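(* Let $k,l$ be positive integers. There exists a map $\theta:\mathcal J^l_k\to\mathcal T^l_k$ such that $$\theta\big(\vec\Pi^l_k(g)\big)=\vec\Pi^l_k(\Theta_*g)\qquad\text{for all }g\in G_k,$$ where $\Theta\in I_0^{k+1}$ is the adjustment diffeomorphism of $g$. If $l<2k$, the map $\theta$ is linear (in $[g]-[b]$). More generally, for any $l'$ with $0\le l'\le l$, the map $\theta$ is linear in $[g]-[b]$ when restricted to jets $[g]\in J^l_k$ which are transverse up to order $l'$ (i.e. which project to elements of $T^{l'}_k$), as long as $l\le k+l'$.
   Context: $\delta$ is the Euclidean metric on $\mathbb R^n$, $\rho(x)=\frac{1-|x|^2}{2}$, $b=\rho^{-2}\delta$ is the hyperbolic metric on $B_1(0)$, $\mathbb S^{n-1}=\partial B_1(0)$. A neighborhood of infinity is an open $U\subset B_1(0)$ containing $B_1(0)\setminus\overline B_{1-\epsilon}(0)$ for some $\epsilon>0$; $\tilde U=U\cup\mathbb S^{n-1}$. $G_k$ is the set of germs at infinity (pairs $(U,g)$, identified if they agree on a smaller neighborhood of infinity) of Riemannian metrics $g$ on $U$ such that $\rho^2g$ extends to a smooth metric on $\tilde U$ with $|g-b|_b=O(\rho^k)$. A germ $g$ is transverse if $g(P,\cdot)=b(P,\cdot)$ near infinity, $P=x^i\partial_i$. $I_0^{k+1}$ is the group of germs at infinity of diffeomorphisms $\Theta:\tilde U\to\Theta(\tilde U)$ (smooth up to $\mathbb S^{n-1}$) with $|\Theta(x)-x|_\delta=O(\rho^{k+1})$. For each $g\in G_k$ there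 is a unique $\Theta\in I_0^{k+1}$ with $\Theta_*g$ transverse (then $\Theta_*g\in G_k$); it is called the adjustment diffeomorphism of $g$. Jets: $J^l_k=G_k/\sim_{l+1}$, where $g_1\sim_{l+1}g_2$ iff $|g_1-g_2|_b=O(\rho^{l+1})$; $[g]$ is the class of $g$ (the same definition is used for $l=0$; if $l<k$ then $J^l_k$ is a single element). A jet is transverse if it has a transverse representative in $G_k$; $T^l_k\subset J^l_k$ is the set of transverse jets. Both are affine spaces with base point $[b]$; $\mathcal J^l_k=J^l_k-[b]$ and $\mathcal T^l_k=T^l_k-[b]$ are the associated vector spaces, and $\vec\Pi^l_k:G_k\to\mathcal J^l_k$ is $\vec\Pi^l_k(g)=[g]-[b]$. For $l'\le l$ there is a natural projection $J^l_k\to J^{l'}_k$. *)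

theory Defs
  imports "HOL-Analysis.Analysis" "HOL-Library.Landau_Symbols"
begin

section \<open>Smooth maps\<close>

text \<open>Maps of class \<open>C\<^sup>k\<close> on an open subset of a finite-dimensional space.\<close>

primrec Ck_on :: "nat \<Rightarrow> 'a::euclidean_space set \<Rightarrow> ('a \<Rightarrow> 'b::real_normed_vector) \<Rightarrow> bool" where
  "Ck_on 0 S f \<longleftrightarrow> continuous_on S f"
| "Ck_on (Suc k) S f \<longleftrightarrow> (\<forall>x\<in>S. f differentiable (at x)) \<and>
     (\<forall>v. Ck_on k S (\<lambda>x. frechet_derivative f (at x) v))"

text \<open>Smoothness on an arbitrary subset of Euclidean space: existence of local smooth
  extensions.  On an open set this is the usual notion; on a relatively open subset of the
  closed unit ball it is smoothness up to the boundary.\<close>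

definition smooth_on :: "'a::euclidean_space set \<Rightarrow> ('a \<Rightarrow> 'b::real_normed_vector) \<Rightarrow> bool" where
  "smooth_on S f \<longleftrightarrow> (\<forall>x\<in>S. \<exists>W F. open W \<and> x \<in> W \<and> (\<forall>k. Ck_on k W F) \<and> (\<forall>y\<in>W \<inter> S. F y = f y))"

definition diffeo_onto_image :: "'a::euclidean_space set \<Rightarrow> ('a \<Rightarrow> 'a) \<Rightarrow> bool" where
  "diffeo_onto_image S f \<longleftrightarrow> smooth_on S f \<and>
     (\<exists>f'. smooth_on (f ` S) f' \<and> (\<forall>x\<in>S. f' (f x) = x))"


section \<open>Neighborhoods of infinity and germs\<close>

text \<open>Infinity is the unit sphere, approached from inside the open unit ball.\<close>

definition nbhd_inf :: "(real^'n) set \<Rightarrow> bool" where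
  "nbhd_inf U \<longleftrightarrow> open U \<and> U \<subseteq> ball 0 1 \<and> (\<exists>\<epsilon>>0. ball 0 1 - cball 0 (1 - \<epsilon>) \<subseteq> U)"

definition with_sphere :: "(real^'n) set \<Rightarrow> (real^'n) set" where
  "with_sphere U = U \<union> sphere 0 1"

definition near_inf :: "(real^'n) filter" where
  "near_inf = filtercomap norm (at_left 1)"

lemma eventually_near_inf:
  "eventually P (near_inf :: (real^'n) filter) \<longleftrightarrow> (\<exists>U. nbhd_inf U \<and> (\<forall>x\<in>U. P x))"
proof
  assume "eventually P near_inf"
  then obtain Q where Q: "eventually Q (at_left (1::real))" "\<And>x. Q (norm x) \<Longrightarrow> P x"
    by (auto simp: near_inf_def eventually_filtercomap)
  then obtain a where a: "a < 1" "\<And>y. a < y \<Longrightarrow> y < 1 \<Longrightarrow> Q y"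
    by (auto simp: eventually_at_left_field)
  let ?U = "ball 0 1 - cball 0 a :: (real^'n) set"
  have "nbhd_inf ?U"
    unfolding nbhd_inf_def using a(1) by (auto intro!: exI[of _ "1 - a"])
  moreover have "\<forall>x\<in>?U. P x" using a Q by auto
  ultimately show "\<exists>U. nbhd_inf U \<and> (\<forall>x\<in>U. P x)" by blast
next
  assume "\<exists>U. nbhd_inf U \<and> (\<forall>x\<in>U. P x)"
  then obtain U \<epsilon> where U: "\<epsilon> > 0" "ball 0 1 - cball 0 (1 - \<epsilon>) \<subseteq> U" "\<forall>x\<in>U. P x"
    by (auto simp: nbhd_inf_def)
  have "eventually (\<lambda>y. 1 - \<epsilon> < y \<and> y < 1) (at_left (1::real))"
    using U(1) by (auto simp: eventually_at_left_field intro!: exI[of _ "1 - \<epsilon>"])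
  moreover have "P x" if "1 - \<epsilon> < norm x \<and> norm x < 1" for x
    using that U by (auto simp: subset_iff)
  ultimately show "eventually P near_inf"
    unfolding near_inf_def eventually_filtercomap by blast
qed

text \<open>A pair \<open>(U, f)\<close> is represented by a total function whose values off \<open>U\<close> are irrelevant,
  so that the germ of \<open>(U, f)\<close> is the class of \<open>f\<close> under agreement on some neighborhood
  of infinity.\<close>

quotient_type ('n, 'b) germ = "(real, 'n::finite) vec \<Rightarrow> 'b" /
    "\<lambda>f g. eventually (\<lambda>x. f x = g x) near_inf"
  morphisms rep_germ germ_of
proof (rule equivpI)
  show "reflp (\<lambda>f g. eventually (\<lambda>x. f x = g x) (near_inf :: (real^'n) filter))"
    by (simp add: reflp_def)
  show "symp (\<lambda>f g. eventually (\<lambda>x. f x = g x) (near_inf :: (real^'n) filter))"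
    by (simp add: symp_def eq_commute)
  show "transp (\<lambda>f g. eventually (\<lambda>x. f x = g x) (near_inf :: (real^'n) filter))"
    unfolding transp_def by (auto elim: eventually_elim2)
qed

instantiation germ :: (finite, real_vector) real_vector
begin

lift_definition zero_germ :: "('a, 'b) germ" is "\<lambda>_. 0" .
lift_definition plus_germ :: "('a, 'b) germ \<Rightarrow> ('a, 'b) germ \<Rightarrow> ('a, 'b) germ"
  is "\<lambda>f g x. f x + g x" by (auto elim: eventually_elim2)
lift_definition minus_germ :: "('a, 'b) germ \<Rightarrow> ('a, 'b) germ \<Rightarrow> ('a, 'b) germ"
  is "\<lambda>f g x. f x - g x" by (auto elim: eventually_elim2)
lift_definition uminus_germ :: "('a, 'b) germ \<Rightarrow> ('a, 'b) germ"
  is "\<lambda>f x. - f x" by (auto elim: eventually_mono)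
lift_definition scaleR_germ :: "real \<Rightarrow> ('a, 'b) germ \<Rightarrow> ('a, 'b) germ"
  is "\<lambda>c f x. c *\<^sub>R f x" by (auto elim: eventually_mono)

instance
  by standard (transfer; simp add: algebra_simps)+

end


section \<open>Metrics\<close>

text \<open>A (0,2)-tensor field is given by its coefficient matrix in the standard coordinates,
  \<open>g(v,w) = v \<bullet> (g x *v w)\<close>.\<close>

type_synonym 'n tensor_field = "real^'n \<Rightarrow> real^'n^'n"
type_synonym 'n tensor_germ = "('n, real^'n^'n) germ"

definition \<rho> :: "real^'n \<Rightarrow> real" where
  "\<rho> x = (1 - (norm x)\<^sup>2) / 2"

definition hyp_metric :: "'n::finite tensor_field" where
  "hyp_metric x = inverse ((\<rho> x)\<^sup>2) *\<^sub>R mat 1"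

definition riemannian_metric_on :: "(real^'n) set \<Rightarrow> 'n::finite tensor_field \<Rightarrow> bool" where
  "riemannian_metric_on S g \<longleftrightarrow> smooth_on S g \<and>
     (\<forall>x\<in>S. transpose (g x) = g x \<and> (\<forall>v. v \<noteq> 0 \<longrightarrow> v \<bullet> (g x *v v) > 0))"

text \<open>The norm of a (0,2)-tensor \<open>h\<close> with respect to the metric \<open>m\<close> at a point:
  \<open>|h|\<^sup>2 = m\<^sup>i\<^sup>p m\<^sup>j\<^sup>q h\<^sub>i\<^sub>j h\<^sub>p\<^sub>q\<close>.\<close>

definition tensor_norm :: "real^'n^'n \<Rightarrow> real^'n^'n \<Rightarrow> real" where
  "tensor_norm m h = sqrt (\<Sum>i\<in>UNIV. \<Sum>j\<in>UNIV. \<Sum>p\<in>UNIV. \<Sum>q\<in>UNIV.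
     matrix_inv m $ i $ p * matrix_inv m $ j $ q * h $ i $ j * h $ p $ q)"

text \<open>\<open>order_b m h\<close> means \<open>|h|\<^sub>b = O(\<rho>\<^sup>m)\<close>.\<close>

lift_definition order_b :: "nat \<Rightarrow> 'n::finite tensor_germ \<Rightarrow> bool"
  is "\<lambda>m h. (\<lambda>x. tensor_norm (hyp_metric x) (h x)) \<in> O[near_inf](\<lambda>x. \<rho> x ^ m)"
  by (rule landau_o.big.in_cong) (auto elim: eventually_mono)

definition metric_germs :: "nat \<Rightarrow> 'n::finite tensor_germ set" where
  "metric_germs k = {germ_of g | g. \<exists>U. nbhd_inf U \<and> riemannian_metric_on U g \<and>
     (\<exists>h. riemannian_metric_on (with_sphere U) h \<and> (\<forall>x\<in>U. h x = (\<rho> x)\<^sup>2 *\<^sub>R g x)) \<and>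
     order_b k (germ_of g - germ_of hyp_metric)}"

text \<open>\<open>x v* g x\<close> is the covector \<open>g(P, _)\<close> for the radial field \<open>P = x\<^sup>i \<partial>\<^sub>i\<close>.\<close>

lift_definition transverse :: "'n::finite tensor_germ \<Rightarrow> bool"
  is "\<lambda>g. eventually (\<lambda>x. x v* g x = x v* hyp_metric x) near_inf"
  by (auto elim: eventually_elim2)


section \<open>Adjustment diffeomorphisms\<close>

definition I0 :: "nat \<Rightarrow> ('n::finite, real^'n) germ set" where
  "I0 m = {germ_of \<phi> | \<phi>. \<exists>U. nbhd_inf U \<and> diffeo_onto_image (with_sphere U) \<phi> \<and>
     (\<lambda>x. norm (\<phi> x - x)) \<in> O[near_inf](\<lambda>x. \<rho> x ^ m)}"

text \<open>Push-forward of the metric \<open>g\<close> on \<open>U\<close> by \<open>\<phi>\<close>, a tensor field on \<open>\<phi> ` U\<close>: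
  \<open>(\<phi>\<^sub>*g)(v,w) = g(A v, A w)\<close> with \<open>A = (D\<phi>)\<^sup>-\<^sup>1\<close>.\<close>

definition push_field ::
    "(real^'n) set \<Rightarrow> (real^'n \<Rightarrow> real^'n) \<Rightarrow> 'n::finite tensor_field \<Rightarrow> 'n tensor_field" where
  "push_field U \<phi> g = (\<lambda>y. let x = inv_into U \<phi> y;
                               A = matrix_inv (matrix (frechet_derivative \<phi> (at x)))
                           in transpose A ** g x ** A)"

text \<open>For \<open>\<Theta>\<close> in \<open>I0 m\<close> with \<open>m > 0\<close>, the resulting germ does not depend on the choice of
  \<open>U\<close> and of the representatives.\<close>

definition push :: "('n::finite, real^'n) germ \<Rightarrow> 'n tensor_germ \<Rightarrow> 'n tensor_germ" where
  "push \<Theta> g = (SOME h. \<exists>U \<phi> f. nbhd_inf U \<and> diffeo_onto_image (with_sphere U) \<phi> \<and>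
     germ_of \<phi> = \<Theta> \<and> germ_of f = g \<and> h = germ_of (push_field U \<phi> f))"

text \<open>Such a germ \<open>\<Theta>\<close> exists and is unique for every \<open>g \<in> metric_germs k\<close> with \<open>k > 0\<close>; the
  predicate says that \<open>\<Theta>\<close> is this germ.\<close>

definition adjustment_diffeo :: "nat \<Rightarrow> 'n::finite tensor_germ \<Rightarrow> ('n, real^'n) germ \<Rightarrow> bool" where
  "adjustment_diffeo k g \<Theta> \<longleftrightarrow> \<Theta> \<in> I0 (k + 1) \<and> transverse (push \<Theta> g)"


section \<open>Jets\<close>

text \<open>The arguments \<open>k l\<close> stand for the lower and the upper index, so \<open>jets k l\<close> is
  \<open>J\<^sub>k\<^sup>l\<close>.\<close>

definition jet_rel :: "nat \<Rightarrow> nat \<Rightarrow> ('n::finite tensor_germ \<times> 'n tensor_germ) set" where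
  "jet_rel k l = {(g1, g2). g1 \<in> metric_germs k \<and> g2 \<in> metric_germs k \<and> order_b (l + 1) (g1 - g2)}"

definition jets :: "nat \<Rightarrow> nat \<Rightarrow> 'n::finite tensor_germ set set" where
  "jets k l = metric_germs k // jet_rel k l"

definition jet :: "nat \<Rightarrow> nat \<Rightarrow> 'n::finite tensor_germ \<Rightarrow> 'n tensor_germ set" where
  "jet k l g = jet_rel k l `` {g}"

definition transverse_jets :: "nat \<Rightarrow> nat \<Rightarrow> 'n::finite tensor_germ set set" where
  "transverse_jets k l = {A \<in> jets k l. \<exists>g\<in>A. transverse g}"

text \<open>The natural projection to \<open>jets k l'\<close>, for \<open>l' \<le> l\<close>.\<close>

definition jet_proj :: "nat \<Rightarrow> nat \<Rightarrow> 'n::finite tensor_germ set \<Rightarrow> 'n tensor_germ set" where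
  "jet_proj k l' A = (\<Union>g\<in>A. jet k l' g)"

text \<open>Differences of \<open>l\<close>-jets are classes of tensor germs modulo \<open>O(\<rho>\<^sup>l\<^sup>+\<^sup>1)\<close>; the vector space
  operations are those of the quotient of the space of tensor germs by this subspace.\<close>

definition vec_class :: "nat \<Rightarrow> 'n::finite tensor_germ \<Rightarrow> 'n tensor_germ set" where
  "vec_class l h = {h'. order_b (l + 1) (h' - h)}"

definition vec_add :: "nat \<Rightarrow> 'n::finite tensor_germ set \<Rightarrow> 'n tensor_germ set \<Rightarrow> 'n tensor_germ set" where
  "vec_add l A B = (\<Union>h1\<in>A. \<Union>h2\<in>B. vec_class l (h1 + h2))"

definition vec_scale :: "nat \<Rightarrow> real \<Rightarrow> 'n::finite tensor_germ set \<Rightarrow> 'n tensor_germ set" where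
  "vec_scale l c A = (\<Union>h\<in>A. vec_class l (c *\<^sub>R h))"

definition jet_diff :: "nat \<Rightarrow> 'n::finite tensor_germ set \<Rightarrow> 'n tensor_germ set \<Rightarrow> 'n tensor_germ set" where
  "jet_diff l A B = (\<Union>g1\<in>A. \<Union>g2\<in>B. vec_class l (g1 - g2))"

definition \<J> :: "nat \<Rightarrow> nat \<Rightarrow> 'n::finite tensor_germ set set" where
  "\<J> k l = (\<lambda>A. jet_diff l A (jet k l (germ_of hyp_metric))) ` jets k l"

definition \<T> :: "nat \<Rightarrow> nat \<Rightarrow> 'n::finite tensor_germ set set" where
  "\<T> k l = (\<lambda>A. jet_diff l A (jet k l (germ_of hyp_metric))) ` transverse_jets k l"

definition jet_vec :: "nat \<Rightarrow> nat \<Rightarrow> 'n::finite tensor_germ \<Rightarrow> 'n tensor_germ set" where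
  "jet_vec k l g = jet_diff l (jet k l g) (jet k l (germ_of hyp_metric))"

text \<open>Those elements \<open>[g] - [b]\<close> of \<open>\<J> k l\<close> for which \<open>[g]\<close> is transverse up to order \<open>l'\<close>.\<close>

definition \<J>_transverse_upto :: "nat \<Rightarrow> nat \<Rightarrow> nat \<Rightarrow> 'n::finite tensor_germ set set" where
  "\<J>_transverse_upto k l l' =
     (\<lambda>A. jet_diff l A (jet k l (germ_of hyp_metric))) ` {A \<in> jets k l. jet_proj k l' A \<in> transverse_jets k l'}"

text \<open>\<open>S\<close> is a linear subspace and \<open>\<theta>\<close> is linear on it.\<close>

definition linear_on_jets ::
    "nat \<Rightarrow> 'n::finite tensor_germ set set \<Rightarrow> ('n tensor_germ set \<Rightarrow> 'n tensor_germ set) \<Rightarrow> bool" where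
  "linear_on_jets l S \<theta> \<longleftrightarrow>
     (\<forall>A\<in>S. \<forall>B\<in>S. vec_add l A B \<in> S \<and> \<theta> (vec_add l A B) = vec_add l (\<theta> A) (\<theta> B)) \<and>
     (\<forall>c. \<forall>A\<in>S. vec_scale l c A \<in> S \<and> \<theta> (vec_scale l c A) = vec_scale l c (\<theta> A))"


section \<open>Consistency of the definitions\<close>

lemma matrix_inv_hyp:
  assumes "norm (x::real^'n) < 1"
  shows "matrix_inv (hyp_metric x) = (\<rho> x)\<^sup>2 *\<^sub>R mat 1"
proof -
  have "(norm x)\<^sup>2 < 1" using assms by (simp add: abs_square_less_1)
  hence r: "\<rho> x \<noteq> 0" by (simp add: \<rho>_def)
  have 1: "hyp_metric x ** ((\<rho> x)\<^sup>2 *\<^sub>R mat 1) = mat 1" "((\<rho> x)\<^sup>2 *\<^sub>R mat 1) ** hyp_metric x = mat 1"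
    using r by (simp_all add: hyp_metric_def matrix_scalar_ac flip: scalar_matrix_assoc)
  hence "invertible (hyp_metric x)" unfolding invertible_def by blast
  hence "hyp_metric x ** matrix_inv (hyp_metric x) = mat 1"
    unfolding invertible_def matrix_inv_def by (metis (mono_tags, lifting) someI_ex)
  thus ?thesis using 1(2) by (metis matrix_mul_assoc matrix_mul_lid matrix_mul_rid)
qed

lemma tensor_norm_hyp_metric:
  assumes "norm (x::real^'n) < 1"
  shows "tensor_norm (hyp_metric x) h = (\<rho> x)\<^sup>2 * norm h"
proof -
  have *: "(\<Sum>p\<in>UNIV. \<Sum>q\<in>UNIV. matrix_inv (hyp_metric x) $ i $ p * matrix_inv (hyp_metric x) $ j $ q * h $ i $ j * h $ p $ q)
     = (\<rho> x)^4 * (h $ i $ j)\<^sup>2" for i j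
  proof -
    have "(\<Sum>p\<in>UNIV. \<Sum>q\<in>UNIV. matrix_inv (hyp_metric x) $ i $ p * matrix_inv (hyp_metric x) $ j $ q * h $ i $ j * h $ p $ q)
      = (\<Sum>p\<in>UNIV. \<Sum>q\<in>UNIV. if q = j then (if p = i then (\<rho> x)^4 * (h $ i $ j)\<^sup>2 else 0) else 0)"
      unfolding matrix_inv_hyp[OF assms]
      by (intro sum.cong refl) (auto simp: mat_def power2_eq_square power4_eq_xxxx)
    thus ?thesis by simp
  qed
  have "tensor_norm (hyp_metric x) h = sqrt ((\<rho> x)^4 * (\<Sum>i\<in>UNIV. \<Sum>j\<in>UNIV. (h $ i $ j)\<^sup>2))"
    unfolding tensor_norm_def * by (simp add: sum_distrib_left)
  also have "sqrt ((\<rho> x)^4) = (\<rho> x)\<^sup>2" by (rule real_sqrt_unique) auto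
  hence "sqrt ((\<rho> x)^4 * (\<Sum>i\<in>UNIV. \<Sum>j\<in>UNIV. (h $ i $ j)\<^sup>2)) = (\<rho> x)\<^sup>2 * norm h"
    by (simp add: real_sqrt_mult norm_vec_def L2_set_def sum_nonneg)
  finally show ?thesis .
qed

lemma order_b_germ:
  "order_b m (germ_of h) \<longleftrightarrow> (\<lambda>x. (\<rho> x)\<^sup>2 * norm (h x)) \<in> O[near_inf](\<lambda>x. \<rho> x ^ m)"
proof -
  have "eventually (\<lambda>x. tensor_norm (hyp_metric x) (h x) = (\<rho> x)\<^sup>2 * norm (h x)) near_inf"
    unfolding eventually_near_inf
    by (rule exI[of _ "ball 0 1"])
       (auto simp: nbhd_inf_def tensor_norm_hyp_metric intro: exI[of _ 1])
  thus ?thesis unfolding order_b.abs_eq by (rule landau_o.big.in_cong)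
qed

lemma order_b_0: "order_b m 0"
  by (simp add: zero_germ_def order_b_germ)

lemma order_b_scale: "order_b m h \<Longrightarrow> order_b m (c *\<^sub>R h)"
proof (induction h rule: germ.abs_induct)
  case (1 h)
  have "(\<lambda>x. \<bar>c\<bar> * ((\<rho> x)\<^sup>2 * norm (h x))) \<in> O[near_inf](\<lambda>x. \<rho> x ^ m)"
    using 1 unfolding order_b_germ by simp
  thus ?case unfolding scaleR_germ.abs_eq order_b_germ by (simp add: mult_ac)
qed

lemma order_b_add: "order_b m h \<Longrightarrow> order_b m h' \<Longrightarrow> order_b m (h + h')"
proof (induction h rule: germ.abs_induct, induction h' rule: germ.abs_induct)
  case (1 h h')
  have "(\<lambda>x. (\<rho> x)\<^sup>2 * norm (h' x) + (\<rho> x)\<^sup>2 * norm (h x)) \<in> O[near_inf](\<lambda>x. \<rho> x ^ m)"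
    using 1 unfolding order_b_germ by (intro sum_in_bigo)
  moreover have "(\<lambda>x. (\<rho> x)\<^sup>2 * norm (h' x + h x)) \<in> O[near_inf](\<lambda>x. (\<rho> x)\<^sup>2 * norm (h' x) + (\<rho> x)\<^sup>2 * norm (h x))"
    by (intro landau_o.big_mono always_eventually allI)
       (auto simp: abs_mult abs_of_nonneg norm_triangle_ineq mult_left_mono simp flip: distrib_left)
  ultimately show ?case unfolding plus_germ.abs_eq order_b_germ
    by (metis (no_types, lifting) landau_o.big.trans)
qed

lemma order_b_diff: "order_b m h \<Longrightarrow> order_b m h' \<Longrightarrow> order_b m (h - h')"
  using order_b_add[of m h "- h'"] order_b_scale[of m h' "-1"] by simp

lemma order_b_minus_commute: "order_b m (h - h') \<Longrightarrow> order_b m (h' - h)"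
  using order_b_scale[of m "h - h'" "-1"] by simp

lemma order_b_trans: "order_b m (h1 - h2) \<Longrightarrow> order_b m (h2 - h3) \<Longrightarrow> order_b m (h1 - h3)"
  using order_b_add[of m "h1 - h2" "h2 - h3"] by simp

lemma equiv_jet_rel: "equiv (metric_germs k) (jet_rel k l)"
proof (rule equivI)
  show "sym (jet_rel k l)"
    by (auto simp: jet_rel_def sym_def order_b_minus_commute)
  show "trans (jet_rel k l)"
    unfolding jet_rel_def by (rule transI) (use order_b_trans in blast)
qed (auto simp: jet_rel_def refl_on_def order_b_0)

lemma vec_class_eq_iff: "vec_class l h = vec_class l h' \<longleftrightarrow> order_b (l + 1) (h - h')"
proof
  assume "vec_class l h = vec_class l h'"
  moreover have "h \<in> vec_class l h" by (simp add: vec_class_def order_b_0)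
  ultimately show "order_b (l + 1) (h - h')" by (simp add: vec_class_def)
next
  assume *: "order_b (l + 1) (h - h')"
  have "order_b (l + 1) (u - h) \<longleftrightarrow> order_b (l + 1) (u - h')" for u
    using * order_b_trans order_b_minus_commute by blast
  thus "vec_class l h = vec_class l h'" by (simp add: vec_class_def)
qed

lemma vec_add_class: "vec_add l (vec_class l h1) (vec_class l h2) = vec_class l (h1 + h2)"
proof -
  have "vec_class l (u1 + u2) = vec_class l (h1 + h2)"
    if "u1 \<in> vec_class l h1" "u2 \<in> vec_class l h2" for u1 u2
    using that order_b_add[of "l + 1" "u1 - h1" "u2 - h2"]
    unfolding vec_class_eq_iff by (simp add: vec_class_def add_diff_add)
  moreover have "h \<in> vec_class l h" for h :: "'a tensor_germ"
    by (simp add: vec_class_def order_b_0)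
  ultimately show ?thesis unfolding vec_add_def by blast
qed

lemma vec_scale_class: "vec_scale l c (vec_class l h) = vec_class l (c *\<^sub>R h)"
proof -
  have "vec_class l (c *\<^sub>R u) = vec_class l (c *\<^sub>R h)" if "u \<in> vec_class l h" for u
    using that order_b_scale[of "l + 1" "u - h" c]
    unfolding vec_class_eq_iff by (simp add: vec_class_def scaleR_diff_right)
  moreover have "h \<in> vec_class l h" by (simp add: vec_class_def order_b_0)
  ultimately show ?thesis unfolding vec_scale_def by blast
qed

lemma jet_diff_jet:
  assumes "g1 \<in> metric_germs k" "g2 \<in> metric_germs k"
  shows "jet_diff l (jet k l g1) (jet k l g2) = vec_class l (g1 - g2)"
proof -
  have "vec_class l (u1 - u2) = vec_class l (g1 - g2)"
    if "u1 \<in> jet k l g1" "u2 \<in> jet k l g2" for u1 u2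
  proof -
    have "order_b (l + 1) (u1 - g1)" "order_b (l + 1) (u2 - g2)"
      using that by (auto simp: jet_def jet_rel_def intro: order_b_minus_commute)
    hence "order_b (l + 1) ((u1 - g1) - (u2 - g2))" by (rule order_b_diff)
    moreover have "(u1 - g1) - (u2 - g2) = (u1 - u2) - (g1 - g2)" by simp
    ultimately show ?thesis unfolding vec_class_eq_iff by metis
  qed
  moreover have "g1 \<in> jet k l g1" "g2 \<in> jet k l g2"
    using assms by (auto simp: jet_def jet_rel_def order_b_0)
  ultimately show ?thesis unfolding jet_diff_def by blast
qed

end

theory Submission
  imports Defs
begin

text \<open>
  Write a metric as \<open>g = \<rho>\<^sup>-\<^sup>2 (1 + H)\<close>; then \<open>g\<close> belongs to \<open>G\<^sub>k\<close> iff \<open>H\<close> is symmetric, smooth up to the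
  sphere and \<open>O(\<rho>\<^sup>k)\<close>. By Hadamard's lemma every such \<open>H\<close> is \<open>\<rho>\<^sup>k\<close> times a smooth function, so
  differentiation costs one power of \<open>\<rho>\<close>. If \<open>\<phi> = id + u\<close> with \<open>u = O(\<rho>\<^sup>q\<^sup>+\<^sup>1)\<close> and \<open>q \<ge> k\<close>, then pulling
  back by \<open>\<phi>\<close> changes \<open>H\<close> by \<open>\<rho>\<^sup>2\<close> times the Lie derivative of \<open>b\<close> along \<open>u\<close>, up to \<open>O(\<rho>\<^sup>k\<^sup>+\<^sup>q)\<close>. The
  leading coefficient of this Lie derivative, contracted with the radial field, determines that of \<open>u\<close>.
  Hence, order by order: two transverse metrics related by \<open>\<phi>\<close> up to \<open>O(\<rho>\<^sup>l\<^sup>+\<^sup>1)\<close> agree to that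
  order and \<open>u = O(\<rho>\<^sup>l\<^sup>+\<^sup>2)\<close>, which makes \<open>\<theta>\<close> well defined; and every \<open>H\<close> can be made transverse to
  any given order by subtracting a Lie derivative, uniquely, which defines a linear map of jets.
  If \<open>g\<close> is transverse up to order \<open>l'\<close>, its adjustment has \<open>q \<ge> l' + 1\<close>, so the nonlinear error is
  \<open>O(\<rho>\<^sup>k\<^sup>+\<^sup>l\<^sup>'\<^sup>+\<^sup>1)\<close> and \<open>\<theta>\<close> coincides with the linear map for \<open>l \<le> k + l'\<close>. For \<open>l < 2 k\<close> take
  \<open>l' = k - 1\<close>. Only jets that come with an adjustment diffeomorphism constrain \<open>\<theta>\<close> nonlinearly; the
  linear map serves for all others, so the existence of adjustments is never needed.
\<close>

subsection \<open>Calculus of smooth maps on open sets\<close>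

text \<open>On the unit sphere, contracting the leading coefficient with the radial field multiplies
  the normal component of a gauge field of order m + 1 by -2 m and the tangential components by -(m
  + 1). Only m = 0 is degenerate, which is why the whole argument lives above k > 0. This algebra
  solves transversality on the sphere itself, while transversality is demanded on a whole collar;
  that gap is what the projection in the linear step closes, at the cost of a term one order higher.
  The nonlinear expansion is always made around the transverse metric: the given metric is the
  pull-back of its own adjustment, so that H = T + Lie u + error with T the adjusted metric. Mixed
  terms in the metric and the field have order k + q and terms quadratic in the field have order 2
  q, so q \<ge> k is what merges them into one error. For a given l the smallest admissible l' is l
  - k in truncated subtraction, and its set of jets contains those of all larger l'. One map can
  therefore serve every l' at once: it only has to be linear on that largest set.\<close>

lemma frechet_derivative_cong_open:
  assumes "open S" "x \<in> S" "\<And>x. x \<in> S \<Longrightarrow> f x = g x"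
  shows "frechet_derivative f (at x) = frechet_derivative g (at x)"
proof -
  have "(f has_derivative f') (at x) \<longleftrightarrow> (g has_derivative f') (at x)" for f'
    using has_derivative_transform_within_open[of f f' x UNIV S g]
      has_derivative_transform_within_open[of g f' x UNIV S f] assms by auto
  thus ?thesis by (simp add: frechet_derivative_def)
qed

lemma Ck_on_cong:
  assumes "open S" "\<And>x. x \<in> S \<Longrightarrow> f x = g x" "Ck_on k S f"
  shows "Ck_on k S g"
  using assms(2,3)
proof (induction k arbitrary: f g)
  case 0
  thus ?case using continuous_on_eq[of S f g] by simp
next
  case (Suc k)
  have "g differentiable (at x)" if "x \<in> S" for x
  proof -
    have "f differentiable (at x)" using Suc.prems(2) that by simp
    then obtain f' where "(f has_derivative f') (at x)"
      unfolding differentiable_def by (elim exE)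
    hence "(g has_derivative f') (at x)"
      by (rule has_derivative_transform_within_open[OF _ assms(1) that]) (rule Suc.prems(1))
    thus ?thesis by (auto simp: differentiable_def)
  qed
  moreover have "Ck_on k S (\<lambda>x. frechet_derivative g (at x) v)" for v
    by (rule Suc.IH[of "\<lambda>x. frechet_derivative f (at x) v"])
      (use Suc.prems frechet_derivative_cong_open[OF assms(1), of _ f g] in auto)
  ultimately show ?case by simp
qed

text \<open>\<open>Ck_on\<close> refers to the chosen \<open>frechet_derivative\<close>; with this
  rule the closure properties that follow are proved from an explicit derivative formula and
  induction on the order.\<close>

lemma Ck_on_Suc:
  assumes "open S" "\<And>x. x \<in> S \<Longrightarrow> (f has_derivative f' x) (at x)"
    and "\<And>v. Ck_on k S (\<lambda>x. f' x v)"
  shows "Ck_on (Suc k) S f"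
proof -
  have *: "f' x = frechet_derivative f (at x)" if "x \<in> S" for x
    by (rule frechet_derivative_at) (use assms that in auto)
  have "Ck_on k S (\<lambda>x. frechet_derivative f (at x) v)" for v
    by (rule Ck_on_cong[OF assms(1) _ assms(3)[of v]]) (simp add: *)
  moreover have "f differentiable (at x)" if "x \<in> S" for x
    using assms(2)[OF that] by (rule differentiableI)
  ultimately show ?thesis by simp
qed

lemma Ck_on_SucD: "Ck_on (Suc k) S f \<Longrightarrow> Ck_on k S f"
proof (induction k arbitrary: f)
  case 0
  hence "\<forall>x\<in>S. f differentiable (at x)" by simp
  thus ?case
    by (auto intro!: continuous_at_imp_continuous_on differentiable_imp_continuous_within)
qed auto

lemma Ck_on_has_derivative:
  "Ck_on (Suc k) S f \<Longrightarrow> x \<in> S \<Longrightarrow> (f has_derivative frechet_derivative f (at x)) (at x)"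
  by (simp add: frechet_derivative_works)

lemma Ck_on_subset: "Ck_on k S f \<Longrightarrow> T \<subseteq> S \<Longrightarrow> Ck_on k T f"
  by (induction k arbitrary: f) (auto intro: continuous_on_subset)

lemma Ck_on_const: "open S \<Longrightarrow> Ck_on k S (\<lambda>x. c)"
  by (induction k arbitrary: c) (auto intro!: Ck_on_Suc[where f' = "\<lambda>_ _. 0"])

lemma Ck_on_linear_comp:
  assumes "open S" "bounded_linear L" "Ck_on k S f"
  shows "Ck_on k S (\<lambda>x. L (f x))"
  using assms(3)
proof (induction k arbitrary: f)
  case 0
  then show ?case
    by (simp add: bounded_linear.continuous_on[OF assms(2)])
next
  case (Suc k)
  show ?case
    by (rule Ck_on_Suc[OF assms(1) bounded_linear.has_derivative[OF assms(2) Ck_on_has_derivative[OF Suc.prems]]])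
      (use Suc in auto)
qed

lemma Ck_on_id: "open S \<Longrightarrow> Ck_on k S (\<lambda>x. x)"
  by (cases k) (auto intro!: Ck_on_Suc[where f' = "\<lambda>_ v. v"] Ck_on_const)

lemma Ck_on_linear: "open S \<Longrightarrow> bounded_linear L \<Longrightarrow> Ck_on k S L"
  using Ck_on_linear_comp[OF _ _ Ck_on_id] by blast

lemma Ck_on_add:
  assumes "open S" "Ck_on k S f" "Ck_on k S g"
  shows "Ck_on k S (\<lambda>x. f x + g x)"
  using assms(2,3)
proof (induction k arbitrary: f g)
  case 0
  then show ?case by (simp add: continuous_on_add)
next
  case (Suc k)
  show ?case
    by (rule Ck_on_Suc[OF assms(1) has_derivative_add[OF Ck_on_has_derivative[OF Suc.prems(1)] Ck_on_has_derivative[OF Suc.prems(2)]]])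
      (use Suc in auto)
qed

lemma Ck_on_sum:
  assumes "open S" "finite I" "\<And>i. i \<in> I \<Longrightarrow> Ck_on k S (f i)"
  shows "Ck_on k S (\<lambda>x. \<Sum>i\<in>I. f i x)"
  using assms(2,3) by (induction I rule: finite_induct) (auto intro: Ck_on_const Ck_on_add assms)

lemma Ck_on_bilinear:
  assumes "open S" "bounded_bilinear prd" "Ck_on k S f" "Ck_on k S g"
  shows "Ck_on k S (\<lambda>x. prd (f x) (g x))"
  using assms(3,4)
proof (induction k arbitrary: f g)
  case 0
  then show ?case by (simp add: bounded_bilinear.continuous_on[OF assms(2)])
next
  case (Suc k)
  have "Ck_on k S (\<lambda>x. frechet_derivative f (at x) v)" "Ck_on k S (\<lambda>x. frechet_derivative g (at x) v)" for v
    using Suc.prems by simp_all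
  hence "Ck_on k S (\<lambda>x. prd (f x) (frechet_derivative g (at x) v) + prd (frechet_derivative f (at x) v) (g x))" for v
    by (intro Ck_on_add[OF assms(1)] Suc.IH Ck_on_SucD[OF Suc.prems(1)] Ck_on_SucD[OF Suc.prems(2)])
  thus ?case
    by (intro Ck_on_Suc[OF assms(1) bounded_bilinear.FDERIV[OF assms(2) Ck_on_has_derivative[OF Suc.prems(1)] Ck_on_has_derivative[OF Suc.prems(2)]]])
qed

text \<open>In the chain rule the direction in which \<open>g\<close> is differentiated varies with
  x, whereas \<open>Ck_on\<close> speaks of fixed directions only. Expanding it in
  \<open>Basis\<close> leaves derivatives of \<open>g\<close> in fixed directions, composed with
  \<open>f\<close>, to which the induction hypothesis applies.\<close>

lemma Ck_on_compose:
  fixes f :: "'a::euclidean_space \<Rightarrow> 'b::euclidean_space"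
  assumes "open S" "open T" "Ck_on k S f" "f ` S \<subseteq> T" "Ck_on k T g"
  shows "Ck_on k S (\<lambda>x. g (f x))"
  using assms(3,5)
proof (induction k arbitrary: g)
  case 0
  then show ?case using assms(4) by (auto intro: continuous_on_compose2)
next
  case (Suc k)
  have d: "((\<lambda>x. g (f x)) has_derivative (\<lambda>v. frechet_derivative g (at (f x)) (frechet_derivative f (at x) v))) (at x)"
    if "x \<in> S" for x
    using has_derivative_compose[OF Ck_on_has_derivative[OF Suc.prems(1) that] Ck_on_has_derivative[OF Suc.prems(2)]]
      that assms(4) by auto
  have e: "(\<Sum>i\<in>Basis. (frechet_derivative f (at x) v \<bullet> i) *\<^sub>R frechet_derivative g (at (f x)) i)
     = frechet_derivative g (at (f x)) (frechet_derivative f (at x) v)" if "x \<in> S" for x v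
  proof -
    have "linear (frechet_derivative g (at (f x)))"
      using Suc.prems(2) that assms(4) by (auto intro: linear_frechet_derivative)
    hence "(\<Sum>i\<in>Basis. (w \<bullet> i) *\<^sub>R frechet_derivative g (at (f x)) i)
        = frechet_derivative g (at (f x)) (\<Sum>i\<in>Basis. (w \<bullet> i) *\<^sub>R i)" for w
      by (simp add: linear_sum linear_scale)
    thus ?thesis by (simp add: euclidean_representation)
  qed
  have "Ck_on k S (\<lambda>x. \<Sum>i\<in>Basis. (frechet_derivative f (at x) v \<bullet> i) *\<^sub>R frechet_derivative g (at (f x)) i)" for v
  proof (rule Ck_on_sum[OF assms(1) finite_Basis])
    fix i :: 'b
    have "Ck_on k S (\<lambda>x. frechet_derivative g (at (f x)) i)"
      using Suc.IH[of "\<lambda>y. frechet_derivative g (at y) i"] Suc.prems Ck_on_SucD by auto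
    moreover have "Ck_on k S (\<lambda>x. frechet_derivative f (at x) v \<bullet> i)"
      by (rule Ck_on_linear_comp[OF assms(1) bounded_linear_inner_left]) (use Suc.prems in simp)
    ultimately show "Ck_on k S (\<lambda>x. (frechet_derivative f (at x) v \<bullet> i) *\<^sub>R frechet_derivative g (at (f x)) i)"
      by (rule Ck_on_bilinear[OF assms(1) bounded_bilinear_scaleR, rotated])
  qed
  hence "Ck_on k S (\<lambda>x. frechet_derivative g (at (f x)) (frechet_derivative f (at x) v))" for v
    by (rule Ck_on_cong[OF assms(1), rotated]) (simp add: e)
  thus ?case by (intro Ck_on_Suc[OF assms(1) d])
qed

lemma Ck_on_inverse:
  fixes f :: "'a::euclidean_space \<Rightarrow> real"
  assumes "open S" "Ck_on k S f" "\<And>x. x \<in> S \<Longrightarrow> f x \<noteq> 0"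
  shows "Ck_on k S (\<lambda>x. inverse (f x))"
  using assms(2)
proof (induction k)
  case 0
  then show ?case using assms(3) by (auto intro: continuous_on_inverse)
next
  case (Suc k)
  have "Ck_on k S (\<lambda>x. inverse (f x))" using Suc Ck_on_SucD by blast
  moreover have "Ck_on k S (\<lambda>x. frechet_derivative f (at x) v)" for v using Suc.prems by simp
  ultimately have "Ck_on k S (\<lambda>x. - (inverse (f x) * frechet_derivative f (at x) v * inverse (f x)))" for v
    by (intro Ck_on_linear_comp[OF assms(1) bounded_linear_minus[OF bounded_linear_ident]]
          Ck_on_bilinear[OF assms(1) bounded_bilinear_mult])
  thus ?case
    by (intro Ck_on_Suc[OF assms(1) Deriv.has_derivative_inverse[OF assms(3) Ck_on_has_derivative[OF Suc.prems]]]) auto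
qed

text \<open>The reciprocal norm comes before the norm because its derivatives in fixed directions
  are polynomial in x and the reciprocal norm itself, so that the induction closes; the norm is then
  (x . x) / |x|.\<close>

lemma Ck_on_inverse_norm:
  assumes "open S" "0 \<notin> S"
  shows "Ck_on k S (\<lambda>x::'a::euclidean_space. inverse (norm x))"
proof (induction k)
  case 0
  then show ?case using assms by (auto intro!: continuous_intros)
next
  case (Suc k)
  have "((\<lambda>x. inverse (norm x)) has_derivative (\<lambda>v. - (inverse (norm x) * (sgn x \<bullet> v) * inverse (norm x)))) (at x)" if "x \<in> S" for x
  proof -
    have "x \<noteq> 0" using that assms by auto
    hence "(norm has_derivative (\<lambda>v. sgn x \<bullet> v)) (at x)"
      using has_derivative_norm[of x] by (simp add: inner_commute)
    thus ?thesis using \<open>x \<noteq> 0\<close> by (intro Deriv.has_derivative_inverse) auto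
  qed
  moreover have "Ck_on k S (\<lambda>x. - (inverse (norm x) * ((inverse (norm x) *\<^sub>R x) \<bullet> v) * inverse (norm x)))" for v
    by (intro Ck_on_linear_comp[OF assms(1) bounded_linear_minus[OF bounded_linear_ident]]
          Ck_on_bilinear[OF assms(1) bounded_bilinear_mult]
          Ck_on_bilinear[OF assms(1) bounded_bilinear_inner] Ck_on_const Suc
          Ck_on_bilinear[OF assms(1) bounded_bilinear_scaleR] Ck_on_id assms)
  ultimately show ?case by (intro Ck_on_Suc[OF assms(1)]) (auto simp: sgn_div_norm)
qed

text \<open>The derivative of the integrand in x along v is its total derivative along (v, 0), again
  an integrand of the same kind, so differentiation under the integral can be iterated.
  \<open>T\<close> is an open set around [0, 1] because \<open>Ck_on\<close> differentiates at the
  endpoints too.\<close>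

lemma Ck_on_param_integral:
  fixes G :: "'a::euclidean_space \<times> real \<Rightarrow> 'b::euclidean_space"
  assumes "open S" "open T" "{0..1} \<subseteq> T" "Ck_on k (S \<times> T) G"
  shows "Ck_on k S (\<lambda>x. integral {0..1} (\<lambda>t. G (x, t)))"
  using assms(4)
proof (induction k arbitrary: G)
  case 0
  have "continuous_on (S \<times> {0..1}) (\<lambda>(x, t). G (x, t))"
    using 0 assms(3) by (auto intro: continuous_on_subset)
  thus ?case
    using integral_continuous_on_param[of S 0 "1::real" "\<lambda>x t. G (x, t)"] by simp
next
  case (Suc k)
  define D where "D z = frechet_derivative G (at z)" for z
  have cD: "Ck_on k (S \<times> T) (\<lambda>z. D z v)" for v using Suc.prems by (cases v) (simp add: D_def)
  have cD0: "continuous_on (S \<times> T) (\<lambda>z. D z v)" for v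
  proof -
    have "Ck_on n X f \<Longrightarrow> Ck_on 0 X f" for n X and f :: "'a \<times> real \<Rightarrow> 'b"
      by (induction n) (use Ck_on_SucD in blast)+
    thus ?thesis using cD by (metis Ck_on.simps(1))
  qed
  have dG: "(G has_derivative D z) (at z)" if "z \<in> S \<times> T" for z
    using Ck_on_has_derivative[OF Suc.prems that] by (simp add: D_def)
  have dx: "((\<lambda>x. G (x, t)) has_derivative (\<lambda>v. D (x, t) (v, 0))) (at x)" if "x \<in> S" "t \<in> T" for x t
  proof -
    have "((\<lambda>x. (x, t)) has_derivative (\<lambda>v. (v, 0))) (at x)" by (auto intro!: derivative_eq_intros)
    from has_derivative_compose[OF this dG] that show ?thesis by simp
  qed
  \<comment> \<open>The Leibniz rule asks for a derivative that is continuous as a map into bounded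
    operators. In finite dimension this continuity can be checked on basis vectors.\<close>
  define E where "E x t = Blinfun (\<lambda>v. D (x, t) (v, 0))" for x t
  have E: "blinfun_apply (E x t) = (\<lambda>v. D (x, t) (v, 0))" if "x \<in> S" "t \<in> T" for x t
    unfolding E_def using dx[OF that] by (intro bounded_linear_Blinfun_apply) (simp add: has_derivative_bounded_linear)
  have cE: "continuous_on (S \<times> {0..1}) (\<lambda>(x, t). E x t)"
  proof (rule continuous_on_blinfun_componentwise)
    fix i :: 'a assume "i \<in> Basis"
    have "continuous_on (S \<times> {0..1}) (\<lambda>z. D z (i, 0))"
      using cD0 assms(3) by (auto intro: continuous_on_subset)
    thus "continuous_on (S \<times> {0..1}) (\<lambda>z. blinfun_apply (case z of (x, t) \<Rightarrow> E x t) i)"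
      by (rule continuous_on_eq) (use E assms(3) in auto)
  qed
  have "((\<lambda>x. integral {0..1} (\<lambda>t. G (x, t))) has_derivative (\<lambda>v. integral {0..1} (\<lambda>t. D (x, t) (v, 0)))) (at x)"
    if x: "x \<in> S" for x
  proof -
    obtain e where e: "e > 0" "ball x e \<subseteq> S" using assms(1) x open_contains_ball by blast
    have "((\<lambda>x. integral (cbox 0 1) (\<lambda>t. G (x, t))) has_derivative blinfun_apply (integral (cbox 0 1) (E x))) (at x within ball x e)"
    proof (rule leibniz_rule[where fx = E])
      show "((\<lambda>x. G (x, t)) has_derivative blinfun_apply (E y t)) (at y within ball x e)"
        if "y \<in> ball x e" "t \<in> cbox 0 1" for y t
      proof -
        have "y \<in> S" "t \<in> T" using that e assms(3) by (auto simp: subset_iff)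
        thus ?thesis using dx[of y t] E[of y t] by (auto intro: has_derivative_at_withinI)
      qed
      show "(\<lambda>t. G (y, t)) integrable_on cbox 0 1" if "y \<in> ball x e" for y
      proof (rule integrable_continuous)
        have "continuous_on (S \<times> T) G"
          using dG by (meson continuous_at_imp_continuous_on has_derivative_continuous)
        thus "continuous_on (cbox 0 1) (\<lambda>t. G (y, t))"
          by (rule continuous_on_compose2) (use that e assms(3) in \<open>auto intro!: continuous_intros\<close>)
      qed
      show "continuous_on (ball x e \<times> cbox 0 1) (\<lambda>(x, t). E x t)"
        using cE by (rule continuous_on_subset) (use e in auto)
    qed (use e in auto)
    moreover have blin: "blinfun_apply (integral (cbox 0 1) (E x)) v = integral {0..1} (\<lambda>t. D (x, t) (v, 0))" for v
    proof -
      have "continuous_on (cbox 0 1) (\<lambda>t. E x t)"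
        by (rule continuous_on_compose2[OF cE, of _ "\<lambda>t. (x, t)", simplified]) (use x in \<open>auto intro!: continuous_intros\<close>)
      hence "E x integrable_on cbox 0 1" by (rule integrable_continuous)
      hence "blinfun_apply (integral (cbox 0 1) (E x)) v = integral (cbox 0 1) (\<lambda>t. E x t v)"
        by (rule blinfun_apply_integral)
      also have "\<dots> = integral {0..1} (\<lambda>t. D (x, t) (v, 0))"
        unfolding box_real by (rule integral_cong) (use E x assms(3) in auto)
      finally show ?thesis .
    qed
    moreover have "at x within ball x e = at x" using e by (intro at_within_open) auto
    moreover have "blinfun_apply (integral (cbox 0 1) (E x)) = (\<lambda>v. integral {0..1} (\<lambda>t. D (x, t) (v, 0)))"
      using blin by (rule ext)
    ultimately show ?thesis by simp
  qed
  moreover have "Ck_on k S (\<lambda>x. integral {0..1} (\<lambda>t. D (x, t) (v, 0)))" for v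
    by (rule Suc.IH[of "\<lambda>z. D z (v, 0)"]) (rule cD)
  ultimately show ?case by (intro Ck_on_Suc[OF assms(1)])
qed

section \<open>Smoothness of all orders and Hadamard's lemma\<close>

definition Cinf :: "'a::euclidean_space set \<Rightarrow> ('a \<Rightarrow> 'b::real_normed_vector) \<Rightarrow> bool" where
  "Cinf W f \<longleftrightarrow> (\<forall>k. Ck_on k W f)"

lemma Cinf_derivative: "Cinf W f \<Longrightarrow> Cinf W (\<lambda>x. frechet_derivative f (at x) v)"
  unfolding Cinf_def using Ck_on.simps(2) by blast

lemma Cinf_has_derivative:
  "Cinf W f \<Longrightarrow> x \<in> W \<Longrightarrow> (f has_derivative frechet_derivative f (at x)) (at x)"
  unfolding Cinf_def using Ck_on_has_derivative by blast

lemma Cinf_continuous_on: "Cinf W f \<Longrightarrow> continuous_on W f"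
  unfolding Cinf_def using Ck_on.simps(1) by blast

lemma Cinf_cong: "open W \<Longrightarrow> (\<And>x. x \<in> W \<Longrightarrow> f x = g x) \<Longrightarrow> Cinf W f \<Longrightarrow> Cinf W g"
  unfolding Cinf_def using Ck_on_cong by blast

lemma Cinf_subset: "Cinf W f \<Longrightarrow> V \<subseteq> W \<Longrightarrow> Cinf V f"
  unfolding Cinf_def using Ck_on_subset by blast

lemma Cinf_norm:
  assumes "open S" "0 \<notin> S"
  shows "Cinf S (norm :: 'a::euclidean_space \<Rightarrow> real)"
proof -
  have "Ck_on k S (\<lambda>x. (x \<bullet> x) * inverse (norm x))" for k
    by (intro Ck_on_bilinear[OF assms(1) bounded_bilinear_mult] Ck_on_inverse_norm
          Ck_on_bilinear[OF assms(1) bounded_bilinear_inner] Ck_on_id assms)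
  hence "Cinf S (\<lambda>x. (x \<bullet> x) * inverse (norm x))" by (simp add: Cinf_def)
  thus ?thesis
  proof (rule Cinf_cong[OF assms(1), rotated])
    fix x assume "x \<in> S"
    hence "norm x \<noteq> 0" using assms by auto
    thus "(x \<bullet> x) * inverse (norm x) = norm x" by (simp add: power2_norm_eq_inner[symmetric] power2_eq_square)
  qed
qed

text \<open>Hadamard's lemma, by integrating along the rays from \<open>x / norm x\<close> to \<open>x\<close>.\<close>

lemma hadamard_sphere:
  fixes F :: "real^'n \<Rightarrow> 'b::euclidean_space"
  assumes W: "open W" "p \<in> W" "norm p = 1" and F: "Cinf W F"
    and F0: "\<And>x. x \<in> W \<Longrightarrow> norm x = 1 \<Longrightarrow> F x = 0"
  obtains V Q where "open V" "p \<in> V" "V \<subseteq> W" "Cinf V Q" "\<And>x. x \<in> V \<Longrightarrow> F x = \<rho> x *\<^sub>R Q x"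
proof -
  obtain e0 where e0: "e0 > 0" "ball p e0 \<subseteq> W" using W open_contains_ball by blast
  \<comment> \<open>The bound by 1 keeps \<open>V\<close> away from the origin, where the reciprocal
    norm is singular.\<close>
  define e where "e = min e0 1"
  have e: "e > 0" "e \<le> 1" "ball p e \<subseteq> W" using e0 by (auto simp: e_def)
  \<comment> \<open>For t in \<open>T\<close> one has |1 - t| \<le> 2, so the point of the ray lies
    within 2 e / 3 of x, and x lies within e / 3 of p: the rays stay in the ball of radius
    e.\<close>
  define V where "V = ball p (e / 3)"
  define T where "T = {-1<..<2::real}"
  define N where "N x = inverse (norm x)" for x :: "real^'n"
  define \<gamma> where "\<gamma> z = (N (fst z) + snd z * (1 - N (fst z))) *\<^sub>R fst z" for z :: "(real^'n) \<times> real"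
  have V: "open V" "p \<in> V" "V \<subseteq> W" using e by (auto simp: V_def)
  have T: "open T" "{0..1} \<subseteq> T" by (auto simp: T_def)
  have oVT: "open (V \<times> T)" using V T open_Times by blast
  have nV: "\<bar>norm x - 1\<bar> < e / 3" if "x \<in> V" for x
    using that W(3) norm_triangle_ineq3[of x p] by (simp add: V_def dist_norm norm_minus_commute)
  have V0: "norm x > 0" if "x \<in> V" for x using nV[OF that] e by linarith
  have 0: "0 \<notin> V" using V0 by force
  have \<gamma>: "\<gamma> z \<in> ball p e" if zVT: "z \<in> V \<times> T" for z
  proof -
    obtain x t where z: "z = (x, t)" "x \<in> V" "t \<in> T" using zVT by auto
    have "\<gamma> z - x = ((1 - t) * (N x - 1)) *\<^sub>R x"
      by (simp add: z \<gamma>_def algebra_simps)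
    hence "norm (\<gamma> z - x) = \<bar>1 - t\<bar> * (\<bar>N x - 1\<bar> * norm x)" by (simp add: abs_mult)
    also have "\<bar>N x - 1\<bar> * norm x = \<bar>(N x - 1) * norm x\<bar>" by (simp add: abs_mult)
    also have "(N x - 1) * norm x = 1 - norm x" using V0[OF z(2)] by (simp add: N_def field_simps)
    also have "\<bar>1 - t\<bar> * \<bar>1 - norm x\<bar> \<le> 2 * (e / 3)"
      using z nV[OF z(2)] abs_minus_commute[of "norm x" 1] by (intro mult_mono) (auto simp: T_def)
    finally have "norm (\<gamma> z - x) \<le> 2 * e / 3" by simp
    moreover have "norm (x - p) < e / 3" using z by (simp add: V_def dist_norm norm_minus_commute)
    ultimately have "norm (\<gamma> z - p) < e" using norm_triangle_ineq[of "\<gamma> z - x" "x - p"] by simp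
    thus ?thesis by (simp add: dist_norm norm_minus_commute)
  qed
  have CN: "Ck_on k V N" for k
    unfolding N_def using Ck_on_inverse_norm[OF V(1) 0] .
  have fs: "Ck_on k (V \<times> T) fst" "Ck_on k (V \<times> T) snd" for k
    using Ck_on_linear[OF oVT bounded_linear_fst] Ck_on_linear[OF oVT bounded_linear_snd] by auto
  have CNf: "Ck_on k (V \<times> T) (\<lambda>z. N (fst z))" for k
    by (rule Ck_on_compose[OF oVT V(1) fs(1) _ CN]) auto
  have "Ck_on k (V \<times> T) (\<lambda>z. (N (fst z) + snd z * (1 + - N (fst z))) *\<^sub>R fst z)" for k
    by (intro Ck_on_bilinear[OF oVT bounded_bilinear_scaleR] Ck_on_add Ck_on_bilinear[OF oVT bounded_bilinear_mult]
          fs CNf Ck_on_const oVT Ck_on_linear_comp[OF oVT bounded_linear_minus[OF bounded_linear_ident]])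
  hence C\<gamma>: "Ck_on k (V \<times> T) \<gamma>" for k
    by (simp add: \<gamma>_def[abs_def])
  define \<Phi> where "\<Phi> z = (\<Sum>i\<in>Basis. (fst z \<bullet> i) *\<^sub>R frechet_derivative F (at (\<gamma> z)) i)" for z
  have "Ck_on k (V \<times> T) \<Phi>" for k
    unfolding \<Phi>_def
  proof (intro Ck_on_sum[OF oVT finite_Basis] Ck_on_bilinear[OF oVT bounded_bilinear_scaleR]
      Ck_on_linear_comp[OF oVT bounded_linear_inner_left] fs)
    fix i :: "real^'n"
    have "Ck_on k (ball p e) (\<lambda>x. frechet_derivative F (at x) i)"
      using Cinf_subset[OF Cinf_derivative[OF F] e(3)] by (simp add: Cinf_def)
    thus "Ck_on k (V \<times> T) (\<lambda>z. frechet_derivative F (at (\<gamma> z)) i)"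
      by (rule Ck_on_compose[OF oVT open_ball C\<gamma>, rotated]) (use \<gamma> in auto)
  qed
  hence CI: "Ck_on k V (\<lambda>x. integral {0..1} (\<lambda>t. \<Phi> (x, t)))" for k
    by (rule Ck_on_param_integral[OF V(1) T])
  \<comment> \<open>Along the ray the derivative of \<open>F\<close> carries the factor 1 - 1/r with
    r = |x|, and 1 - 1/r = ((1 - r^2) / 2) (-2 / (r (r + 1))). The first factor is \<rho>, the
    second is the weight used here.\<close>
  define Q where "Q x = (- 2 * (N x * inverse (norm x + 1))) *\<^sub>R integral {0..1} (\<lambda>t. \<Phi> (x, t))" for x
  have "norm x + 1 \<noteq> 0" for x :: "real^'n" using norm_ge_zero[of x] by linarith
  hence CQ: "Ck_on k V Q" for k
    unfolding Q_def
    using Cinf_norm[OF V(1) 0] unfolding Cinf_def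
    by (intro Ck_on_bilinear[OF V(1) bounded_bilinear_scaleR] CI Ck_on_bilinear[OF V(1) bounded_bilinear_mult]
         Ck_on_const V CN Ck_on_inverse Ck_on_add) auto
  have "F x = \<rho> x *\<^sub>R Q x" if x: "x \<in> V" for x
  proof -
    have "((\<lambda>t. (1 - N x) *\<^sub>R \<Phi> (x, t)) has_integral F (\<gamma> (x, 1)) - F (\<gamma> (x, 0))) {0..1}"
    proof (rule fundamental_theorem_of_calculus)
      fix t :: real assume t: "t \<in> {0..1}"
      have g: "\<gamma> (x, t) \<in> W" using \<gamma>[of "(x, t)"] e(3) x t T(2) by (auto simp: subset_iff)
      have d\<gamma>: "((\<lambda>t. \<gamma> (x, t)) has_vector_derivative (1 - N x) *\<^sub>R x) (at t within {0..1})"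
        unfolding \<gamma>_def by (auto intro!: derivative_eq_intros)
      have lin: "linear (frechet_derivative F (at (\<gamma> (x, t))))"
        using Cinf_has_derivative[OF F g] has_derivative_linear by blast
      have "frechet_derivative F (at (\<gamma> (x, t))) (\<Sum>i\<in>Basis. (x \<bullet> i) *\<^sub>R i) = \<Phi> (x, t)"
        by (simp only: \<Phi>_def linear_sum[OF lin] linear_scale[OF lin] fst_conv)
      hence "frechet_derivative F (at (\<gamma> (x, t))) ((1 - N x) *\<^sub>R x) = (1 - N x) *\<^sub>R \<Phi> (x, t)"
        by (simp add: linear_scale[OF lin] euclidean_representation)
      moreover have "((F \<circ> (\<lambda>t. \<gamma> (x, t))) has_vector_derivative frechet_derivative F (at (\<gamma> (x, t))) ((1 - N x) *\<^sub>R x)) (at t within {0..1})"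
        by (rule vector_derivative_diff_chain_within[OF d\<gamma>])
          (rule has_derivative_at_withinI[OF Cinf_has_derivative[OF F g]])
      ultimately show "((\<lambda>t. F (\<gamma> (x, t))) has_vector_derivative (1 - N x) *\<^sub>R \<Phi> (x, t)) (at t within {0..1})"
        by (simp add: o_def)
    qed simp
    from integral_unique[OF this]
    have I: "(1 - N x) *\<^sub>R integral {0..1} (\<lambda>t. \<Phi> (x, t)) = F (\<gamma> (x, 1)) - F (\<gamma> (x, 0))"
      by (simp only: integral_cmul)
    have "F (\<gamma> (x, 0)) = 0"
    proof (rule F0)
      show "\<gamma> (x, 0) \<in> W" using \<gamma>[of "(x, 0)"] e(3) x T(2) by (auto simp: subset_iff)
      show "norm (\<gamma> (x, 0)) = 1" using V0[OF x] by (auto simp: \<gamma>_def N_def)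
    qed
    moreover have "\<gamma> (x, 1) = x" by (simp add: \<gamma>_def)
    ultimately have "F x = (1 - N x) *\<^sub>R integral {0..1} (\<lambda>t. \<Phi> (x, t))"
      using I by simp
    also have "1 - N x = \<rho> x * (- 2 * (N x * inverse (norm x + 1)))"
    proof -
      have "1 - inverse r = (1 - r\<^sup>2) / 2 * (- 2 * (inverse r * inverse (r + 1)))" if "r > 0" for r :: real
      proof -
        have "(1 - r\<^sup>2) / 2 * (- 2 * (a * b)) = (r - 1) * a * ((r + 1) * b)" for a b
          by (simp add: field_simps power2_eq_square)
        hence "(1 - r\<^sup>2) / 2 * (- 2 * (inverse r * inverse (r + 1)))
            = (r - 1) * inverse r * ((r + 1) * inverse (r + 1))" .
        also have "(r + 1) * inverse (r + 1) = 1" using that by (intro right_inverse) simp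
        also have "(r - 1) * inverse r * 1 = 1 - inverse r" using that by (simp add: left_diff_distrib)
        finally show ?thesis by simp
      qed
      thus ?thesis using V0[OF x] unfolding N_def \<rho>_def by blast
    qed
    finally show ?thesis by (simp add: Q_def)
  qed
  thus ?thesis using that[of V Q] V CQ by (auto simp: Cinf_def)
qed

subsection \<open>Asymptotics near the sphere\<close>

lemma eventually_near_inf_collar:
  "eventually P (near_inf :: (real^'n) filter) \<longleftrightarrow> (\<exists>e>0. \<forall>x. 1 - e < norm x \<and> norm x < 1 \<longrightarrow> P x)"
proof
  assume "eventually P near_inf"
  then obtain U e where "nbhd_inf U" "\<forall>x\<in>U. P x" "e > 0" "ball 0 1 - cball 0 (1 - e) \<subseteq> U"
    unfolding eventually_near_inf nbhd_inf_def by blast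
  thus "\<exists>e>0. \<forall>x. 1 - e < norm x \<and> norm x < 1 \<longrightarrow> P x"
    by (intro exI[of _ e]) (auto simp: subset_iff)
next
  assume "\<exists>e>0. \<forall>x. 1 - e < norm x \<and> norm x < 1 \<longrightarrow> P x"
  then obtain e where e: "e > 0" "\<forall>x. 1 - e < norm x \<and> norm x < 1 \<longrightarrow> P x" by blast
  have "nbhd_inf (ball 0 1 - cball 0 (1 - e) :: (real^'n) set)"
    unfolding nbhd_inf_def using e(1) by (auto intro!: exI[of _ e])
  thus "eventually P near_inf" unfolding eventually_near_inf
    by (rule_tac exI[of _ "ball 0 1 - cball 0 (1 - e)"]) (use e in auto)
qed

text \<open>Compactness gives one radius valid at all points of the sphere, and a point x of the
  collar has distance 1 - |x| from \<open>sgn x\<close>.\<close>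

lemma open_near_sphere_collar:
  assumes "open B" "sphere (0::real^'n) 1 \<subseteq> B"
  obtains e where "e > 0" "\<And>x. 1 - e < norm x \<Longrightarrow> norm x \<le> 1 \<Longrightarrow> x \<in> B"
proof -
  obtain e where e: "e > 0" "(\<Union>x\<in>sphere (0::real^'n) 1. ball x e) \<subseteq> B"
    using compact_subset_open_imp_ball_epsilon_subset[OF compact_sphere assms] by blast
  have "x \<in> B" if "1 - min e 1 < norm x" "norm x \<le> 1" for x
  proof -
    have n: "norm x > 0" using that by linarith
    have "sgn x - x = (1 / norm x - 1) *\<^sub>R x" by (simp add: sgn_div_norm scaleR_diff_left divide_inverse)
    hence "norm (sgn x - x) = \<bar>(1 / norm x - 1) * norm x\<bar>" by (simp add: abs_mult)
    also have "(1 / norm x - 1) * norm x = 1 - norm x" using n by (simp add: field_simps)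
    finally have "x \<in> ball (sgn x) e" using that by (simp add: dist_norm)
    moreover have "sgn x \<in> sphere 0 1" using n by (auto simp: norm_sgn)
    ultimately show ?thesis using e(2) by blast
  qed
  thus ?thesis using that[of "min e 1"] e(1) by auto
qed

text \<open>Smoothness up to the sphere provides a separate extension around each boundary point;
  this turns what is shown near each of them into a statement on a single collar.\<close>

lemma eventually_near_inf_local:
  assumes "\<And>p :: real^'n. norm p = 1 \<Longrightarrow> \<exists>W. open W \<and> p \<in> W \<and> (\<forall>x\<in>W \<inter> ball 0 1. P x)"
  shows "eventually P near_inf"
proof -
  let ?B = "\<Union>{W. open W \<and> (\<forall>x\<in>W \<inter> ball 0 1. P x)}"
  have "open ?B" by (auto intro!: open_Union)
  moreover have "sphere 0 1 \<subseteq> ?B"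
  proof
    fix p :: "real^'n" assume "p \<in> sphere 0 1"
    hence "norm p = 1" by simp
    then obtain W where "open W" "p \<in> W" "\<forall>x\<in>W \<inter> ball 0 1. P x" using assms by blast
    thus "p \<in> ?B" by blast
  qed
  ultimately obtain e where e: "e > 0" "\<And>x. 1 - e < norm x \<Longrightarrow> norm x \<le> 1 \<Longrightarrow> x \<in> ?B"
    by (rule open_near_sphere_collar) blast
  show ?thesis unfolding eventually_near_inf_collar
  proof (intro exI[of _ e] conjI allI impI e(1))
    fix x :: "real^'n" assume x: "1 - e < norm x \<and> norm x < 1"
    hence "x \<in> ?B" using e(2) by auto
    thus "P x" using x by auto
  qed
qed

lemma eventually_near_infD:
  assumes "eventually P near_inf" "norm (p :: real^'n) = 1"
  obtains W where "open W" "p \<in> W" "\<And>x. x \<in> W \<Longrightarrow> norm x < 1 \<Longrightarrow> P x"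
proof -
  obtain e where e: "e > 0" "\<forall>x :: real^'n. 1 - e < norm x \<and> norm x < 1 \<longrightarrow> P x"
    using assms unfolding eventually_near_inf_collar by blast
  show ?thesis by (rule that[of "- cball 0 (1 - e)"]) (use e assms in auto)
qed

text \<open>Collars are open. This is what allows identities between germs to be
  differentiated.\<close>

lemma eventually_near_inf_nhds:
  assumes "eventually P (near_inf :: (real^'n) filter)"
  shows "eventually (\<lambda>x. eventually P (nhds x)) near_inf"
proof -
  obtain e where e: "e > 0" "\<forall>x :: real^'n. 1 - e < norm x \<and> norm x < 1 \<longrightarrow> P x"
    using assms unfolding eventually_near_inf_collar by blast
  have "eventually P (nhds x)" if "1 - e < norm x \<and> norm x < 1" for x :: "real^'n"
    unfolding eventually_nhds
    by (rule exI[of _ "ball 0 1 - cball 0 (1 - e)"]) (use that e in auto)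
  thus ?thesis unfolding eventually_near_inf_collar using e(1) by blast
qed

lemma eventually_norm_near_inf: "a < 1 \<Longrightarrow> eventually (\<lambda>x::real^'n. a < norm x \<and> norm x < 1) near_inf"
  unfolding eventually_near_inf_collar by (intro exI[of _ "1 - a"]) auto

section \<open>Bounds for \<open>\<rho>\<close> and orders of vanishing at the sphere\<close>

lemma rho_pos: "norm x < 1 \<Longrightarrow> 0 < \<rho> x"
  by (simp add: \<rho>_def abs_square_less_1)

lemma rho_le_half: "\<rho> x \<le> 1 / 2"
  by (simp add: \<rho>_def)

lemma rho_le: "\<rho> x \<le> 1 - norm x"
proof -
  have "2 * norm x \<le> (norm x)\<^sup>2 + 1"
    using zero_le_power2[of "1 - norm x"] by (simp add: power2_eq_square algebra_simps)
  thus ?thesis by (simp add: \<rho>_def)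
qed

lemma eventually_rho: "eventually (\<lambda>x::real^'n. 0 < \<rho> x \<and> \<rho> x \<le> 1 / 2 \<and> 1 / 2 < norm x \<and> norm x < 1) near_inf"
proof -
  have "eventually (\<lambda>x::real^'n. 1 / 2 < norm x \<and> norm x < 1) near_inf"
    by (rule eventually_norm_near_inf) simp
  thus ?thesis by (rule eventually_mono) (use rho_pos rho_le_half in blast)
qed

lemma eventually_rho_less: "e > 0 \<Longrightarrow> eventually (\<lambda>x::real^'n. \<rho> x < e) near_inf"
proof -
  assume e: "e > 0"
  have "eventually (\<lambda>x::real^'n. 1 - e < norm x \<and> norm x < 1) near_inf"
    using e by (intro eventually_norm_near_inf) simp
  thus ?thesis
  proof eventually_elim
    case (elim x)
    thus ?case using rho_le[of x] by linarith
  qed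
qed

lemma rho_lipschitz: "norm x \<le> 1 \<Longrightarrow> norm y \<le> 1 \<Longrightarrow> \<bar>\<rho> x - \<rho> y\<bar> \<le> norm (x - y)"
proof -
  assume n: "norm x \<le> 1" "norm y \<le> 1"
  have "\<rho> x - \<rho> y = (norm y - norm x) * ((norm y + norm x) / 2)"
    by (simp add: \<rho>_def power2_eq_square field_simps)
  hence "\<bar>\<rho> x - \<rho> y\<bar> = \<bar>(norm y - norm x) * ((norm y + norm x) / 2)\<bar>" by (simp only:)
  also have "\<dots> = \<bar>norm y - norm x\<bar> * ((norm y + norm x) / 2)" by (simp add: abs_mult)
  also have "\<dots> \<le> norm (x - y) * 1"
    using n norm_triangle_ineq3[of y x] by (intro mult_mono) (auto simp: norm_minus_commute)
  finally show ?thesis by simp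
qed

text \<open>Landau's notation for vector-valued functions with the constant exposed. Since \<rho> is
  positive near infinity, the bound is stated without absolute values; order 0 is
  boundedness.\<close>

definition O_inf :: "nat \<Rightarrow> (real^'n \<Rightarrow> 'b::real_normed_vector) \<Rightarrow> bool" where
  "O_inf m f \<longleftrightarrow> (\<exists>C. eventually (\<lambda>x. norm (f x) \<le> C * \<rho> x ^ m) near_inf)"

lemma O_infI: "eventually (\<lambda>x. norm (f x) \<le> C * \<rho> x ^ m) near_inf \<Longrightarrow> O_inf m f"
  unfolding O_inf_def by blast

lemma O_infE:
  assumes "O_inf m f"
  obtains C where "C \<ge> 0" "eventually (\<lambda>x. norm (f x) \<le> C * \<rho> x ^ m) near_inf"
proof -
  obtain C where "eventually (\<lambda>x. norm (f x) \<le> C * \<rho> x ^ m) near_inf"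
    using assms unfolding O_inf_def by blast
  hence "eventually (\<lambda>x. norm (f x) \<le> max C 0 * \<rho> x ^ m) near_inf"
    using eventually_rho
  proof eventually_elim
    case (elim x)
    have "C * \<rho> x ^ m \<le> max C 0 * \<rho> x ^ m" using elim by (intro mult_right_mono) auto
    thus ?case using elim by linarith
  qed
  thus ?thesis using that[of "max C 0"] by auto
qed

lemma O_inf_iff_bigo:
  "(\<lambda>x. norm (f x)) \<in> O[near_inf](\<lambda>x. \<rho> x ^ m) \<longleftrightarrow> O_inf m f"
proof
  assume "(\<lambda>x. norm (f x)) \<in> O[near_inf](\<lambda>x. \<rho> x ^ m)"
  then obtain c where "eventually (\<lambda>x. norm (norm (f x)) \<le> c * norm (\<rho> x ^ m)) near_inf"
    by (auto elim: landau_o.bigE)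
  hence "eventually (\<lambda>x. norm (f x) \<le> c * \<rho> x ^ m) near_inf"
    using eventually_rho by eventually_elim auto
  thus "O_inf m f" by (rule O_infI)
next
  assume "O_inf m f"
  then obtain C where "eventually (\<lambda>x. norm (f x) \<le> C * \<rho> x ^ m) near_inf" by (rule O_infE)
  hence "eventually (\<lambda>x. norm (norm (f x)) \<le> C * norm (\<rho> x ^ m)) near_inf"
    using eventually_rho by eventually_elim auto
  thus "(\<lambda>x. norm (f x)) \<in> O[near_inf](\<lambda>x. \<rho> x ^ m)" by (rule bigoI)
qed

lemma O_inf_bound:
  assumes "O_inf m g" "eventually (\<lambda>x. norm (f x) \<le> K * norm (g x)) near_inf"
  shows "O_inf m f"
proof -
  obtain C where "C \<ge> 0" "eventually (\<lambda>x. norm (g x) \<le> C * \<rho> x ^ m) near_inf"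
    using assms(1) by (rule O_infE)
  from this(2) assms(2) have "eventually (\<lambda>x. norm (f x) \<le> (\<bar>K\<bar> * C) * \<rho> x ^ m) near_inf"
  proof eventually_elim
    case (elim x)
    have "K * norm (g x) \<le> \<bar>K\<bar> * norm (g x)" by (intro mult_right_mono) auto
    also have "\<dots> \<le> \<bar>K\<bar> * (C * \<rho> x ^ m)" using elim by (intro mult_left_mono) auto
    finally show ?case using elim by (simp add: mult.assoc)
  qed
  thus ?thesis by (rule O_infI)
qed

lemma O_inf_cong: "eventually (\<lambda>x. f x = g x) near_inf \<Longrightarrow> O_inf m f \<Longrightarrow> O_inf m g"
  by (erule O_inf_bound[where K = 1]) (auto elim: eventually_mono)

lemma O_inf_zero: "O_inf m (\<lambda>x. 0)"
  by (rule O_infI[where C = 0]) simp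

lemma O_inf_const: "O_inf 0 (\<lambda>x. c)"
  by (rule O_infI[where C = "norm c"]) simp

lemma O_inf_add:
  assumes "O_inf m f" "O_inf m g"
  shows "O_inf m (\<lambda>x. f x + g x)"
proof -
  obtain C D where "eventually (\<lambda>x. norm (f x) \<le> C * \<rho> x ^ m) near_inf"
    "eventually (\<lambda>x. norm (g x) \<le> D * \<rho> x ^ m) near_inf"
    using assms unfolding O_inf_def by blast
  hence "eventually (\<lambda>x. norm (f x + g x) \<le> (C + D) * \<rho> x ^ m) near_inf"
  proof eventually_elim
    case (elim x)
    thus ?case using norm_triangle_ineq[of "f x" "g x"] by (simp add: distrib_right)
  qed
  thus ?thesis by (rule O_infI)
qed

lemma O_inf_bilinear:
  assumes "bounded_bilinear prd" "O_inf m f" "O_inf n g"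
  shows "O_inf (m + n) (\<lambda>x. prd (f x) (g x))"
proof -
  interpret bounded_bilinear prd by fact
  obtain K where K: "K \<ge> 0" "\<And>a b. norm (prd a b) \<le> norm a * norm b * K" using nonneg_bounded by blast
  obtain C where C: "C \<ge> 0" "eventually (\<lambda>x. norm (f x) \<le> C * \<rho> x ^ m) near_inf" using assms(2) by (rule O_infE)
  obtain D where D: "D \<ge> 0" "eventually (\<lambda>x. norm (g x) \<le> D * \<rho> x ^ n) near_inf" using assms(3) by (rule O_infE)
  from C(2) D(2) have "eventually (\<lambda>x. norm (prd (f x) (g x)) \<le> (C * D * K) * \<rho> x ^ (m + n)) near_inf"
    using eventually_rho
  proof eventually_elim
    case (elim x)
    have "norm (prd (f x) (g x)) \<le> norm (f x) * norm (g x) * K" by (rule K)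
    also have "\<dots> \<le> (C * \<rho> x ^ m) * (D * \<rho> x ^ n) * K"
      using elim K C D by (intro mult_right_mono mult_mono) auto
    finally show ?case by (simp add: power_add mult_ac)
  qed
  thus ?thesis by (rule O_infI)
qed

lemma O_inf_linear:
  assumes "bounded_linear L" "O_inf m f"
  shows "O_inf m (\<lambda>x. L (f x))"
proof -
  obtain K where K: "\<And>a. norm (L a) \<le> norm a * K"
    using bounded_linear.bounded[OF assms(1)] by blast
  show ?thesis
    by (rule O_inf_bound[OF assms(2), where K = K]) (use K in \<open>auto simp: mult.commute\<close>)
qed

lemma O_inf_minus: "O_inf m f \<Longrightarrow> O_inf m (\<lambda>x. - f x)"
  by (rule O_inf_linear[OF bounded_linear_minus[OF bounded_linear_ident]])

lemma O_inf_diff: "O_inf m f \<Longrightarrow> O_inf m g \<Longrightarrow> O_inf m (\<lambda>x. f x - g x)"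
  using O_inf_add[OF _ O_inf_minus, of m f g] by simp

lemma O_inf_sum: "finite I \<Longrightarrow> (\<And>i. i \<in> I \<Longrightarrow> O_inf m (f i)) \<Longrightarrow> O_inf m (\<lambda>x. \<Sum>i\<in>I. f i x)"
  by (induction I rule: finite_induct) (auto intro: O_inf_zero O_inf_add)

lemma O_inf_mono:
  assumes "O_inf n f" "m \<le> n"
  shows "O_inf m f"
proof -
  obtain C where C: "C \<ge> 0" "eventually (\<lambda>x. norm (f x) \<le> C * \<rho> x ^ n) near_inf" using assms(1) by (rule O_infE)
  from C(2) eventually_rho have "eventually (\<lambda>x. norm (f x) \<le> C * \<rho> x ^ m) near_inf"
  proof eventually_elim
    case (elim x)
    have "C * \<rho> x ^ n \<le> C * \<rho> x ^ m" using elim C assms(2) by (intro mult_left_mono power_decreasing) auto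
    thus ?case using elim by linarith
  qed
  thus ?thesis by (rule O_infI)
qed

text \<open>Being an equivalence, this serves both to read off the order of a leading coefficient
  after a power of \<rho> has been extracted and to restore the power afterwards.\<close>

lemma O_inf_rho_power_cancel: "O_inf (n + m) (\<lambda>x. \<rho> x ^ n *\<^sub>R f x) \<longleftrightarrow> O_inf m f"
proof -
  have "eventually (\<lambda>x. norm (\<rho> x ^ n *\<^sub>R f x) \<le> C * \<rho> x ^ (n + m)) near_inf \<longleftrightarrow>
     eventually (\<lambda>x. norm (f x) \<le> C * \<rho> x ^ m) near_inf" for C
  proof (rule eventually_cong[OF eventually_rho])
    fix x :: "real^'a" assume x: "0 < \<rho> x \<and> \<rho> x \<le> 1 / 2 \<and> 1 / 2 < norm x \<and> norm x < 1"
    hence "\<rho> x ^ n > 0" by simp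
    moreover have "norm (\<rho> x ^ n *\<^sub>R f x) = \<rho> x ^ n * norm (f x)" "C * \<rho> x ^ (n + m) = \<rho> x ^ n * (C * \<rho> x ^ m)"
      using x by (auto simp: power_add)
    ultimately show "norm (\<rho> x ^ n *\<^sub>R f x) \<le> C * \<rho> x ^ (n + m) \<longleftrightarrow> norm (f x) \<le> C * \<rho> x ^ m"
      by (simp only: mult_le_cancel_left_pos)
  qed
  thus ?thesis by (simp add: O_inf_def)
qed

lemma O_inf_divide: "O_inf (n + m) f \<Longrightarrow> O_inf m (\<lambda>x. inverse (\<rho> x ^ n) *\<^sub>R f x)"
proof -
  assume f: "O_inf (n + m) f"
  have "eventually (\<lambda>x. f x = \<rho> x ^ n *\<^sub>R (inverse (\<rho> x ^ n) *\<^sub>R f x)) near_inf"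
    using eventually_rho by eventually_elim auto
  from O_inf_cong[OF this f] show ?thesis by (simp only: O_inf_rho_power_cancel)
qed

lemma O_inf_small:
  assumes "O_inf m f" "m > 0" "e > 0"
  shows "eventually (\<lambda>x. norm (f x) < e) near_inf"
proof -
  obtain C where C: "C \<ge> 0" "eventually (\<lambda>x. norm (f x) \<le> C * \<rho> x ^ 1) near_inf"
    using O_inf_mono[OF assms(1), of 1] assms(2) by (auto elim: O_infE)
  have "e / (C + 1) > 0" using C assms by simp
  from C(2) eventually_rho_less[OF this] eventually_rho show ?thesis
  proof eventually_elim
    case (elim x)
    have "C * \<rho> x ^ 1 \<le> (C + 1) * \<rho> x" using elim by (simp add: algebra_simps)
    also have "\<dots> < e" using elim C by (simp add: field_simps)
    finally show ?case using elim by linarith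
  qed
qed

subsection \<open>Germs of functions that are smooth up to the sphere\<close>

text \<open>Values on the sphere are ignored, so that this is a property of germs at infinity.\<close>

definition smooth_inf :: "(real^'n \<Rightarrow> 'b::real_normed_vector) \<Rightarrow> bool" where
  "smooth_inf f \<longleftrightarrow> (\<forall>p. norm p = 1 \<longrightarrow>
     (\<exists>W F. open W \<and> p \<in> W \<and> Cinf W F \<and> (\<forall>x\<in>W. norm x < 1 \<longrightarrow> F x = f x)))"

lemma smooth_infE:
  assumes "smooth_inf f" "norm p = 1"
  obtains W F where "open W" "p \<in> W" "Cinf W F" "\<And>x. x \<in> W \<Longrightarrow> norm x < 1 \<Longrightarrow> F x = f x"
proof -
  obtain W F where *: "open W \<and> p \<in> W \<and> Cinf W F \<and> (\<forall>x\<in>W. norm x < 1 \<longrightarrow> F x = f x)"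
    using assms(1)[unfolded smooth_inf_def, rule_format, OF assms(2)] by (elim exE)
  show ?thesis by (rule that[of W F]) (simp_all add: *)
qed

lemma smooth_infI:
  assumes "\<And>p. norm p = 1 \<Longrightarrow> \<exists>W F. open W \<and> p \<in> W \<and> Cinf W F \<and> (\<forall>x\<in>W. norm x < 1 \<longrightarrow> F x = f x)"
  shows "smooth_inf f"
  using assms unfolding smooth_inf_def by blast

lemma smooth_inf_cong:
  assumes "smooth_inf f" "eventually (\<lambda>x. f x = g x) near_inf"
  shows "smooth_inf g"
proof (rule smooth_infI)
  fix p :: "real^'a" assume p: "norm p = 1"
  obtain W F where W: "open W" "p \<in> W" "Cinf W F" "\<And>x. x \<in> W \<Longrightarrow> norm x < 1 \<Longrightarrow> F x = f x"
    using assms(1) p by (rule smooth_infE) blast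
  obtain V where V: "open V" "p \<in> V" "\<And>x. x \<in> V \<Longrightarrow> norm x < 1 \<Longrightarrow> f x = g x"
    using assms(2) p by (rule eventually_near_infD) blast
  show "\<exists>W F. open W \<and> p \<in> W \<and> Cinf W F \<and> (\<forall>x\<in>W. norm x < 1 \<longrightarrow> F x = g x)"
    by (rule exI[of _ "W \<inter> V"], rule exI[of _ F]) (use W V in \<open>auto intro: Cinf_subset\<close>)
qed

lemma smooth_inf_global: "(\<And>k W. open W \<Longrightarrow> Ck_on k W f) \<Longrightarrow> smooth_inf f"
  by (rule smooth_infI, rule exI[of _ UNIV], rule exI[of _ f]) (auto simp: Cinf_def)

lemma smooth_inf_const: "smooth_inf (\<lambda>x. c)"
  by (rule smooth_inf_global) (rule Ck_on_const)

lemma smooth_inf_id: "smooth_inf (\<lambda>x. x)"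
  by (rule smooth_inf_global) (rule Ck_on_id)

lemma smooth_inf_linear:
  assumes "bounded_linear L" "smooth_inf f"
  shows "smooth_inf (\<lambda>x. L (f x))"
proof (rule smooth_infI)
  fix p :: "real^'c" assume p: "norm p = 1"
  obtain W F where W: "open W" "p \<in> W" "Cinf W F" "\<And>x. x \<in> W \<Longrightarrow> norm x < 1 \<Longrightarrow> F x = f x"
    using assms(2) p by (rule smooth_infE) blast
  show "\<exists>W F. open W \<and> p \<in> W \<and> Cinf W F \<and> (\<forall>x\<in>W. norm x < 1 \<longrightarrow> F x = L (f x))"
    by (rule exI[of _ W], rule exI[of _ "\<lambda>x. L (F x)"])
      (use W Ck_on_linear_comp[OF W(1) assms(1)] in \<open>auto simp: Cinf_def\<close>)
qed

lemma smooth_inf_minus: "smooth_inf f \<Longrightarrow> smooth_inf (\<lambda>x. - f x)"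
  by (rule smooth_inf_linear[OF bounded_linear_minus[OF bounded_linear_ident]])

lemma smooth_inf_bin:
  fixes f :: "real^'n \<Rightarrow> 'b::real_normed_vector" and g :: "real^'n \<Rightarrow> 'c::real_normed_vector"
  assumes "smooth_inf f" "smooth_inf g"
    and "\<And>k (W :: (real^'n) set) F G. open W \<Longrightarrow> Ck_on k W F \<Longrightarrow> Ck_on k W G \<Longrightarrow> Ck_on k W (\<lambda>x. prd (F x) (G x))"
  shows "smooth_inf (\<lambda>x. prd (f x) (g x))"
proof (rule smooth_infI)
  fix p :: "real^'n" assume p: "norm p = 1"
  obtain W F where W: "open W" "p \<in> W" "Cinf W F" "\<And>x. x \<in> W \<Longrightarrow> norm x < 1 \<Longrightarrow> F x = f x"
    using assms(1) p by (rule smooth_infE) blast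
  obtain V G where V: "open V" "p \<in> V" "Cinf V G" "\<And>x. x \<in> V \<Longrightarrow> norm x < 1 \<Longrightarrow> G x = g x"
    using assms(2) p by (rule smooth_infE) blast
  have "Ck_on k (W \<inter> V) (\<lambda>x. prd (F x) (G x))" for k
    by (rule assms(3)[of "W \<inter> V" k F G]) (use W V Ck_on_subset[of k W F "W \<inter> V"] Ck_on_subset[of k V G "W \<inter> V"] in \<open>auto simp: Cinf_def\<close>)
  thus "\<exists>W F. open W \<and> p \<in> W \<and> Cinf W F \<and> (\<forall>x\<in>W. norm x < 1 \<longrightarrow> F x = prd (f x) (g x))"
    by (intro exI[of _ "W \<inter> V"] exI[of _ "\<lambda>x. prd (F x) (G x)"]) (use W V in \<open>auto simp: Cinf_def\<close>)
qed

lemma smooth_inf_add: "smooth_inf f \<Longrightarrow> smooth_inf g \<Longrightarrow> smooth_inf (\<lambda>x. f x + g x)"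
  by (rule smooth_inf_bin[where prd = "(+)"]) (auto intro: Ck_on_add)

lemma smooth_inf_diff: "smooth_inf f \<Longrightarrow> smooth_inf g \<Longrightarrow> smooth_inf (\<lambda>x. f x - g x)"
  using smooth_inf_add[OF _ smooth_inf_minus, of f g] by simp

lemma smooth_inf_bilinear:
  "bounded_bilinear prd \<Longrightarrow> smooth_inf f \<Longrightarrow> smooth_inf g \<Longrightarrow> smooth_inf (\<lambda>x. prd (f x) (g x))"
  by (rule smooth_inf_bin[where prd = prd]) (auto intro: Ck_on_bilinear)

lemma smooth_inf_sum:
  "finite I \<Longrightarrow> (\<And>i. i \<in> I \<Longrightarrow> smooth_inf (f i)) \<Longrightarrow> smooth_inf (\<lambda>x. \<Sum>i\<in>I. f i x)"
  by (induction I rule: finite_induct) (auto intro: smooth_inf_const smooth_inf_add)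

lemma smooth_inf_rho: "smooth_inf (\<rho> :: real^'n \<Rightarrow> real)"
proof -
  have "smooth_inf (\<lambda>x::real^'n. (1 / 2) * (1 - x \<bullet> x))"
    by (intro smooth_inf_bilinear[OF bounded_bilinear_mult] smooth_inf_const smooth_inf_diff
        smooth_inf_bilinear[OF bounded_bilinear_inner] smooth_inf_id)
  thus ?thesis by (simp add: \<rho>_def[abs_def] power2_norm_eq_inner)
qed

lemma smooth_inf_power: "smooth_inf f \<Longrightarrow> smooth_inf (\<lambda>x. (f x :: real) ^ m)"
  by (induction m) (auto intro: smooth_inf_const smooth_inf_bilinear[OF bounded_bilinear_mult])

lemma smooth_inf_derivative:
  assumes "smooth_inf f"
  shows "smooth_inf (\<lambda>x. frechet_derivative f (at x) v)"
proof (rule smooth_infI)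
  fix p :: "real^'a" assume p: "norm p = 1"
  obtain W F where W: "open W" "p \<in> W" "Cinf W F" "\<And>x. x \<in> W \<Longrightarrow> norm x < 1 \<Longrightarrow> F x = f x"
    using assms(1) p by (rule smooth_infE) blast
  have "frechet_derivative F (at x) = frechet_derivative f (at x)" if "x \<in> W" "norm x < 1" for x
    by (rule frechet_derivative_cong_open[where S = "W \<inter> ball 0 1"]) (use W that in auto)
  thus "\<exists>W F. open W \<and> p \<in> W \<and> Cinf W F \<and> (\<forall>x\<in>W. norm x < 1 \<longrightarrow> F x = frechet_derivative f (at x) v)"
    using W Cinf_derivative[OF W(3)] by (intro exI[of _ W] exI[of _ "\<lambda>x. frechet_derivative F (at x) v"]) auto
qed

lemma smooth_inf_has_derivative:
  assumes "smooth_inf f"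
  shows "eventually (\<lambda>x. (f has_derivative frechet_derivative f (at x)) (at x)) near_inf"
proof (rule eventually_near_inf_local)
  fix p :: "real^'a" assume p: "norm p = 1"
  obtain W F where W: "open W" "p \<in> W" "Cinf W F" "\<And>x. x \<in> W \<Longrightarrow> norm x < 1 \<Longrightarrow> F x = f x"
    using assms(1) p by (rule smooth_infE) blast
  have "(f has_derivative frechet_derivative f (at x)) (at x)" if "x \<in> W" "norm x < 1" for x
  proof -
    have "(f has_derivative frechet_derivative F (at x)) (at x)"
      by (rule has_derivative_transform_within_open[OF Cinf_has_derivative[OF W(3)], of x "W \<inter> ball 0 1"])
        (use W that in auto)
    thus ?thesis using frechet_derivative_at by metis
  qed
  thus "\<exists>W. open W \<and> p \<in> W \<and> (\<forall>x\<in>W \<inter> ball 0 1. (f has_derivative frechet_derivative f (at x)) (at x))"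
    using W by (intro exI[of _ W]) auto
qed

lemma tendsto_near_sphere:
  assumes "O_inf (Suc m) f" "norm (p :: real^'n) = 1"
  shows "(f \<longlongrightarrow> 0) (at p within ball 0 1)"
proof (rule tendstoI)
  fix e :: real assume "e > 0"
  hence "eventually (\<lambda>x. norm (f x) < e) near_inf" using O_inf_small[OF assms(1)] by simp
  then obtain W where W: "open W" "p \<in> W" "\<And>x. x \<in> W \<Longrightarrow> norm x < 1 \<Longrightarrow> norm (f x) < e"
    using assms(2) by (rule eventually_near_infD) blast
  thus "eventually (\<lambda>x. dist (f x) 0 < e) (at p within ball 0 1)"
    unfolding eventually_at_topological by (intro exI[of _ W]) auto
qed

lemma at_within_ball_nontrivial:
  assumes "norm (p :: 'a::euclidean_space) = 1"
  shows "at p within ball 0 1 \<noteq> bot"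
proof -
  have "p islimpt ball 0 1" using assms by (simp add: islimpt_ball)
  thus ?thesis by (simp add: trivial_limit_within)
qed

lemma local_extension_at_sphere:
  assumes "open W" "p \<in> W" "norm (p :: real^'n) = 1" "Cinf W F" "\<And>x. x \<in> W \<Longrightarrow> norm x < 1 \<Longrightarrow> F x = f x"
  shows "(f \<longlongrightarrow> F p) (at p within ball 0 1)"
proof -
  have "isCont F p" using Cinf_continuous_on[OF assms(4)] assms(1,2) by (simp add: continuous_on_eq_continuous_at)
  hence "(F \<longlongrightarrow> F p) (at p within ball 0 1)"
    by (simp add: continuous_at_imp_continuous_at_within continuous_within[symmetric])
  moreover have "eventually (\<lambda>x. F x = f x) (at p within ball 0 1)"
    unfolding eventually_at_topological using assms by (intro exI[of _ W]) auto
  ultimately show ?thesis by (rule Lim_transform_eventually)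
qed

lemma local_extension_eq_limit:
  assumes "open W" "p \<in> W" "norm (p :: real^'n) = 1" "Cinf W F" "\<And>x. x \<in> W \<Longrightarrow> norm x < 1 \<Longrightarrow> F x = f x"
    and "(f \<longlongrightarrow> c) (at p within ball 0 1)"
  shows "F p = c"
  using tendsto_unique[OF at_within_ball_nontrivial[OF assms(3)] local_extension_at_sphere[OF assms(1-5)] assms(6)] .

text \<open>The displacement tends to 0 at the sphere, so the local extension of
  \<open>\<psi>\<close> fixes p and maps a neighborhood of p into the domain of the extension of
  \<open>f\<close>. The third hypothesis keeps interior points interior, where that extension is
  known to agree with \<open>f\<close>.\<close>

lemma smooth_inf_compose:
  fixes \<psi> :: "real^'n \<Rightarrow> real^'n"
  assumes "smooth_inf \<psi>" "O_inf (Suc m) (\<lambda>x. \<psi> x - x)" "eventually (\<lambda>x. norm (\<psi> x) < 1) near_inf" "smooth_inf f"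
  shows "smooth_inf (\<lambda>x. f (\<psi> x))"
proof (rule smooth_infI)
  fix p :: "real^'n" assume p: "norm p = 1"
  obtain W X where W: "open W" "p \<in> W" "Cinf W X" "\<And>x. x \<in> W \<Longrightarrow> norm x < 1 \<Longrightarrow> X x = \<psi> x"
    using assms(1) p by (rule smooth_infE) blast
  obtain V F where V: "open V" "p \<in> V" "Cinf V F" "\<And>x. x \<in> V \<Longrightarrow> norm x < 1 \<Longrightarrow> F x = f x"
    using assms(4) p by (rule smooth_infE) blast
  obtain Z where Z: "open Z" "p \<in> Z" "\<And>x. x \<in> Z \<Longrightarrow> norm x < 1 \<Longrightarrow> norm (\<psi> x) < 1"
    using assms(3) p by (rule eventually_near_infD) blast
  have "((\<lambda>x. (\<psi> x - x) + x) \<longlongrightarrow> 0 + p) (at p within ball 0 1)"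
    by (intro tendsto_add tendsto_near_sphere[OF assms(2) p] tendsto_ident_at)
  hence Xp: "X p = p"
    by (intro local_extension_eq_limit[OF W(1,2) p W(3,4)]) auto
  define S where "S = (W \<inter> X -` V) \<inter> Z"
  have S: "open S" "p \<in> S"
    unfolding S_def using continuous_open_preimage[OF Cinf_continuous_on[OF W(3)] W(1) V(1)] Z W V Xp by auto
  have "Ck_on k S (\<lambda>x. F (X x))" for k
    by (rule Ck_on_compose[OF S(1) V(1)])
      (use W V Ck_on_subset[of k W X S] in \<open>auto simp: Cinf_def S_def\<close>)
  thus "\<exists>W F. open W \<and> p \<in> W \<and> Cinf W F \<and> (\<forall>x\<in>W. norm x < 1 \<longrightarrow> F x = f (\<psi> x))"
    by (intro exI[of _ S] exI[of _ "\<lambda>x. F (X x)"]) (use S W V Z in \<open>auto simp: Cinf_def S_def\<close>)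
qed

text \<open>Since f - 1 vanishes at the sphere, each local extension has the value 1 at p and is
  nonzero on a smaller neighborhood.\<close>

lemma smooth_inf_inverse:
  fixes f :: "real^'n \<Rightarrow> real"
  assumes "smooth_inf f" "O_inf (Suc m) (\<lambda>x. f x - 1)"
  shows "smooth_inf (\<lambda>x. inverse (f x))"
proof (rule smooth_infI)
  fix p :: "real^'n" assume p: "norm p = 1"
  obtain W F where W: "open W" "p \<in> W" "Cinf W F" "\<And>x. x \<in> W \<Longrightarrow> norm x < 1 \<Longrightarrow> F x = f x"
    using assms(1) p by (rule smooth_infE) blast
  have "((\<lambda>x. (f x - 1) + 1) \<longlongrightarrow> 0 + 1) (at p within ball 0 1)"
    by (intro tendsto_add tendsto_near_sphere[OF assms(2) p] tendsto_const)
  hence Fp: "F p = 1"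
    by (intro local_extension_eq_limit[OF W(1,2) p W(3,4)]) auto
  define S where "S = W \<inter> F -` (- {0})"
  have S: "open S" "p \<in> S"
    unfolding S_def using continuous_open_preimage[OF Cinf_continuous_on[OF W(3)] W(1)] W Fp by auto
  have "Ck_on k S (\<lambda>x. inverse (F x))" for k
    by (rule Ck_on_inverse[OF S(1)])
      (use W Ck_on_subset[of k W F S] in \<open>auto simp: Cinf_def S_def\<close>)
  thus "\<exists>W F. open W \<and> p \<in> W \<and> Cinf W F \<and> (\<forall>x\<in>W. norm x < 1 \<longrightarrow> F x = inverse (f x))"
    by (intro exI[of _ S] exI[of _ "\<lambda>x. inverse (F x)"]) (use S W in \<open>auto simp: Cinf_def S_def\<close>)
qed

lemma smooth_on_continuous_on:
  assumes "smooth_on S f"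
  shows "continuous_on S f"
  unfolding continuous_on_eq_continuous_within
proof
  fix x assume x: "x \<in> S"
  then obtain W F where W: "open W" "x \<in> W" "\<forall>k. Ck_on k W F" "\<forall>y\<in>W \<inter> S. F y = f y"
    using assms unfolding smooth_on_def by blast
  have "continuous_on W F" using W(3) Ck_on.simps(1) by blast
  hence "isCont F x" using W(1,2) by (simp add: continuous_on_eq_continuous_at)
  hence "(F \<longlongrightarrow> F x) (at x within S)"
    by (simp add: continuous_at_imp_continuous_at_within continuous_within[symmetric])
  moreover have "eventually (\<lambda>y. F y = f y) (at x within S)"
    unfolding eventually_at_topological using W by (intro exI[of _ W]) auto
  ultimately have "(f \<longlongrightarrow> F x) (at x within S)" by (rule Lim_transform_eventually)
  thus "continuous (at x within S) f" using W x by (simp add: continuous_within)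
qed

text \<open>The extensions around different boundary points are chosen independently. They agree on
  the sphere because each value there is the limit of \<open>f\<close> from inside, so these limits
  define one function that every local extension represents.\<close>

lemma smooth_inf_extend:
  fixes f :: "real^'n \<Rightarrow> 'b::real_normed_vector"
  assumes "smooth_inf f"
  obtains e h where "e > 0" "smooth_on (with_sphere (ball 0 1 - cball 0 (1 - e))) h"
    "\<And>x. norm x < 1 \<Longrightarrow> h x = f x" "\<And>p. norm p = 1 \<Longrightarrow> (f \<longlongrightarrow> h p) (at p within ball 0 1)"
proof -
  define \<W> where "\<W> = {W. open W \<and> (\<exists>F. Cinf W F \<and> (\<forall>x\<in>W. norm x < 1 \<longrightarrow> F x = f x))}"
  have \<W>: "\<exists>W\<in>\<W>. p \<in> W" if p: "norm p = 1" for p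
  proof -
    obtain W F where "open W" "p \<in> W" "Cinf W F" "\<And>x. x \<in> W \<Longrightarrow> norm x < 1 \<Longrightarrow> F x = f x"
      using assms p by (rule smooth_infE) blast
    thus ?thesis unfolding \<W>_def by (intro bexI[of _ W]) auto
  qed
  have "open (\<Union>\<W>)" unfolding \<W>_def by (auto intro!: open_Union)
  moreover have "sphere 0 1 \<subseteq> \<Union>\<W>" using \<W> by fastforce
  ultimately obtain e where e: "e > 0" "\<And>x. 1 - e < norm x \<Longrightarrow> norm x \<le> 1 \<Longrightarrow> x \<in> \<Union>\<W>"
    by (rule open_near_sphere_collar) blast
  define h where "h x = (if norm x < 1 then f x else Lim (at x within ball 0 1) f)" for x
  have hlim: "F p = h p" if "open W" "p \<in> W" "norm p = 1" "Cinf W F" "\<And>x. x \<in> W \<Longrightarrow> norm x < 1 \<Longrightarrow> F x = f x" for W F p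
    using tendsto_Lim[OF at_within_ball_nontrivial[OF that(3)] local_extension_at_sphere[OF that]] that
    by (simp add: h_def)
  have "smooth_on (with_sphere (ball 0 1 - cball 0 (1 - e))) h"
    unfolding smooth_on_def
  proof
    fix x :: "real^'n" assume x: "x \<in> with_sphere (ball 0 1 - cball 0 (1 - e))"
    hence "x \<in> \<Union>\<W>" using e by (auto simp: with_sphere_def)
    then obtain W F where W: "open W" "x \<in> W" "Cinf W F" "\<And>x. x \<in> W \<Longrightarrow> norm x < 1 \<Longrightarrow> F x = f x"
      unfolding \<W>_def by blast
    have "F y = h y" if "y \<in> W \<inter> with_sphere (ball 0 1 - cball 0 (1 - e))" for y
    proof (cases "norm y < 1")
      case True
      then show ?thesis using W that by (simp add: h_def)
    next
      case False
      hence "norm y = 1" using that by (auto simp: with_sphere_def)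
      then show ?thesis using hlim[OF W(1) _ _ W(3,4)] that by auto
    qed
    thus "\<exists>W F. open W \<and> x \<in> W \<and> (\<forall>k. Ck_on k W F) \<and> (\<forall>y\<in>W \<inter> with_sphere (ball 0 1 - cball 0 (1 - e)). F y = h y)"
      using W unfolding Cinf_def by blast
  qed
  moreover have "(f \<longlongrightarrow> h p) (at p within ball 0 1)" if p: "norm p = 1" for p
  proof -
    obtain W F where W: "open W" "p \<in> W" "Cinf W F" "\<And>x. x \<in> W \<Longrightarrow> norm x < 1 \<Longrightarrow> F x = f x"
      using assms p by (rule smooth_infE) blast
    show ?thesis using local_extension_at_sphere[OF W(1,2) p W(3,4)] hlim[OF W(1,2) p W(3,4)] by simp
  qed
  ultimately show ?thesis using that[of e h] e(1) by (simp add: h_def)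
qed

lemma smooth_inf_bounded:
  assumes "smooth_inf f"
  shows "O_inf 0 f"
proof -
  obtain e h where h: "e > 0" "smooth_on (with_sphere (ball 0 1 - cball 0 (1 - e))) h" "\<And>x. norm x < 1 \<Longrightarrow> h x = f x"
    using assms by (rule smooth_inf_extend) blast
  let ?K = "cball 0 1 - ball 0 (1 - e / 2) :: (real^'a) set"
  have "?K \<subseteq> with_sphere (ball 0 1 - cball 0 (1 - e))" using h(1) by (auto simp: with_sphere_def)
  hence "continuous_on ?K h" using smooth_on_continuous_on[OF h(2)] continuous_on_subset by blast
  moreover have "compact ?K" by (intro compact_diff) auto
  ultimately have "bounded (h ` ?K)" by (intro compact_imp_bounded compact_continuous_image)
  then obtain C where C: "\<And>x. x \<in> ?K \<Longrightarrow> norm (h x) \<le> C" unfolding bounded_iff by blast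
  have "eventually (\<lambda>x::real^'a. 1 - e / 2 < norm x \<and> norm x < 1) near_inf"
    using h(1) by (intro eventually_norm_near_inf) auto
  hence "eventually (\<lambda>x. norm (f x) \<le> C * \<rho> x ^ 0) near_inf"
  proof eventually_elim
    case (elim x)
    thus ?case using C[of x] h(3)[of x] by auto
  qed
  thus ?thesis by (rule O_infI)
qed

lemma smooth_inf_of_smooth_on:
  assumes "nbhd_inf U" "smooth_on (with_sphere U) h"
  shows "smooth_inf h"
proof (rule smooth_infI)
  fix p :: "real^'a" assume p: "norm p = 1"
  hence "p \<in> with_sphere U" by (simp add: with_sphere_def)
  then obtain W F where W: "open W" "p \<in> W" "\<forall>k. Ck_on k W F" "\<forall>y\<in>W \<inter> with_sphere U. F y = h y"
    using assms(2) unfolding smooth_on_def by blast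
  obtain e where e: "e > 0" "ball 0 1 - cball 0 (1 - e) \<subseteq> U" using assms(1) unfolding nbhd_inf_def by blast
  have "F x = h x" if "x \<in> W - cball 0 (1 - e)" "norm x < 1" for x
    using that W(4) e(2) by (auto simp: with_sphere_def subset_iff)
  moreover have "Cinf (W - cball 0 (1 - e)) F" "open (W - cball 0 (1 - e))"
    using W Ck_on_subset[of _ W F "W - cball 0 (1 - e)"] by (auto simp: Cinf_def)
  ultimately show "\<exists>W F. open W \<and> p \<in> W \<and> Cinf W F \<and> (\<forall>x\<in>W. norm x < 1 \<longrightarrow> F x = h x)"
    by (intro exI[of _ "W - cball 0 (1 - e)"] exI[of _ F]) (use W p e in auto)
qed

section \<open>Division by powers of \<open>\<rho>\<close> and derivatives of vanishing
  functions\<close>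

lemma smooth_inf_divide_rho:
  fixes f :: "real^'n \<Rightarrow> 'b::euclidean_space"
  assumes "smooth_inf f" "O_inf 1 f"
  shows "smooth_inf (\<lambda>x. inverse (\<rho> x) *\<^sub>R f x)"
proof (rule smooth_infI)
  fix p :: "real^'n" assume p: "norm p = 1"
  obtain W F where W: "open W" "p \<in> W" "Cinf W F" "\<And>x. x \<in> W \<Longrightarrow> norm x < 1 \<Longrightarrow> F x = f x"
    using assms(1) p by (rule smooth_infE) blast
  \<comment> \<open>Limits from inside force the value of the extension at all sphere points of
    \<open>W\<close>, not only at p, as Hadamard's lemma demands.\<close>
  have "F x = 0" if "x \<in> W" "norm x = 1" for x
    by (rule local_extension_eq_limit[OF W(1) that W(3,4)])
      (use tendsto_near_sphere[of 0 f, OF _ that(2)] assms(2) in auto)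
  then obtain V Q where V: "open V" "p \<in> V" "V \<subseteq> W" "Cinf V Q" "\<And>x. x \<in> V \<Longrightarrow> F x = \<rho> x *\<^sub>R Q x"
    using hadamard_sphere[OF W(1,2) p W(3)] by blast
  have "Q x = inverse (\<rho> x) *\<^sub>R f x" if "x \<in> V" "norm x < 1" for x
  proof -
    have "F x = f x" using that V W by blast
    thus ?thesis using V(5)[OF that(1)] rho_pos[OF that(2)] by (metis inverse_mult_eq_1 less_irrefl left_inverse scaleR_one scaleR_scaleR)
  qed
  thus "\<exists>W F. open W \<and> p \<in> W \<and> Cinf W F \<and> (\<forall>x\<in>W. norm x < 1 \<longrightarrow> F x = inverse (\<rho> x) *\<^sub>R f x)"
    using V by blast
qed

lemma smooth_inf_divide:
  fixes f :: "real^'n \<Rightarrow> 'b::euclidean_space"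
  assumes "smooth_inf f" "O_inf m f"
  shows "smooth_inf (\<lambda>x. inverse (\<rho> x ^ m) *\<^sub>R f x)"
  using assms(2)
proof (induction m)
  case 0
  then show ?case using assms by simp
next
  case (Suc m)
  have "O_inf 1 (\<lambda>x. inverse (\<rho> x ^ m) *\<^sub>R f x)"
    by (rule O_inf_divide) (use Suc in simp)
  moreover have "smooth_inf (\<lambda>x. inverse (\<rho> x ^ m) *\<^sub>R f x)"
    using Suc O_inf_mono[of "Suc m" f m] by simp
  ultimately have "smooth_inf (\<lambda>x. inverse (\<rho> x) *\<^sub>R (inverse (\<rho> x ^ m) *\<^sub>R f x))"
    by (intro smooth_inf_divide_rho)
  thus ?case by (simp add: mult.commute)
qed

lemma smooth_inf_factor:
  fixes f :: "real^'n \<Rightarrow> 'b::euclidean_space"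
  assumes "smooth_inf f" "O_inf m f"
  obtains Q where "smooth_inf Q" "eventually (\<lambda>x. f x = \<rho> x ^ m *\<^sub>R Q x) near_inf"
proof
  show "smooth_inf (\<lambda>x. inverse (\<rho> x ^ m) *\<^sub>R f x)" by (rule smooth_inf_divide[OF assms])
  show "eventually (\<lambda>x. f x = \<rho> x ^ m *\<^sub>R (inverse (\<rho> x ^ m) *\<^sub>R f x)) near_inf"
    using eventually_rho by eventually_elim auto
qed

lemma has_derivative_rho: "(\<rho> has_derivative (\<lambda>v. - (x \<bullet> v))) (at x)"
proof -
  have "((\<lambda>x. (1 - x \<bullet> x) / 2) has_derivative (\<lambda>v. - (x \<bullet> v))) (at x)"
    by (auto intro!: derivative_eq_intros simp: inner_commute)
  thus ?thesis by (simp add: \<rho>_def[abs_def] power2_norm_eq_inner)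
qed

lemma eventually_frechet_derivative_eq:
  assumes "eventually (\<lambda>x. f x = g x) near_inf"
  shows "eventually (\<lambda>x. frechet_derivative f (at x) = frechet_derivative g (at x)) near_inf"
  using eventually_near_inf_nhds[OF assms]
proof eventually_elim
  case (elim x)
  then obtain S where "open S" "x \<in> S" "\<forall>y\<in>S. f y = g y" unfolding eventually_nhds by blast
  thus ?case by (intro frechet_derivative_cong_open) auto
qed

lemma frechet_derivative_rho_power:
  assumes "smooth_inf Q"
  shows "eventually (\<lambda>x. frechet_derivative (\<lambda>x. \<rho> x ^ Suc m *\<^sub>R Q x) (at x) =
     (\<lambda>v. \<rho> x ^ Suc m *\<^sub>R frechet_derivative Q (at x) v - (real (Suc m) * \<rho> x ^ m * (x \<bullet> v)) *\<^sub>R Q x)) near_inf"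
  using smooth_inf_has_derivative[OF assms]
proof eventually_elim
  case (elim x)
  have "((\<lambda>x. \<rho> x ^ Suc m *\<^sub>R Q x) has_derivative
     (\<lambda>v. \<rho> x ^ Suc m *\<^sub>R frechet_derivative Q (at x) v - (real (Suc m) * \<rho> x ^ m * (x \<bullet> v)) *\<^sub>R Q x)) (at x)"
    by (rule derivative_eq_intros has_derivative_rho elim refl)+ (auto simp: fun_eq_iff)
  from frechet_derivative_at[OF this] show ?case by simp
qed

lemma O_inf_derivative:
  fixes f :: "real^'n \<Rightarrow> 'b::euclidean_space"
  assumes "smooth_inf f" "O_inf (Suc m) f"
  shows "O_inf m (\<lambda>x. frechet_derivative f (at x) v)"
proof -
  obtain Q where Q: "smooth_inf Q" "eventually (\<lambda>x. f x = \<rho> x ^ Suc m *\<^sub>R Q x) near_inf"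
    using assms by (rule smooth_inf_factor)
  have "smooth_inf (\<lambda>x. \<rho> x ^ 1 *\<^sub>R frechet_derivative Q (at x) v - (real (Suc m) * (x \<bullet> v)) *\<^sub>R Q x)"
    by (intro smooth_inf_diff smooth_inf_bilinear[OF bounded_bilinear_scaleR] smooth_inf_power smooth_inf_rho
        smooth_inf_derivative Q smooth_inf_bilinear[OF bounded_bilinear_mult]
        smooth_inf_bilinear[OF bounded_bilinear_inner] smooth_inf_const smooth_inf_id)
  from smooth_inf_bounded[OF this]
  have "O_inf (m + 0) (\<lambda>x. \<rho> x ^ m *\<^sub>R (\<rho> x ^ 1 *\<^sub>R frechet_derivative Q (at x) v - (real (Suc m) * (x \<bullet> v)) *\<^sub>R Q x))"
    by (simp only: O_inf_rho_power_cancel)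
  moreover have "eventually (\<lambda>x. \<rho> x ^ m *\<^sub>R (\<rho> x ^ 1 *\<^sub>R frechet_derivative Q (at x) v - (real (Suc m) * (x \<bullet> v)) *\<^sub>R Q x)
     = frechet_derivative f (at x) v) near_inf"
    using eventually_frechet_derivative_eq[OF Q(2)] frechet_derivative_rho_power[OF Q(1), of m]
    by eventually_elim (simp add: scaleR_diff_right mult_ac)
  ultimately show ?thesis using O_inf_cong by fastforce
qed

subsection \<open>Jacobians\<close>

definition outer :: "real^'n \<Rightarrow> real^'n \<Rightarrow> real^'n^'n" where
  "outer u v = (\<chi> i j. u $ i * v $ j)"

definition jac :: "(real^'n \<Rightarrow> real^'n) \<Rightarrow> real^'n \<Rightarrow> real^'n^'n" where
  "jac f x = matrix (frechet_derivative f (at x))"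

lemma bounded_bilinear_outer: "bounded_bilinear (outer :: real^'n \<Rightarrow> real^'n \<Rightarrow> real^'n^'n)"
  unfolding bilinear_conv_bounded_bilinear[symmetric] bilinear_def
  by (auto intro!: linearI simp: outer_def vec_eq_iff algebra_simps)

lemma bounded_bilinear_matrix_mult: "bounded_bilinear ((**) :: real^'n^'n \<Rightarrow> real^'n^'n \<Rightarrow> real^'n^'n)"
  unfolding bilinear_conv_bounded_bilinear[symmetric] bilinear_def
  by (auto intro!: linearI simp: matrix_matrix_mult_def vec_eq_iff algebra_simps sum.distrib sum_distrib_left)

lemma bounded_bilinear_vector_matrix: "bounded_bilinear ((v*) :: real^'n \<Rightarrow> real^'n^'n \<Rightarrow> real^'n)"
  unfolding bilinear_conv_bounded_bilinear[symmetric] bilinear_def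
  by (auto intro!: linearI simp: vector_matrix_mult_def vec_eq_iff algebra_simps sum.distrib sum_distrib_left)

lemma bounded_linear_transpose: "bounded_linear (transpose :: real^'n^'n \<Rightarrow> real^'n^'n)"
  unfolding linear_conv_bounded_linear[symmetric]
  by (auto intro!: linearI simp: transpose_def vec_eq_iff)

lemmas smooth_inf_matrix_mult = smooth_inf_bilinear[OF bounded_bilinear_matrix_mult]
  and smooth_inf_outer = smooth_inf_bilinear[OF bounded_bilinear_outer]
  and smooth_inf_vector_matrix = smooth_inf_bilinear[OF bounded_bilinear_vector_matrix]
  and smooth_inf_transpose = smooth_inf_linear[OF bounded_linear_transpose]
  and smooth_inf_scaleR = smooth_inf_bilinear[OF bounded_bilinear_scaleR]
  and smooth_inf_mult = smooth_inf_bilinear[OF bounded_bilinear_mult]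
  and smooth_inf_inner = smooth_inf_bilinear[OF bounded_bilinear_inner]
  and O_inf_matrix_mult = O_inf_bilinear[OF bounded_bilinear_matrix_mult]
  and O_inf_outer = O_inf_bilinear[OF bounded_bilinear_outer]
  and O_inf_vector_matrix = O_inf_bilinear[OF bounded_bilinear_vector_matrix]
  and O_inf_transpose = O_inf_linear[OF bounded_linear_transpose]
  and O_inf_scaleR = O_inf_bilinear[OF bounded_bilinear_scaleR]
  and O_inf_mult = O_inf_bilinear[OF bounded_bilinear_mult]
  and O_inf_inner = O_inf_bilinear[OF bounded_bilinear_inner]

lemmas smooth_inf_intros = smooth_inf_add smooth_inf_diff smooth_inf_minus smooth_inf_matrix_mult
  smooth_inf_outer smooth_inf_vector_matrix smooth_inf_transpose smooth_inf_scaleR smooth_inf_mult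
  smooth_inf_inner smooth_inf_const smooth_inf_id smooth_inf_rho smooth_inf_power

lemma transpose_add: "transpose (A + B) = transpose A + transpose (B :: real^'n^'n)"
  and transpose_diff: "transpose (A - B) = transpose A - transpose (B :: real^'n^'n)"
  and transpose_scaleR: "transpose (c *\<^sub>R A) = c *\<^sub>R transpose (A :: real^'n^'n)"
  and transpose_outer: "transpose (outer u v) = outer v u"
  by (auto simp: transpose_def vec_eq_iff outer_def mult.commute)

lemma vector_matrix_outer: "x v* outer u v = (x \<bullet> u) *\<^sub>R v"
  by (simp add: vec_eq_iff vector_matrix_mult_def outer_def inner_vec_def sum_distrib_left sum_distrib_right mult_ac)

lemma outer_matrix_mult: "outer u v ** A = outer u (v v* A)"
  by (simp add: vec_eq_iff vector_matrix_mult_def outer_def matrix_matrix_mult_def sum_distrib_left mult_ac)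

lemma vector_matrix_mat1: "x v* (c *\<^sub>R mat 1) = c *\<^sub>R (x :: real^'n)"
  using vector_matrix_mul_rid[of x] bounded_bilinear.scaleR_right[OF bounded_bilinear_vector_matrix, of x c "mat 1"]
  by simp

lemma vector_matrix_mult_assoc: "x v* (A ** B) = (x v* A) v* (B :: real^'n^'n)"
  by (simp add: vec_eq_iff vector_matrix_mult_def matrix_matrix_mult_def sum_distrib_left sum_distrib_right mult_ac)
    (auto intro: sum.swap)

lemmas vector_matrix_simps = bounded_bilinear.add_right[OF bounded_bilinear_vector_matrix]
  bounded_bilinear.diff_right[OF bounded_bilinear_vector_matrix]
  bounded_bilinear.scaleR_right[OF bounded_bilinear_vector_matrix]

lemmas matrix_mult_simps = bounded_bilinear.add_left[OF bounded_bilinear_matrix_mult]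
  bounded_bilinear.add_right[OF bounded_bilinear_matrix_mult]
  bounded_bilinear.diff_left[OF bounded_bilinear_matrix_mult]
  bounded_bilinear.diff_right[OF bounded_bilinear_matrix_mult]
  bounded_bilinear.scaleR_left[OF bounded_bilinear_matrix_mult]
  bounded_bilinear.scaleR_right[OF bounded_bilinear_matrix_mult]

text \<open>Writes a Jacobian through derivatives in the coordinate directions, so that smoothness
  and order bounds for these carry over to \<open>jac\<close>.\<close>

lemma matrix_eq_sum_outer: "matrix f = (\<Sum>j\<in>UNIV. outer (f (axis j 1)) (axis j 1))"
  by (simp add: vec_eq_iff matrix_def outer_def axis_def if_distrib cong: if_cong)

lemma smooth_inf_jac:
  assumes "smooth_inf u"
  shows "smooth_inf (jac u)"
proof -
  have "smooth_inf (\<lambda>x. \<Sum>j\<in>UNIV. outer (frechet_derivative u (at x) (axis j 1)) (axis j 1))"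
    by (intro smooth_inf_sum smooth_inf_outer smooth_inf_derivative assms smooth_inf_const) simp
  thus ?thesis by (simp add: jac_def[abs_def] matrix_eq_sum_outer)
qed

lemma O_inf_jac:
  assumes "smooth_inf u" "O_inf (Suc m) u"
  shows "O_inf m (jac u)"
proof -
  have "O_inf (m + 0) (\<lambda>x. \<Sum>j\<in>UNIV. outer (frechet_derivative u (at x) (axis j 1)) (axis j 1))"
    by (intro O_inf_sum O_inf_outer O_inf_derivative assms O_inf_const) simp
  thus ?thesis by (simp add: jac_def[abs_def] matrix_eq_sum_outer)
qed

lemma jac_eq: "(f has_derivative f') (at x) \<Longrightarrow> jac f x = matrix f'"
  by (simp add: jac_def frechet_derivative_at[symmetric])

lemma has_derivative_jac: "smooth_inf f \<Longrightarrow> eventually (\<lambda>x. (f has_derivative (\<lambda>v. jac f x *v v)) (at x)) near_inf"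
  using smooth_inf_has_derivative
proof (rule eventually_mono)
  fix x assume f: "(f has_derivative frechet_derivative f (at x)) (at x)"
  have "(\<lambda>v. jac f x *v v) = frechet_derivative f (at x)"
    unfolding jac_def by (rule matrix_vector_mul) (rule has_derivative_bounded_linear[OF f])
  thus "(f has_derivative (\<lambda>v. jac f x *v v)) (at x)" using f by simp
qed

lemma jac_eqI: "(f has_derivative (\<lambda>v. A *v v)) (at x) \<Longrightarrow> jac f x = A"
  by (simp add: jac_eq)

lemma jac_cong: "eventually (\<lambda>x. f x = g x) near_inf \<Longrightarrow> eventually (\<lambda>x. jac f x = jac g x) near_inf"
  unfolding jac_def using eventually_frechet_derivative_eq by (rule eventually_mono) auto

lemma jac_add:
  assumes "smooth_inf u" "smooth_inf v"
  shows "eventually (\<lambda>x. jac (\<lambda>x. u x + v x) x = jac u x + jac v x) near_inf"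
  using has_derivative_jac[OF assms(1)] has_derivative_jac[OF assms(2)]
proof eventually_elim
  case (elim x)
  show ?case
    by (rule jac_eqI) (use has_derivative_add[OF elim] in \<open>simp add: matrix_vector_mult_add_rdistrib\<close>)
qed

lemma jac_scaleR:
  assumes "smooth_inf u"
  shows "eventually (\<lambda>x. jac (\<lambda>x. c *\<^sub>R u x) x = c *\<^sub>R jac u x) near_inf"
  using has_derivative_jac[OF assms(1)]
proof eventually_elim
  case (elim x)
  show ?case
    by (rule jac_eqI) (use has_derivative_scaleR_right[OF elim, of c] in \<open>simp add: scaleR_matrix_vector_assoc\<close>)
qed

lemma jac_id: "jac (\<lambda>x. x) x = mat 1"
  by (rule jac_eqI) simp

lemma jac_compose:
  assumes "(f has_derivative (\<lambda>v. jac f (g x) *v v)) (at (g x))" "(g has_derivative (\<lambda>v. jac g x *v v)) (at x)"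
  shows "jac (\<lambda>x. f (g x)) x = jac f (g x) ** jac g x"
  by (rule jac_eqI) (use has_derivative_compose[OF assms(2,1)] in \<open>simp add: matrix_vector_mul_assoc\<close>)

lemma jac_rho_power:
  assumes "smooth_inf V"
  shows "eventually (\<lambda>x. jac (\<lambda>x. \<rho> x ^ Suc m *\<^sub>R V x) x =
     \<rho> x ^ m *\<^sub>R (\<rho> x *\<^sub>R jac V x - real (Suc m) *\<^sub>R outer (V x) x)) near_inf"
  using frechet_derivative_rho_power[OF assms, of m]
proof eventually_elim
  case (elim x)
  show ?case unfolding jac_def elim
    by (simp add: vec_eq_iff matrix_def outer_def inner_axis algebra_simps)
qed

subsection \<open>The linearized gauge action\<close>

text \<open>\<open>Lie u\<close> is \<open>\<rho>\<^sup>2\<close> times the Lie derivative of the hyperbolic metric along \<open>u\<close>.\<close>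

definition Lie :: "(real^'n \<Rightarrow> real^'n) \<Rightarrow> real^'n \<Rightarrow> real^'n^'n" where
  "Lie u x = jac u x + transpose (jac u x) + (2 * (inverse (\<rho> x) * (x \<bullet> u x))) *\<^sub>R mat 1"

text \<open>The leading coefficient of \<open>Lie (\<rho>\<^sup>m\<^sup>+\<^sup>1 V)\<close>.\<close>

definition symb :: "nat \<Rightarrow> real^'n \<Rightarrow> real^'n \<Rightarrow> real^'n^'n" where
  "symb m x v = (2 * (x \<bullet> v)) *\<^sub>R mat 1 - real (Suc m) *\<^sub>R (outer v x + outer x v)"

lemma O_inf_divide_rho: "O_inf (Suc m) f \<Longrightarrow> O_inf m (\<lambda>x. inverse (\<rho> x) * (f x :: real))"
  using O_inf_divide[of 1 m f] by simp

lemma smooth_inf_Lie: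
  assumes "smooth_inf u" "O_inf 1 u"
  shows "smooth_inf (Lie u)"
proof -
  have "O_inf (0 + 1) (\<lambda>x. x \<bullet> u x)"
    by (intro O_inf_inner assms smooth_inf_bounded smooth_inf_id)
  hence "smooth_inf (\<lambda>x. inverse (\<rho> x) *\<^sub>R (x \<bullet> u x))"
    by (intro smooth_inf_divide_rho smooth_inf_intros assms) auto
  hence s: "smooth_inf (\<lambda>x. inverse (\<rho> x) * (x \<bullet> u x))" by simp
  hence "smooth_inf (\<lambda>x. jac u x + transpose (jac u x) + (2 * (inverse (\<rho> x) * (x \<bullet> u x))) *\<^sub>R mat 1)"
    by (intro smooth_inf_add smooth_inf_transpose smooth_inf_jac assms smooth_inf_scaleR
        smooth_inf_mult[OF smooth_inf_const s] smooth_inf_const)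
  thus ?thesis by (simp add: Lie_def[abs_def])
qed

lemma O_inf_Lie:
  assumes "smooth_inf u" "O_inf (Suc m) u"
  shows "O_inf m (Lie u)"
proof -
  have "O_inf (0 + Suc m) (\<lambda>x. x \<bullet> u x)"
    by (intro O_inf_inner assms smooth_inf_bounded smooth_inf_id)
  hence "O_inf m (\<lambda>x. inverse (\<rho> x) * (x \<bullet> u x))"
    by (intro O_inf_divide_rho) auto
  from O_inf_scaleR[OF O_inf_mult[OF O_inf_const[of 2] this] O_inf_const[of "mat 1 :: real^'a^'a"]]
  have "O_inf m (\<lambda>x. (2 * (inverse (\<rho> x) * (x \<bullet> u x))) *\<^sub>R (mat 1 :: real^'a^'a))" by simp
  hence "O_inf m (\<lambda>x. jac u x + transpose (jac u x) + (2 * (inverse (\<rho> x) * (x \<bullet> u x))) *\<^sub>R mat 1)"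
    by (intro O_inf_add O_inf_transpose O_inf_jac assms)
  thus ?thesis by (simp add: Lie_def[abs_def])
qed

lemma transpose_Lie: "transpose (Lie u x) = Lie u x"
  by (simp add: Lie_def transpose_add transpose_scaleR transpose_mat add.commute)

lemma Lie_cong: "eventually (\<lambda>x. u x = v x) near_inf \<Longrightarrow> eventually (\<lambda>x. Lie u x = Lie v x) near_inf"
  using jac_cong[of u v] by (auto elim: eventually_elim2 simp: Lie_def)

lemma Lie_add:
  assumes "smooth_inf u" "smooth_inf v"
  shows "eventually (\<lambda>x. Lie (\<lambda>x. u x + v x) x = Lie u x + Lie v x) near_inf"
  using jac_add[OF assms]
  by eventually_elim (simp add: Lie_def transpose_add inner_add_right algebra_simps scaleR_add_left)

lemma Lie_scaleR:
  assumes "smooth_inf u"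
  shows "eventually (\<lambda>x. Lie (\<lambda>x. c *\<^sub>R u x) x = c *\<^sub>R Lie u x) near_inf"
  using jac_scaleR[OF assms, of c]
  by eventually_elim (simp add: Lie_def transpose_scaleR scaleR_add_right mult_ac)

text \<open>Differentiating the power of \<rho> and dividing by \<rho> in the conformal term lower
  the order by the same amount, and both contributions are algebraic in V. Derivatives of V keep an
  extra factor \<rho>, so at leading order the Lie derivative acts on V pointwise.\<close>

lemma Lie_rho_power:
  assumes "smooth_inf V"
  shows "eventually (\<lambda>x. Lie (\<lambda>x. \<rho> x ^ Suc m *\<^sub>R V x) x =
     \<rho> x ^ m *\<^sub>R (\<rho> x *\<^sub>R (jac V x + transpose (jac V x)) + symb m x (V x))) near_inf"
  using jac_rho_power[OF assms, of m] eventually_rho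
proof eventually_elim
  case (elim x)
  have "inverse (\<rho> x) * (x \<bullet> (\<rho> x ^ Suc m *\<^sub>R V x)) = \<rho> x ^ m * (x \<bullet> V x)" using elim by simp
  hence "Lie (\<lambda>x. \<rho> x ^ Suc m *\<^sub>R V x) x = jac (\<lambda>x. \<rho> x ^ Suc m *\<^sub>R V x) x + transpose (jac (\<lambda>x. \<rho> x ^ Suc m *\<^sub>R V x) x)
     + (2 * (\<rho> x ^ m * (x \<bullet> V x))) *\<^sub>R mat 1" by (simp only: Lie_def)
  thus ?case unfolding elim(1)
    by (simp add: symb_def transpose_scaleR transpose_diff transpose_add transpose_outer algebra_simps)
qed

lemma vector_matrix_symb:
  "x v* symb m x v = (2 * (x \<bullet> v)) *\<^sub>R x - real (Suc m) *\<^sub>R ((x \<bullet> v) *\<^sub>R x + (x \<bullet> x) *\<^sub>R v)"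
  by (simp add: symb_def vector_matrix_simps vector_matrix_mat1 vector_matrix_outer)

text \<open>A second contraction with x leaves -2 m |x|^2 (x . V), which controls the normal
  component because m > 0. Once that component is known to vanish on the sphere, what is left of the
  single contraction is (m + 1) |x|^2 V up to sign.\<close>

lemma symb_contract_vanishing:
  assumes "m > 0" and Y: "O_inf 1 (\<lambda>x. x v* symb m x (V x))"
  shows "O_inf 1 V"
proof -
  have "O_inf (0 + 1) (\<lambda>x. x \<bullet> (x v* symb m x (V x)))"
    by (intro O_inf_inner smooth_inf_bounded smooth_inf_id Y)
  moreover have "x \<bullet> (x v* symb m x (V x)) = - (2 * real m * (x \<bullet> x)) * (x \<bullet> V x)" for x
    unfolding vector_matrix_symb by (simp add: inner_diff_right inner_add_right algebra_simps)
  ultimately have *: "O_inf 1 (\<lambda>x. - (2 * real m * (x \<bullet> x)) * (x \<bullet> V x))" by (simp del: mult_minus_left)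
  \<comment> \<open>Near infinity |x| > 1/2, so 4 |x|^2 \<ge> 1; this is the source of the constant
    2 here and of 4 for the full vector.\<close>
  have s: "O_inf 1 (\<lambda>x. x \<bullet> V x)"
  proof (rule O_inf_bound[OF *, where K = 2], rule eventually_mono[OF eventually_rho])
    fix x :: "real^'a" assume "0 < \<rho> x \<and> \<rho> x \<le> 1 / 2 \<and> 1 / 2 < norm x \<and> norm x < 1"
    hence "(1/2)\<^sup>2 \<le> (norm x)\<^sup>2" by (intro power_mono) auto
    hence "1 \<le> 4 * (x \<bullet> x)" by (simp add: power2_norm_eq_inner[symmetric] power2_eq_square)
    also have "\<dots> \<le> 4 * real m * (x \<bullet> x)" using assms(1) by (intro mult_right_mono) auto
    finally have "1 * \<bar>x \<bullet> V x\<bar> \<le> (4 * real m * (x \<bullet> x)) * \<bar>x \<bullet> V x\<bar>" by (intro mult_right_mono) auto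
    thus "norm (x \<bullet> V x) \<le> 2 * norm (- (2 * real m * (x \<bullet> x)) * (x \<bullet> V x))"
      by (simp add: abs_mult)
  qed
  have "O_inf 1 (\<lambda>x. (2 * (x \<bullet> V x)) *\<^sub>R x)" "O_inf 1 (\<lambda>x. real (Suc m) *\<^sub>R ((x \<bullet> V x) *\<^sub>R x))"
    using O_inf_scaleR[OF O_inf_mult[OF O_inf_const[of 2] s] smooth_inf_bounded[OF smooth_inf_id]]
      O_inf_scaleR[OF O_inf_const[of "real (Suc m)"] O_inf_scaleR[OF s smooth_inf_bounded[OF smooth_inf_id]]] by simp_all
  hence "O_inf 1 (\<lambda>x. (2 * (x \<bullet> V x)) *\<^sub>R x - real (Suc m) *\<^sub>R ((x \<bullet> V x) *\<^sub>R x) - x v* symb m x (V x))"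
    by (intro O_inf_diff Y)
  moreover have "(2 * (x \<bullet> V x)) *\<^sub>R x - real (Suc m) *\<^sub>R ((x \<bullet> V x) *\<^sub>R x) - x v* symb m x (V x)
     = (real (Suc m) * (x \<bullet> x)) *\<^sub>R V x" for x
    unfolding vector_matrix_symb by (simp add: scaleR_add_right del: of_nat_Suc)
  ultimately have *: "O_inf 1 (\<lambda>x. (real (Suc m) * (x \<bullet> x)) *\<^sub>R V x)" by simp
  show ?thesis
  proof (rule O_inf_bound[OF *, where K = 4], rule eventually_mono[OF eventually_rho])
    fix x :: "real^'a" assume "0 < \<rho> x \<and> \<rho> x \<le> 1 / 2 \<and> 1 / 2 < norm x \<and> norm x < 1"
    hence "(1/2)\<^sup>2 \<le> (norm x)\<^sup>2" by (intro power_mono) auto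
    hence "1 \<le> 4 * (x \<bullet> x)" by (simp add: power2_norm_eq_inner[symmetric] power2_eq_square)
    also have "\<dots> \<le> 4 * real (Suc m) * (x \<bullet> x)" by (intro mult_right_mono) auto
    finally have "1 * norm (V x) \<le> (4 * real (Suc m) * (x \<bullet> x)) * norm (V x)" by (intro mult_right_mono) auto
    thus "norm (V x) \<le> 4 * norm ((real (Suc m) * (x \<bullet> x)) *\<^sub>R V x)"
      by (simp add: abs_mult del: of_nat_Suc)
  qed
qed

text \<open>The gain of one order that drives both uniqueness arguments. Contraction with x removes
  the transverse tensor \<open>T\<close> and reduces the bound to the leading coefficient of the
  field; the derivative terms, collected in \<open>Z\<close>, already carry a factor \<rho>.\<close>

lemma gauge_field_vanishing:
  assumes "smooth_inf u" "O_inf (Suc q) u" "q > 0"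
    and T: "eventually (\<lambda>x. x v* T x = 0) near_inf" and L: "O_inf (Suc q) (\<lambda>x. Lie u x + T x)"
  shows "O_inf (Suc (Suc q)) u"
proof -
  obtain V where V: "smooth_inf V" "eventually (\<lambda>x. u x = \<rho> x ^ Suc q *\<^sub>R V x) near_inf"
    using assms(1,2) by (rule smooth_inf_factor)
  define Z where "Z x = \<rho> x ^ 1 *\<^sub>R (x v* (jac V x + transpose (jac V x)))" for x
  have "O_inf (0 + Suc q) (\<lambda>x. x v* (Lie u x + T x))"
    by (intro O_inf_vector_matrix smooth_inf_bounded smooth_inf_id L)
  moreover have ev: "eventually (\<lambda>x. x v* (Lie u x + T x) = \<rho> x ^ q *\<^sub>R (Z x + x v* symb q x (V x))) near_inf"
    using Lie_rho_power[OF V(1), of q] Lie_cong[OF V(2)] T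
    by eventually_elim (simp add: vector_matrix_simps Z_def scaleR_add_right)
  ultimately have "O_inf (q + 1) (\<lambda>x. \<rho> x ^ q *\<^sub>R (Z x + x v* symb q x (V x)))"
    using O_inf_cong[OF ev] by simp
  hence "O_inf 1 (\<lambda>x. Z x + x v* symb q x (V x))" by (simp only: O_inf_rho_power_cancel)
  moreover have "O_inf (1 + 0) Z"
    unfolding Z_def O_inf_rho_power_cancel
    by (intro smooth_inf_bounded smooth_inf_intros smooth_inf_jac V)
  ultimately have "O_inf 1 (\<lambda>x. (Z x + x v* symb q x (V x)) - Z x)" by (intro O_inf_diff) auto
  hence "O_inf 1 V" using symb_contract_vanishing[OF assms(3)] by simp
  hence "O_inf (Suc q + 1) (\<lambda>x. \<rho> x ^ Suc q *\<^sub>R V x)" by (simp only: O_inf_rho_power_cancel)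
  moreover have "eventually (\<lambda>x. \<rho> x ^ Suc q *\<^sub>R V x = u x) near_inf"
    using V(2) by (rule eventually_mono) simp
  ultimately show ?thesis using O_inf_cong by (metis Suc_eq_plus1)
qed

subsection \<open>Pull-back by maps close to the identity\<close>

text \<open>The index is the order to which the Jacobian agrees with the identity, one less than the
  order of the displacement; representatives of germs in \<open>I0 (k + 1)\<close> are thus of type
  \<open>near_id k\<close>.\<close>

definition near_id :: "nat \<Rightarrow> (real^'n \<Rightarrow> real^'n) \<Rightarrow> bool" where
  "near_id k \<phi> \<longleftrightarrow> smooth_inf \<phi> \<and> O_inf (Suc k) (\<lambda>x. \<phi> x - x)"

text \<open>If \<open>g = \<rho>\<^sup>-\<^sup>2 (1 + H)\<close>, then the pull-back of \<open>g\<close> by \<open>\<phi>\<close> is \<open>\<rho>\<^sup>-\<^sup>2 (1 + pull \<phi> H)\<close>.\<close>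

definition pull :: "(real^'n \<Rightarrow> real^'n) \<Rightarrow> (real^'n \<Rightarrow> real^'n^'n) \<Rightarrow> real^'n \<Rightarrow> real^'n^'n" where
  "pull \<phi> H x = (\<rho> x / \<rho> (\<phi> x))\<^sup>2 *\<^sub>R (transpose (jac \<phi> x) ** (mat 1 + H (\<phi> x)) ** jac \<phi> x) - mat 1"

text \<open>The relative decrease of \<rho> along the map, exact and not only to first order: it
  comes from |x + w|^2 = |x|^2 + 2 x . w + |w|^2 with w the displacement.\<close>

definition rho_defect :: "(real^'n \<Rightarrow> real^'n) \<Rightarrow> real^'n \<Rightarrow> real" where
  "rho_defect \<phi> x = inverse (\<rho> x) * (x \<bullet> (\<phi> x - x) + ((\<phi> x - x) \<bullet> (\<phi> x - x)) / 2)"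

lemma rho_defect: "\<rho> x > 0 \<Longrightarrow> \<rho> (\<phi> x) = \<rho> x * (1 - rho_defect \<phi> x)"
proof -
  assume rx: "\<rho> x > 0"
  have "a * (1 - inverse a * z) = a - z" if "a > 0" for a z :: real
    using that by (simp add: right_diff_distrib)
  from this[OF rx] have "\<rho> x * (1 - rho_defect \<phi> x) = \<rho> x - (x \<bullet> (\<phi> x - x) + ((\<phi> x - x) \<bullet> (\<phi> x - x)) / 2)"
    by (simp only: rho_defect_def)
  also have "\<dots> = \<rho> (\<phi> x)"
    by (simp add: \<rho>_def power2_norm_eq_inner inner_diff_left inner_diff_right inner_commute field_simps)
  finally show ?thesis by simp
qed

lemma
  assumes "near_id k \<phi>"
  shows O_inf_rho_defect: "O_inf k (rho_defect \<phi>)"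
    and O_inf_rho_defect_linear: "O_inf (2 * k) (\<lambda>x. rho_defect \<phi> x - inverse (\<rho> x) * (x \<bullet> (\<phi> x - x)))"
    and smooth_inf_rho_defect: "smooth_inf (rho_defect \<phi>)"
proof -
  have w: "O_inf (Suc k) (\<lambda>x. \<phi> x - x)" "smooth_inf (\<lambda>x. \<phi> x - x)"
    using assms by (auto simp: near_id_def intro: smooth_inf_intros)
  have "O_inf (0 + Suc k) (\<lambda>x. x \<bullet> (\<phi> x - x))"
    by (intro O_inf_inner w smooth_inf_bounded smooth_inf_id)
  hence a: "O_inf (Suc k) (\<lambda>x. x \<bullet> (\<phi> x - x))" by simp
  have "O_inf (Suc k + Suc k) (\<lambda>x. (\<phi> x - x) \<bullet> (\<phi> x - x))"
    by (intro O_inf_inner w)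
  hence "O_inf (Suc k + Suc k) (\<lambda>x. ((\<phi> x - x) \<bullet> (\<phi> x - x)) / 2)"
    by (rule O_inf_linear[OF bounded_linear_divide])
  hence b: "O_inf (Suc (2 * k)) (\<lambda>x. ((\<phi> x - x) \<bullet> (\<phi> x - x)) / 2)"
    by (rule O_inf_mono) simp
  have ab: "O_inf (Suc k) (\<lambda>x. x \<bullet> (\<phi> x - x) + ((\<phi> x - x) \<bullet> (\<phi> x - x)) / 2)"
    by (intro O_inf_add a O_inf_mono[OF b]) simp
  from O_inf_divide_rho[OF ab] show "O_inf k (rho_defect \<phi>)"
    by (simp add: rho_defect_def[abs_def])
  have "smooth_inf (\<lambda>x. inverse (\<rho> x) *\<^sub>R (x \<bullet> (\<phi> x - x) + ((\<phi> x - x) \<bullet> (\<phi> x - x)) / 2))"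
    by (rule smooth_inf_divide_rho)
      (auto intro!: smooth_inf_intros w O_inf_mono[OF ab] smooth_inf_linear[OF bounded_linear_divide])
  thus "smooth_inf (rho_defect \<phi>)" by (simp add: rho_defect_def[abs_def])
  show "O_inf (2 * k) (\<lambda>x. rho_defect \<phi> x - inverse (\<rho> x) * (x \<bullet> (\<phi> x - x)))"
    using O_inf_divide_rho[OF b] by (simp add: rho_defect_def algebra_simps)
qed

section \<open>Composition with maps close to the identity\<close>

lemma norm_less_one_iff_rho: "norm x < 1 \<longleftrightarrow> 0 < \<rho> x"
  by (simp add: \<rho>_def abs_square_less_1)

text \<open>For k > 0 the relative defect tends to 0, so \<rho> before and after the map are
  comparable. Positivity of \<rho> then shows that points near infinity are mapped into the open
  ball.\<close>

lemma near_id_rho: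
  assumes "near_id k \<phi>" "k > 0"
  shows "eventually (\<lambda>x. \<rho> x / 2 < \<rho> (\<phi> x) \<and> \<rho> (\<phi> x) < 2 * \<rho> x \<and> norm (\<phi> x) < 1) near_inf"
proof -
  have "eventually (\<lambda>x. norm (rho_defect \<phi> x) < 1 / 2) near_inf"
    by (rule O_inf_small[OF O_inf_rho_defect[OF assms(1)] assms(2)]) simp
  thus ?thesis using eventually_rho
  proof eventually_elim
    case (elim x)
    have r: "\<rho> (\<phi> x) = \<rho> x * (1 - rho_defect \<phi> x)" using elim by (intro rho_defect) auto
    have "\<rho> x * (1 / 2) < \<rho> x * (1 - rho_defect \<phi> x)" "\<rho> x * (1 - rho_defect \<phi> x) < \<rho> x * 2"
      using elim by (intro mult_strict_left_mono; simp add: abs_less_iff; linarith)+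
    thus ?case unfolding norm_less_one_iff_rho using r elim by auto
  qed
qed

lemma near_id_eventually:
  assumes "near_id k \<phi>" "k > 0" "eventually P near_inf"
  shows "eventually (\<lambda>x. P (\<phi> x)) near_inf"
proof -
  obtain e where e: "e > 0" "\<And>x :: real^'a. 1 - e < norm x \<Longrightarrow> norm x < 1 \<Longrightarrow> P x"
    using assms(3) unfolding eventually_near_inf_collar by blast
  have "eventually (\<lambda>x. norm (\<phi> x - x) < e / 2) near_inf"
    by (rule O_inf_small[where m = "Suc k"]) (use assms e in \<open>auto simp: near_id_def\<close>)
  moreover have "eventually (\<lambda>x::real^'a. 1 - e / 2 < norm x \<and> norm x < 1) near_inf"
    by (rule eventually_norm_near_inf) (use e in simp)
  ultimately show ?thesis using near_id_rho[OF assms(1,2)]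
  proof eventually_elim
    case (elim x)
    have "norm x - norm (\<phi> x) \<le> norm (\<phi> x - x)" using norm_triangle_ineq2[of x "\<phi> x"] by (simp add: norm_minus_commute)
    thus ?case using elim e(2)[of "\<phi> x"] by linarith
  qed
qed

lemma near_id_O_inf:
  assumes "near_id k \<phi>" "k > 0" "O_inf m f"
  shows "O_inf m (\<lambda>x. f (\<phi> x))"
proof -
  obtain C where C: "C \<ge> 0" "eventually (\<lambda>x. norm (f x) \<le> C * \<rho> x ^ m) near_inf" using assms(3) by (rule O_infE)
  from near_id_eventually[OF assms(1,2) C(2)] near_id_rho[OF assms(1,2)] eventually_rho
  have "eventually (\<lambda>x. norm (f (\<phi> x)) \<le> (C * 2 ^ m) * \<rho> x ^ m) near_inf"
  proof eventually_elim
    case (elim x)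
    have "\<rho> (\<phi> x) ^ m \<le> (2 * \<rho> x) ^ m" using elim by (intro power_mono) auto
    hence "C * \<rho> (\<phi> x) ^ m \<le> C * (2 * \<rho> x) ^ m" using C by (intro mult_left_mono)
    thus ?case using elim by (simp add: power_mult_distrib)
  qed
  thus ?thesis by (rule O_infI)
qed

lemma near_id_smooth_inf:
  assumes "near_id k \<phi>" "k > 0" "smooth_inf f"
  shows "smooth_inf (\<lambda>x. f (\<phi> x))"
proof (rule smooth_inf_compose[where m = k])
  show "smooth_inf \<phi>" "O_inf (Suc k) (\<lambda>x. \<phi> x - x)" using assms(1) by (simp_all add: near_id_def)
  show "eventually (\<lambda>x. norm (\<phi> x) < 1) near_inf" using near_id_rho[OF assms(1,2)] by (rule eventually_mono) simp
qed (rule assms(3))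

lemma near_id_compose:
  assumes "near_id k \<phi>" "near_id k \<psi>" "k > 0"
  shows "near_id k (\<lambda>x. \<phi> (\<psi> x))"
proof -
  have "O_inf (Suc k) (\<lambda>x. (\<phi> (\<psi> x) - \<psi> x) + (\<psi> x - x))"
    using assms near_id_O_inf[OF assms(2,3), of "Suc k" "\<lambda>x. \<phi> x - x"]
    by (intro O_inf_add) (auto simp: near_id_def)
  thus ?thesis using assms near_id_smooth_inf[OF assms(2,3), of \<phi>] by (auto simp: near_id_def)
qed

text \<open>The mean value inequality on the segment from x to its image. The segment stays in the
  ball by convexity and in the collar where the derivative is bounded because the displacement is
  small; the operator norm is bounded by the sum of the bounds on basis vectors.\<close>

lemma near_id_lipschitz:
  fixes F :: "real^'n \<Rightarrow> 'b::euclidean_space"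
  assumes "near_id q \<phi>" "q > 0" "smooth_inf F"
  shows "O_inf (Suc q) (\<lambda>x. F (\<phi> x) - F x)"
proof -
  let ?D = "\<lambda>x. frechet_derivative F (at x)"
  have "\<forall>i. \<exists>C. eventually (\<lambda>x. norm (?D x i) \<le> C) near_inf"
    using smooth_inf_bounded[OF smooth_inf_derivative[OF assms(3)]] by (auto simp: O_inf_def)
  then obtain C where C: "\<And>i. eventually (\<lambda>x. norm (?D x i) \<le> C i) near_inf" by metis
  have "eventually (\<lambda>x. (F has_derivative ?D x) (at x) \<and> (\<forall>i\<in>Basis. norm (?D x i) \<le> C i)) near_inf"
    using smooth_inf_has_derivative[OF assms(3)] C by (auto intro!: eventually_conj eventually_ball_finite)
  then obtain e where e: "e > 0" "\<And>x. 1 - e < norm x \<Longrightarrow> norm x < 1 \<Longrightarrow> (F has_derivative ?D x) (at x)"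
    "\<And>x i. 1 - e < norm x \<Longrightarrow> norm x < 1 \<Longrightarrow> i \<in> Basis \<Longrightarrow> norm (?D x i) \<le> C i"
    unfolding eventually_near_inf_collar by blast
  define K where "K = (\<Sum>i\<in>Basis. C i)"
  have on: "onorm (?D x) \<le> K" if "1 - e < norm x" "norm x < 1" for x
  proof (rule onorm_bound)
    show "0 \<le> K" unfolding K_def using e(3)[OF that] norm_ge_zero order_trans by (intro sum_nonneg) blast
    have lin: "linear (?D x)" using e(2)[OF that] has_derivative_linear by blast
    fix v
    have "?D x v = (\<Sum>i\<in>Basis. (v \<bullet> i) *\<^sub>R ?D x i)"
      using linear_sum[OF lin, of "\<lambda>i. (v \<bullet> i) *\<^sub>R i" Basis] linear_scale[OF lin]
      by (simp add: euclidean_representation)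
    also have "norm \<dots> \<le> (\<Sum>i\<in>Basis. norm ((v \<bullet> i) *\<^sub>R ?D x i))" by (rule norm_sum)
    also have "\<dots> \<le> (\<Sum>i\<in>Basis. norm v * C i)"
      using e(3)[OF that] by (intro sum_mono) (auto intro!: mult_mono simp: Basis_le_norm)
    finally show "norm (?D x v) \<le> K * norm v" by (simp add: K_def sum_distrib_left mult.commute)
  qed
  have w: "O_inf (Suc q) (\<lambda>x. \<phi> x - x)" using assms by (simp add: near_id_def)
  have "eventually (\<lambda>x. norm (\<phi> x - x) < e / 2) near_inf"
    by (rule O_inf_small[OF w]) (use e in auto)
  moreover have "eventually (\<lambda>x::real^'n. 1 - e / 2 < norm x \<and> norm x < 1) near_inf"
    by (rule eventually_norm_near_inf) (use e in simp)
  ultimately have "eventually (\<lambda>x. norm (F (\<phi> x) - F x) \<le> K * norm (\<phi> x - x)) near_inf"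
    using near_id_rho[OF assms(1,2)]
  proof eventually_elim
    case (elim x)
    have seg: "1 - e < norm y \<and> norm y < 1" if "y \<in> closed_segment x (\<phi> x)" for y
    proof
      have "norm (y - x) \<le> norm (\<phi> x - x)" using segment_bound[OF that] by simp
      moreover have "norm x - norm y \<le> norm (y - x)" using norm_triangle_ineq2[of x y] by (simp add: norm_minus_commute)
      ultimately show "1 - e < norm y" using elim by linarith
      have "closed_segment x (\<phi> x) \<subseteq> ball 0 1" using elim by (intro closed_segment_subset) auto
      thus "norm y < 1" using that by auto
    qed
    show ?case
    proof (rule differentiable_bound[where S = "closed_segment x (\<phi> x)" and f' = ?D])
      show "(F has_derivative ?D y) (at y within closed_segment x (\<phi> x))" if "y \<in> closed_segment x (\<phi> x)" for y
        using e(2) seg[OF that] has_derivative_at_withinI by blast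
      show "onorm (?D y) \<le> K" if "y \<in> closed_segment x (\<phi> x)" for y
        using on seg[OF that] by blast
    qed auto
  qed
  thus ?thesis by (rule O_inf_bound[OF w])
qed

lemma O_inf_power_diff:
  assumes "O_inf q (e :: real^'n \<Rightarrow> real)"
  shows "O_inf q (\<lambda>x. (1 - e x) ^ k - 1)"
proof (induction k)
  case 0
  then show ?case by (simp add: O_inf_zero)
next
  case (Suc k)
  have "O_inf (0 + q) (\<lambda>x. (1 - e x) * ((1 - e x) ^ k - 1))"
    by (intro O_inf_mult Suc O_inf_diff O_inf_const O_inf_mono[OF assms]) simp
  hence "O_inf q (\<lambda>x. (1 - e x) * ((1 - e x) ^ k - 1) - e x)" by (intro O_inf_diff assms) simp
  thus ?case by (simp add: algebra_simps)
qed

text \<open>With H = \<rho>^k F, the power of \<rho> changes by a relative error of order q and the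
  smooth factor \<open>F\<close> by O(\<rho>^(q+1)); the common factor \<rho>^k supplies the
  remaining orders.\<close>

lemma near_id_comp_diff:
  fixes H :: "real^'n \<Rightarrow> 'b::euclidean_space"
  assumes "near_id q \<phi>" "q > 0" "smooth_inf H" "O_inf k H"
  shows "O_inf (k + q) (\<lambda>x. H (\<phi> x) - H x)"
proof -
  obtain F where F: "smooth_inf F" "eventually (\<lambda>x. H x = \<rho> x ^ k *\<^sub>R F x) near_inf"
    using assms(3,4) by (rule smooth_inf_factor)
  have "O_inf (q + 0) (\<lambda>x. ((1 - rho_defect \<phi> x) ^ k - 1) *\<^sub>R F (\<phi> x))"
    by (intro O_inf_scaleR O_inf_power_diff O_inf_rho_defect assms smooth_inf_bounded
          near_id_smooth_inf[OF assms(1,2)] F)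
  moreover have "O_inf q (\<lambda>x. F (\<phi> x) - F x)"
    by (rule O_inf_mono[OF near_id_lipschitz[OF assms(1,2) F(1)]]) simp
  ultimately have "O_inf q (\<lambda>x. ((1 - rho_defect \<phi> x) ^ k - 1) *\<^sub>R F (\<phi> x) + (F (\<phi> x) - F x))"
    by (intro O_inf_add) auto
  hence "O_inf (k + q) (\<lambda>x. \<rho> x ^ k *\<^sub>R (((1 - rho_defect \<phi> x) ^ k - 1) *\<^sub>R F (\<phi> x) + (F (\<phi> x) - F x)))"
    by (simp only: O_inf_rho_power_cancel)
  moreover have "eventually (\<lambda>x. \<rho> x ^ k *\<^sub>R (((1 - rho_defect \<phi> x) ^ k - 1) *\<^sub>R F (\<phi> x) + (F (\<phi> x) - F x))
     = H (\<phi> x) - H x) near_inf"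
    using F(2) near_id_eventually[OF assms(1,2) F(2)] eventually_rho
  proof eventually_elim
    case (elim x)
    have "\<rho> (\<phi> x) ^ k = \<rho> x ^ k * (1 - rho_defect \<phi> x) ^ k"
      using rho_defect[of x \<phi>] elim by (simp add: power_mult_distrib)
    thus ?case unfolding elim(1,2) by (simp add: scaleR_diff_left scaleR_diff_right scaleR_add_right)
  qed
  ultimately show ?thesis by (rule O_inf_cong[rotated])
qed

lemma jac_near_id:
  assumes "near_id k \<phi>"
  shows "eventually (\<lambda>x. jac \<phi> x = mat 1 + jac (\<lambda>x. \<phi> x - x) x) near_inf"
proof -
  have "smooth_inf (\<lambda>x. \<phi> x - x)" using assms by (auto simp: near_id_def intro: smooth_inf_intros)
  from jac_add[OF smooth_inf_id this] show ?thesis by (simp add: jac_id)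
qed

lemma
  assumes "near_id q \<phi>" "q > 0"
  shows O_inf_rho_ratio: "O_inf (2 * q) (\<lambda>x. (\<rho> x / \<rho> (\<phi> x))\<^sup>2 - 1 - 2 * (inverse (\<rho> x) * (x \<bullet> (\<phi> x - x))))"
    and smooth_inf_rho_ratio: "smooth_inf (\<lambda>x. (\<rho> x / \<rho> (\<phi> x))\<^sup>2)"
proof -
  let ?e = "rho_defect \<phi>"
  define r where "r x = (inverse (1 - ?e x))\<^sup>2" for x
  have oe: "O_inf q ?e" by (rule O_inf_rho_defect[OF assms(1)])
  have "O_inf (Suc (q - 1)) (\<lambda>x. (1 - ?e x) - 1)" using O_inf_minus[OF oe] assms(2) by simp
  hence sr: "smooth_inf r" unfolding r_def[abs_def]
    by (intro smooth_inf_power smooth_inf_inverse) (intro smooth_inf_intros smooth_inf_rho_defect[OF assms(1)])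
  have r: "eventually (\<lambda>x. r x = (\<rho> x / \<rho> (\<phi> x))\<^sup>2) near_inf"
    using eventually_rho
  proof eventually_elim
    case (elim x)
    have "a / (a * b) = inverse b" if "a > 0" for a b :: real using that by (simp add: divide_inverse)
    hence "\<rho> x / \<rho> (\<phi> x) = inverse (1 - ?e x)" using rho_defect[of x \<phi>] elim by (simp only:)
    thus ?case by (simp only: r_def)
  qed
  show "smooth_inf (\<lambda>x. (\<rho> x / \<rho> (\<phi> x))\<^sup>2)" by (rule smooth_inf_cong[OF sr r])
  \<comment> \<open>With e the defect, (1 - e)^(-2) - 1 - 2 e = e^2 (3 - 2 e) (1 - e)^(-2) is the
    exact second-order remainder.\<close>
  have "O_inf ((q + q) + 0 + 0) (\<lambda>x. (?e x * ?e x) * (3 - 2 * ?e x) * r x)"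
    by (rule O_inf_mult[OF O_inf_mult[OF O_inf_mult[OF oe oe] smooth_inf_bounded] smooth_inf_bounded[OF sr]])
      (intro smooth_inf_intros smooth_inf_rho_defect[OF assms(1)])
  hence a: "O_inf (2 * q) (\<lambda>x. (?e x * ?e x) * (3 - 2 * ?e x) * r x)" by (simp only: add_0_right mult_2[of q])
  have "O_inf (0 + 2 * q) (\<lambda>x. 2 * (?e x - inverse (\<rho> x) * (x \<bullet> (\<phi> x - x))))"
    by (intro O_inf_mult O_inf_const O_inf_rho_defect_linear assms)
  hence "O_inf (2 * q) (\<lambda>x. (?e x * ?e x) * (3 - 2 * ?e x) * r x + 2 * (?e x - inverse (\<rho> x) * (x \<bullet> (\<phi> x - x))))"
    by (intro O_inf_add a) simp
  moreover have "eventually (\<lambda>x. (?e x * ?e x) * (3 - 2 * ?e x) * r x + 2 * (?e x - inverse (\<rho> x) * (x \<bullet> (\<phi> x - x)))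
     = (\<rho> x / \<rho> (\<phi> x))\<^sup>2 - 1 - 2 * (inverse (\<rho> x) * (x \<bullet> (\<phi> x - x)))) near_inf"
    using r O_inf_small[OF oe assms(2), of "1/2", simplified]
  proof eventually_elim
    case (elim x)
    have "1 - ?e x \<noteq> 0" using elim by auto
    hence "(1 - ?e x)\<^sup>2 * r x = 1" by (simp add: r_def power_mult_distrib[symmetric])
    moreover have "(?e x * ?e x) * (3 - 2 * ?e x) * r x = r x - (1 + 2 * ?e x) * ((1 - ?e x)\<^sup>2 * r x)"
      by (simp add: algebra_simps power2_eq_square)
    ultimately have "(?e x * ?e x) * (3 - 2 * ?e x) * r x = r x - 1 - 2 * ?e x" by simp
    thus ?case unfolding elim(1) by simp
  qed
  ultimately show "O_inf (2 * q) (\<lambda>x. (\<rho> x / \<rho> (\<phi> x))\<^sup>2 - 1 - 2 * (inverse (\<rho> x) * (x \<bullet> (\<phi> x - x))))"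
    by (rule O_inf_cong[rotated])
qed

text \<open>Pure algebra, arranged so that every summand on the right has a visible order: r is the
  squared ratio of the two values of \<rho>, s its first-order part, B the Jacobian of the
  displacement and H' the composed perturbation.\<close>

lemma pull_expansion:
  fixes B H H' :: "real^'n^'n"
  shows "r *\<^sub>R (transpose (mat 1 + B) ** (mat 1 + H') ** (mat 1 + B)) - mat 1 - H - (B + transpose B + s *\<^sub>R mat 1)
    = (r - 1 - s) *\<^sub>R mat 1 + (r - 1) *\<^sub>R (B + transpose B) + r *\<^sub>R (transpose B ** B)
      + (r - 1) *\<^sub>R (transpose (mat 1 + B) ** H' ** (mat 1 + B))
      + transpose B ** H' ** (mat 1 + B) + H' ** B + (H' - H)"
  by (simp add: transpose_add transpose_mat matrix_mult_simps algebra_simps)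

text \<open>Summands quadratic in the displacement are O(\<rho>^(2q)), which k \<le> q turns into
  O(\<rho>^(k+q)); summands containing both H and the displacement have that order outright.\<close>

lemma pull_linearization:
  fixes H :: "real^'n \<Rightarrow> real^'n^'n"
  assumes "near_id q \<phi>" "k > 0" "k \<le> q" "smooth_inf H" "O_inf k H"
  shows "O_inf (k + q) (\<lambda>x. pull \<phi> H x - H x - Lie (\<lambda>x. \<phi> x - x) x)"
proof -
  have q: "q > 0" using assms by simp
  define w where "w x = \<phi> x - x" for x
  define B where "B = jac w"
  define r where "r x = (\<rho> x / \<rho> (\<phi> x))\<^sup>2" for x
  define s where "s x = 2 * (inverse (\<rho> x) * (x \<bullet> w x))" for x
  have w: "smooth_inf w" "O_inf (Suc q) w"
    using assms(1) by (auto simp: near_id_def w_def[abs_def] intro: smooth_inf_intros)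
  have B: "O_inf q B" unfolding B_def by (rule O_inf_jac[OF w])
  have B0: "O_inf 0 B" using O_inf_mono[OF B] by simp
  have r1: "O_inf (2 * q) (\<lambda>x. r x - 1 - s x)"
    using O_inf_rho_ratio[OF assms(1) q] by (simp add: r_def s_def w_def)
  have "O_inf (0 + Suc q) (\<lambda>x. x \<bullet> w x)" by (intro O_inf_inner w smooth_inf_bounded smooth_inf_id)
  hence "O_inf q (\<lambda>x. inverse (\<rho> x) * (x \<bullet> w x))" by (intro O_inf_divide_rho) simp
  from O_inf_mult[OF O_inf_const[of 2] this] have s: "O_inf q s" by (simp add: s_def[abs_def])
  have "O_inf q (\<lambda>x. (r x - 1 - s x) + s x)" by (intro O_inf_add s O_inf_mono[OF r1]) simp
  hence r2: "O_inf q (\<lambda>x. r x - 1)" by simp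
  have "O_inf 0 (\<lambda>x. (r x - 1) + 1)" by (intro O_inf_add O_inf_const O_inf_mono[OF r2]) simp
  hence r3: "O_inf 0 r" by simp
  have H': "O_inf k (\<lambda>x. H (\<phi> x))" by (rule near_id_O_inf[OF assms(1) q assms(5)])
  have A: "O_inf 0 (\<lambda>x. mat 1 + B x)" by (intro O_inf_add O_inf_const B0)
  have "O_inf (2 * q + 0) (\<lambda>x. (r x - 1 - s x) *\<^sub>R mat 1 :: real^'n^'n)" by (intro O_inf_scaleR r1 O_inf_const)
  moreover have "O_inf (q + q) (\<lambda>x. (r x - 1) *\<^sub>R (B x + transpose (B x)))"
    by (intro O_inf_scaleR r2 O_inf_add B O_inf_transpose)
  moreover have "O_inf (0 + (q + q)) (\<lambda>x. r x *\<^sub>R (transpose (B x) ** B x))"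
    by (intro O_inf_scaleR r3 O_inf_matrix_mult B O_inf_transpose)
  moreover have "O_inf (q + ((0 + k) + 0)) (\<lambda>x. (r x - 1) *\<^sub>R (transpose (mat 1 + B x) ** H (\<phi> x) ** (mat 1 + B x)))"
    by (intro O_inf_scaleR r2 O_inf_matrix_mult A O_inf_transpose H')
  moreover have "O_inf ((q + k) + 0) (\<lambda>x. transpose (B x) ** H (\<phi> x) ** (mat 1 + B x))"
    by (intro O_inf_matrix_mult A O_inf_transpose H' B)
  moreover have "O_inf (k + q) (\<lambda>x. H (\<phi> x) ** B x)"
    by (intro O_inf_matrix_mult H' B)
  moreover have "O_inf (k + q) (\<lambda>x. H (\<phi> x) - H x)"
    by (rule near_id_comp_diff[OF assms(1) q assms(4,5)])
  ultimately have "O_inf (k + q) (\<lambda>x. (r x - 1 - s x) *\<^sub>R mat 1 + (r x - 1) *\<^sub>R (B x + transpose (B x)) + r x *\<^sub>R (transpose (B x) ** B x)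
      + (r x - 1) *\<^sub>R (transpose (mat 1 + B x) ** H (\<phi> x) ** (mat 1 + B x))
      + transpose (B x) ** H (\<phi> x) ** (mat 1 + B x) + H (\<phi> x) ** B x + (H (\<phi> x) - H x))"
    using assms(3) by (intro O_inf_add) (erule O_inf_mono, simp)+
  moreover have "eventually (\<lambda>x. (r x - 1 - s x) *\<^sub>R mat 1 + (r x - 1) *\<^sub>R (B x + transpose (B x)) + r x *\<^sub>R (transpose (B x) ** B x)
      + (r x - 1) *\<^sub>R (transpose (mat 1 + B x) ** H (\<phi> x) ** (mat 1 + B x))
      + transpose (B x) ** H (\<phi> x) ** (mat 1 + B x) + H (\<phi> x) ** B x + (H (\<phi> x) - H x)
      = pull \<phi> H x - H x - Lie w x) near_inf"
    using jac_near_id[OF assms(1)]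
  proof eventually_elim
    case (elim x)
    have j: "jac \<phi> x = mat 1 + B x" using elim by (simp add: B_def w_def[abs_def])
    show ?case unfolding pull_expansion[symmetric] pull_def Lie_def j r_def s_def B_def ..
  qed
  ultimately have "O_inf (k + q) (\<lambda>x. pull \<phi> H x - H x - Lie w x)" by (rule O_inf_cong[rotated])
  thus ?thesis by (simp add: w_def[abs_def])
qed

text \<open>The conditions on \<open>H\<close> under which \<open>\<rho>\<^sup>-\<^sup>2 (1 + H)\<close> represents a germ in \<open>G\<^sub>k\<close>, and those under
  which this germ is transverse.\<close>

definition perturb :: "nat \<Rightarrow> (real^'n \<Rightarrow> real^'n^'n) \<Rightarrow> bool" where
  "perturb k H \<longleftrightarrow> smooth_inf H \<and> eventually (\<lambda>x. transpose (H x) = H x) near_inf \<and> O_inf k H"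

definition radial_free :: "(real^'n \<Rightarrow> real^'n^'n) \<Rightarrow> bool" where
  "radial_free H \<longleftrightarrow> eventually (\<lambda>x. x v* H x = 0) near_inf"

lemma perturb_add: "perturb k H \<Longrightarrow> perturb k H' \<Longrightarrow> perturb k (\<lambda>x. H x + H' x)"
  unfolding perturb_def by (auto intro: smooth_inf_add O_inf_add elim: eventually_elim2 simp: transpose_add)

lemma perturb_scaleR: "perturb k H \<Longrightarrow> perturb k (\<lambda>x. c *\<^sub>R H x)"
  unfolding perturb_def
  by (auto intro: smooth_inf_linear[OF bounded_linear_scaleR_right] O_inf_linear[OF bounded_linear_scaleR_right]
      elim: eventually_mono simp: transpose_scaleR)

lemma perturb_diff: "perturb k H \<Longrightarrow> perturb k H' \<Longrightarrow> perturb k (\<lambda>x. H x - H' x)"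
  using perturb_add[of k H "\<lambda>x. (-1) *\<^sub>R H' x"] perturb_scaleR[of k H' "-1"] by simp

lemma perturb_zero: "perturb k (\<lambda>x. 0)"
  unfolding perturb_def by (auto intro: smooth_inf_const O_inf_zero simp: transpose_def vec_eq_iff)

lemma perturb_mono: "perturb k H \<Longrightarrow> k' \<le> k \<Longrightarrow> perturb k' H"
  unfolding perturb_def using O_inf_mono by auto

lemma radial_free_add: "radial_free H \<Longrightarrow> radial_free H' \<Longrightarrow> radial_free (\<lambda>x. H x + H' x)"
  unfolding radial_free_def by (auto elim: eventually_elim2 simp: vector_matrix_simps)

lemma radial_free_scaleR: "radial_free H \<Longrightarrow> radial_free (\<lambda>x. c *\<^sub>R H x)"
  unfolding radial_free_def by (auto elim: eventually_mono simp: vector_matrix_simps)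

lemma radial_free_diff: "radial_free H \<Longrightarrow> radial_free H' \<Longrightarrow> radial_free (\<lambda>x. H x - H' x)"
  unfolding radial_free_def by (auto elim: eventually_elim2 simp: vector_matrix_simps)

lemma radial_free_zero: "radial_free (\<lambda>x. 0)"
  unfolding radial_free_def by (simp add: vector_matrix_mult_def vec_eq_iff)

lemma pull_diff:
  "pull \<phi> H x - pull \<phi> H' x = (\<rho> x / \<rho> (\<phi> x))\<^sup>2 *\<^sub>R (transpose (jac \<phi> x) ** (H (\<phi> x) - H' (\<phi> x)) ** jac \<phi> x)"
  by (simp add: pull_def matrix_mult_simps algebra_simps)

lemma perturb_pull:
  assumes "near_id k \<phi>" "k > 0" "perturb k H"
  shows "perturb k (pull \<phi> H)"
proof -
  have H: "smooth_inf H" "eventually (\<lambda>x. transpose (H x) = H x) near_inf" "O_inf k H"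
    using assms(3) by (auto simp: perturb_def)
  have \<phi>: "smooth_inf \<phi>" "O_inf (Suc k) (\<lambda>x. \<phi> x - x)" using assms(1) by (auto simp: near_id_def)
  have "smooth_inf (pull \<phi> H)"
    unfolding pull_def[abs_def]
    by (intro smooth_inf_diff smooth_inf_scaleR smooth_inf_rho_ratio[OF assms(1,2)] smooth_inf_matrix_mult
        smooth_inf_transpose smooth_inf_jac \<phi> smooth_inf_add smooth_inf_const near_id_smooth_inf[OF assms(1,2) H(1)])
  moreover have "eventually (\<lambda>x. transpose (pull \<phi> H x) = pull \<phi> H x) near_inf"
    using near_id_eventually[OF assms(1,2) H(2)]
    by (rule eventually_mono)
      (simp add: pull_def transpose_diff transpose_scaleR matrix_transpose_mul transpose_mat transpose_add matrix_mul_assoc)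
  moreover have "O_inf k (pull \<phi> H)"
  proof -
    have "O_inf k (\<lambda>x. pull \<phi> H x - H x - Lie (\<lambda>x. \<phi> x - x) x)"
      by (rule O_inf_mono[OF pull_linearization[OF assms(1,2) _ H(1,3)]]) auto
    moreover have "O_inf k (Lie (\<lambda>x. \<phi> x - x))"
      by (intro O_inf_Lie smooth_inf_diff \<phi> smooth_inf_id)
    ultimately have "O_inf k (\<lambda>x. (pull \<phi> H x - H x - Lie (\<lambda>x. \<phi> x - x) x) + H x + Lie (\<lambda>x. \<phi> x - x) x)"
      by (intro O_inf_add H)
    thus ?thesis by simp
  qed
  ultimately show ?thesis by (simp add: perturb_def)
qed

lemma O_inf_pull_diff:
  assumes "near_id k \<phi>" "k > 0" "O_inf m (\<lambda>x. H x - H' x)"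
  shows "O_inf m (\<lambda>x. pull \<phi> H x - pull \<phi> H' x)"
proof -
  have j: "smooth_inf (jac \<phi>)" using assms(1) by (auto simp: near_id_def intro: smooth_inf_jac)
  have "O_inf (0 + ((0 + m) + 0)) (\<lambda>x. (\<rho> x / \<rho> (\<phi> x))\<^sup>2 *\<^sub>R (transpose (jac \<phi> x) ** (H (\<phi> x) - H' (\<phi> x)) ** jac \<phi> x))"
    by (intro O_inf_scaleR smooth_inf_bounded smooth_inf_rho_ratio[OF assms(1,2)] O_inf_matrix_mult O_inf_transpose j
        near_id_O_inf[OF assms])
  thus ?thesis by (simp add: pull_diff)
qed

lemma pull_compose:
  assumes "near_id k \<phi>" "near_id k \<psi>" "k > 0"
  shows "eventually (\<lambda>x. pull \<psi> (pull \<phi> H) x = pull (\<lambda>x. \<phi> (\<psi> x)) H x) near_inf"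
proof -
  have "smooth_inf \<phi>" "smooth_inf \<psi>" using assms by (auto simp: near_id_def)
  from has_derivative_jac[OF this(2)] near_id_eventually[OF assms(2,3) has_derivative_jac[OF this(1)]]
    near_id_eventually[OF assms(2,3) eventually_rho]
  show ?thesis
  proof eventually_elim
    case (elim x)
    define M where "M = transpose (jac \<phi> (\<psi> x)) ** (mat 1 + H (\<phi> (\<psi> x))) ** jac \<phi> (\<psi> x)"
    have "pull \<psi> (pull \<phi> H) x
       = (\<rho> x / \<rho> (\<psi> x))\<^sup>2 *\<^sub>R (transpose (jac \<psi> x) ** ((\<rho> (\<psi> x) / \<rho> (\<phi> (\<psi> x)))\<^sup>2 *\<^sub>R M) ** jac \<psi> x) - mat 1"
      by (simp add: pull_def M_def)
    also have "\<dots> = ((\<rho> x / \<rho> (\<psi> x))\<^sup>2 * (\<rho> (\<psi> x) / \<rho> (\<phi> (\<psi> x)))\<^sup>2) *\<^sub>R (transpose (jac \<psi> x) ** M ** jac \<psi> x) - mat 1"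
      by (simp add: matrix_mult_simps)
    also have "(\<rho> x / \<rho> (\<psi> x))\<^sup>2 * (\<rho> (\<psi> x) / \<rho> (\<phi> (\<psi> x)))\<^sup>2 = (\<rho> x / \<rho> (\<phi> (\<psi> x)))\<^sup>2"
      using elim by (simp add: power_mult_distrib[symmetric])
    also have "transpose (jac \<psi> x) ** M ** jac \<psi> x
        = transpose (jac \<phi> (\<psi> x) ** jac \<psi> x) ** (mat 1 + H (\<phi> (\<psi> x))) ** (jac \<phi> (\<psi> x) ** jac \<psi> x)"
      by (simp add: M_def matrix_transpose_mul matrix_mul_assoc)
    also have "jac \<phi> (\<psi> x) ** jac \<psi> x = jac (\<lambda>x. \<phi> (\<psi> x)) x"
      using jac_compose[of \<phi> \<psi> x] elim by simp
    finally show ?case by (simp add: pull_def)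
  qed
qed

lemma pull_identity:
  assumes "eventually (\<lambda>x. \<phi> x = x) near_inf"
  shows "eventually (\<lambda>x. pull \<phi> H x = H x) near_inf"
  using assms jac_cong[OF assms] eventually_rho
  by eventually_elim (simp add: pull_def jac_id transpose_mat)

lemma perturb_Lie:
  assumes "smooth_inf u" "O_inf (Suc k) u"
  shows "perturb k (Lie u)"
  unfolding perturb_def using assms
  by (auto intro: smooth_inf_Lie[OF assms(1) O_inf_mono[OF assms(2)]] O_inf_Lie simp: transpose_Lie)

text \<open>As k > 0, the nonlinear error O(\<rho>^(k+q)) is negligible at order q + 1. This leaves
  Lie w + (T2 - T1) for the displacement w; the difference of the two tensors is invisible to radial
  contraction, so w gains an order. When no order is left to gain, Lie w is itself
  negligible.\<close>

lemma transverse_gauge_uniqueness: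
  assumes "k > 0" "perturb k T1" "perturb k T2" "radial_free T1" "radial_free T2"
    and \<phi>: "near_id k \<phi>" and l: "O_inf (Suc l) (\<lambda>x. pull \<phi> T2 x - T1 x)"
  shows "near_id (max k (Suc l)) \<phi>" "O_inf (Suc l) (\<lambda>x. T1 x - T2 x)"
proof -
  define w where "w x = \<phi> x - x" for x
  have sw: "smooth_inf w" using \<phi> by (auto simp: near_id_def w_def[abs_def] intro: smooth_inf_intros)
  have T2: "smooth_inf T2" "O_inf k T2" using assms by (auto simp: perturb_def)
  have lin: "O_inf (k + q) (\<lambda>x. pull \<phi> T2 x - T2 x - Lie w x)" if "near_id q \<phi>" "k \<le> q" for q
    using pull_linearization[OF that(1) assms(1) that(2) T2] by (simp add: w_def[abs_def])
  \<comment> \<open>The maximum covers l < k, where the initial order k already suffices and the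
    induction is empty.\<close>
  have "near_id q \<phi>" if "k \<le> q" "q \<le> max k (Suc l)" for q
    using that
  proof (induction q rule: dec_induct)
    case base
    show ?case by fact
  next
    case (step q)
    hence q: "near_id q \<phi>" "q \<le> l" by auto
    have "O_inf (Suc q) (\<lambda>x. (pull \<phi> T2 x - T1 x) - (pull \<phi> T2 x - T2 x - Lie w x))"
      by (intro O_inf_diff O_inf_mono[OF l] O_inf_mono[OF lin[OF q(1)]]) (use step q assms(1) in auto)
    hence "O_inf (Suc q) (\<lambda>x. Lie w x + (T2 x - T1 x))" by (simp add: algebra_simps)
    moreover have "radial_free (\<lambda>x. T2 x - T1 x)" by (intro radial_free_diff assms)
    moreover have "O_inf (Suc q) w" using q(1) by (simp add: near_id_def w_def[abs_def])
    ultimately have "O_inf (Suc (Suc q)) w"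
      using step assms(1) by (intro gauge_field_vanishing[where T = "\<lambda>x. T2 x - T1 x"] sw) (auto simp: radial_free_def)
    thus ?case using q(1) by (simp add: near_id_def w_def[abs_def])
  qed
  thus q: "near_id (max k (Suc l)) \<phi>" by simp
  have "O_inf (Suc (max k (Suc l))) w" using q by (simp add: near_id_def w_def[abs_def])
  hence a: "O_inf (Suc l) (Lie w)" by (intro O_inf_mono[OF O_inf_Lie[OF sw]]) auto
  have b: "O_inf (Suc l) (\<lambda>x. pull \<phi> T2 x - T2 x - Lie w x)"
    by (intro O_inf_mono[OF lin[OF q]]) auto
  have "O_inf (Suc l) (\<lambda>x. (pull \<phi> T2 x - T2 x - Lie w x) + Lie w x - (pull \<phi> T2 x - T1 x))"
    by (rule O_inf_diff[OF O_inf_add[OF b a] l])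
  thus "O_inf (Suc l) (\<lambda>x. T1 x - T2 x)" by simp
qed

subsection \<open>Solving the linearized problem\<close>

text \<open>\<open>T\<close> is the linearized adjustment of \<open>H\<close>, modulo \<open>O(\<rho>\<^sup>m)\<close>.\<close>

definition lin_adjusted :: "nat \<Rightarrow> nat \<Rightarrow> (real^'n \<Rightarrow> real^'n^'n) \<Rightarrow> (real^'n \<Rightarrow> real^'n^'n) \<Rightarrow> bool" where
  "lin_adjusted k m H T \<longleftrightarrow> perturb k T \<and> radial_free T \<and>
     (\<exists>u. smooth_inf u \<and> O_inf (Suc k) u \<and> O_inf m (\<lambda>x. H x - T x - Lie u x))"

lemma lin_adjusted_add:
  assumes "lin_adjusted k m H T" "lin_adjusted k m H' T'"
  shows "lin_adjusted k m (\<lambda>x. H x + H' x) (\<lambda>x. T x + T' x)"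
proof -
  obtain u u' where u: "smooth_inf u" "O_inf (Suc k) u" "O_inf m (\<lambda>x. H x - T x - Lie u x)"
    "smooth_inf u'" "O_inf (Suc k) u'" "O_inf m (\<lambda>x. H' x - T' x - Lie u' x)"
    using assms unfolding lin_adjusted_def by blast
  have "O_inf m (\<lambda>x. (H x - T x - Lie u x) + (H' x - T' x - Lie u' x))" by (intro O_inf_add u)
  moreover have "eventually (\<lambda>x. (H x - T x - Lie u x) + (H' x - T' x - Lie u' x)
     = H x + H' x - (T x + T' x) - Lie (\<lambda>x. u x + u' x) x) near_inf"
    using Lie_add[OF u(1,4)] by eventually_elim simp
  ultimately have "O_inf m (\<lambda>x. H x + H' x - (T x + T' x) - Lie (\<lambda>x. u x + u' x) x)" by (rule O_inf_cong[rotated])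
  thus ?thesis unfolding lin_adjusted_def using assms u
    by (auto simp: lin_adjusted_def intro!: perturb_add radial_free_add exI[of _ "\<lambda>x. u x + u' x"] smooth_inf_add O_inf_add)
qed

lemma lin_adjusted_scaleR:
  assumes "lin_adjusted k m H T"
  shows "lin_adjusted k m (\<lambda>x. c *\<^sub>R H x) (\<lambda>x. c *\<^sub>R T x)"
proof -
  obtain u where u: "smooth_inf u" "O_inf (Suc k) u" "O_inf m (\<lambda>x. H x - T x - Lie u x)"
    using assms unfolding lin_adjusted_def by blast
  have "O_inf m (\<lambda>x. c *\<^sub>R (H x - T x - Lie u x))" by (intro O_inf_linear[OF bounded_linear_scaleR_right] u)
  moreover have "eventually (\<lambda>x. c *\<^sub>R (H x - T x - Lie u x)
     = c *\<^sub>R H x - c *\<^sub>R T x - Lie (\<lambda>x. c *\<^sub>R u x) x) near_inf"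
    using Lie_scaleR[OF u(1), of c] by eventually_elim (simp add: scaleR_diff_right)
  ultimately have "O_inf m (\<lambda>x. c *\<^sub>R H x - c *\<^sub>R T x - Lie (\<lambda>x. c *\<^sub>R u x) x)" by (rule O_inf_cong[rotated])
  thus ?thesis unfolding lin_adjusted_def using assms u
    by (auto simp: lin_adjusted_def intro!: perturb_scaleR radial_free_scaleR exI[of _ "\<lambda>x. c *\<^sub>R u x"]
        smooth_inf_linear[OF bounded_linear_scaleR_right] O_inf_linear[OF bounded_linear_scaleR_right])
qed

text \<open>The linear counterpart of gauge uniqueness, free of nonlinear error: u gains orders
  until Lie u is negligible, and then so is \<open>T\<close>. By linearity the linearized adjustment
  thereby descends to jets.\<close>

lemma lin_adjusted_zero_unique:
  assumes "k > 0" "lin_adjusted k (Suc l) H T" "O_inf (Suc l) H"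
  shows "O_inf (Suc l) T"
proof -
  obtain u where u: "smooth_inf u" "O_inf (Suc k) u" "O_inf (Suc l) (\<lambda>x. H x - T x - Lie u x)"
    using assms unfolding lin_adjusted_def by blast
  have "O_inf (Suc l) (\<lambda>x. H x - (H x - T x - Lie u x))" by (intro O_inf_diff u assms)
  hence s: "O_inf (Suc l) (\<lambda>x. Lie u x + T x)" by (simp add: algebra_simps)
  have "O_inf (Suc q) u" if "k \<le> q" "q \<le> max k (Suc l)" for q
    using that
  proof (induction q rule: dec_induct)
    case base
    show ?case by fact
  next
    case (step q)
    show ?case
      by (rule gauge_field_vanishing[OF u(1), where T = T])
        (use step assms in \<open>auto simp: lin_adjusted_def radial_free_def intro: O_inf_mono[OF s]\<close>)
  qed
  hence "O_inf (Suc l) (Lie u)" by (intro O_inf_mono[OF O_inf_Lie[OF u(1), of "max k (Suc l)"]]) auto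
  hence "O_inf (Suc l) (\<lambda>x. (Lie u x + T x) - Lie u x)" by (intro O_inf_diff s)
  thus ?thesis by simp
qed

lemma lin_adjusted_unique:
  assumes "k > 0" "lin_adjusted k (Suc l) H T" "lin_adjusted k (Suc l) H' T'" "O_inf (Suc l) (\<lambda>x. H x - H' x)"
  shows "O_inf (Suc l) (\<lambda>x. T x - T' x)"
  using lin_adjusted_zero_unique[OF assms(1), of l "\<lambda>x. H x + (-1) *\<^sub>R H' x" "\<lambda>x. T x + (-1) *\<^sub>R T' x"]
    lin_adjusted_add[OF assms(2) lin_adjusted_scaleR[OF assms(3), of "-1"]] assms(4)
  by simp

text \<open>The field \<open>V\<close> makes the leading coefficient transverse on the sphere; the projection
  \<open>(x \<bullet> x) - x \<otimes> x\<close> then makes it transverse near the sphere.\<close>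

lemma lin_adjusted_step:
  fixes R :: "real^'n \<Rightarrow> real^'n^'n"
  assumes "m > 0" "perturb m R"
  shows "\<exists>T. lin_adjusted m (Suc m) R T"
proof -
  have R: "smooth_inf R" "O_inf m R" "eventually (\<lambda>x. transpose (R x) = R x) near_inf"
    using assms by (auto simp: perturb_def)
  define F where "F x = inverse (\<rho> x ^ m) *\<^sub>R R x" for x
  have sF: "smooth_inf F" unfolding F_def[abs_def] by (rule smooth_inf_divide[OF R(1,2)])
  have RF: "eventually (\<lambda>x. R x = \<rho> x ^ m *\<^sub>R F x) near_inf"
    unfolding F_def using eventually_rho by eventually_elim auto
  have F: "eventually (\<lambda>x. transpose (F x) = F x) near_inf"
    unfolding F_def using R(3) by eventually_elim (simp add: transpose_scaleR)
  define f where "f x = x v* F x" for x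
  \<comment> \<open>On the unit sphere the contracted leading coefficient is to equal
    \<open>f\<close>. Contracting once more gives -2 m s = x . f for the normal component s, and
    then (m + 1) V = (1 - m) s x - f.\<close>
  define s where "s x = (- inverse (2 * real m)) * (x \<bullet> f x)" for x
  define V where "V x = inverse (real m + 1) *\<^sub>R ((1 - real m) *\<^sub>R (s x *\<^sub>R x) - f x)" for x
  have sf: "smooth_inf f" unfolding f_def[abs_def] by (intro smooth_inf_intros sF)
  have ss: "smooth_inf s" unfolding s_def[abs_def] by (intro smooth_inf_intros sf)
  have sV: "smooth_inf V" unfolding V_def[abs_def] by (intro smooth_inf_intros sf ss)
  have xx: "x \<bullet> x = 1 - 2 * \<rho> x" for x :: "real^'n"
    by (simp add: \<rho>_def power2_norm_eq_inner diff_divide_distrib)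
  have V: "(real m + 1) *\<^sub>R V x = (1 - real m) *\<^sub>R (s x *\<^sub>R x) - f x" for x
    by (simp add: V_def)
  \<comment> \<open>Off the sphere x . x = 1 - 2 \<rho>, so the normal component of \<open>V\<close>
    is s only up to c \<rho> s.\<close>
  define c where "c = 2 * (1 - real m) * inverse (real m + 1)"
  have xf: "x \<bullet> f x = - (2 * real m) * s x" for x
    using assms(1) by (simp add: s_def)
  have xV: "x \<bullet> V x = s x - c * \<rho> x * s x" for x
  proof -
    have "(real m + 1) * (x \<bullet> V x) = x \<bullet> ((real m + 1) *\<^sub>R V x)" by simp
    also have "\<dots> = (1 - real m) * s x * (1 - 2 * \<rho> x) + 2 * real m * s x"
      unfolding V by (simp add: inner_diff_right xx xf)
    also have "\<dots> = (real m + 1) * s x - 2 * (1 - real m) * \<rho> x * s x"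
      by (simp add: algebra_simps)
    finally have "(x \<bullet> V x) = inverse (real m + 1) * ((real m + 1) * s x - 2 * (1 - real m) * \<rho> x * s x)"
      by (simp add: field_simps)
    also have "\<dots> = s x - c * \<rho> x * s x" by (simp add: c_def right_diff_distrib mult_ac)
    finally show ?thesis .
  qed
  define F1 where "F1 x = F x - symb m x (V x)" for x
  \<comment> \<open>What the correction leaves in the radial direction, divided by \<rho>: all terms
    come from replacing x . x by 1 - 2 \<rho>.\<close>
  define Z where "Z x = 2 *\<^sub>R (f x - (1 - real m) *\<^sub>R (s x *\<^sub>R x)) - ((real m - 1) * c * s x) *\<^sub>R x" for x
  have sZ: "smooth_inf Z" unfolding Z_def[abs_def] by (intro smooth_inf_intros sf ss)
  have sF1: "smooth_inf F1"
    unfolding F1_def[abs_def] symb_def by (intro smooth_inf_intros sF sV)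
  have F1: "eventually (\<lambda>x. transpose (F1 x) = F1 x) near_inf"
    using F by eventually_elim (simp add: F1_def symb_def transpose_diff transpose_scaleR transpose_add transpose_outer transpose_mat add.commute)
  have xF1: "x v* F1 x = \<rho> x *\<^sub>R Z x" for x
  proof -
    have "x v* F1 x = f x - ((2 * (x \<bullet> V x)) *\<^sub>R x - ((real m + 1) * (x \<bullet> V x)) *\<^sub>R x - (x \<bullet> x) *\<^sub>R ((real m + 1) *\<^sub>R V x))"
      unfolding F1_def vector_matrix_simps vector_matrix_symb f_def by (simp add: algebra_simps)
    also have "\<dots> = \<rho> x *\<^sub>R Z x"
      unfolding V xV xx Z_def vec_eq_iff vector_minus_component vector_scaleR_component
      by (simp add: algebra_simps)
    finally show ?thesis .
  qed
  define \<Xi> where "\<Xi> x = (x \<bullet> x) *\<^sub>R mat 1 - outer x x" for x :: "real^'n"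
  define T where "T x = \<rho> x ^ m *\<^sub>R (\<Xi> x ** F1 x ** \<Xi> x)" for x
  have s\<Xi>: "smooth_inf \<Xi>" unfolding \<Xi>_def[abs_def] by (intro smooth_inf_intros)
  have sT: "smooth_inf T" unfolding T_def[abs_def] by (intro smooth_inf_intros s\<Xi> sF1)
  have "O_inf (m + 0) T" unfolding T_def[abs_def] O_inf_rho_power_cancel
    by (intro smooth_inf_bounded smooth_inf_intros s\<Xi> sF1)
  moreover have "eventually (\<lambda>x. transpose (T x) = T x) near_inf"
    using F1 by eventually_elim
      (simp add: T_def \<Xi>_def transpose_scaleR matrix_transpose_mul transpose_diff transpose_mat transpose_outer matrix_mul_assoc)
  ultimately have pT: "perturb m T" using sT by (simp add: perturb_def)
  have "x v* \<Xi> x = 0" for x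
    by (simp add: \<Xi>_def vector_matrix_simps vector_matrix_mat1 vector_matrix_outer)
  hence rT: "radial_free T"
    unfolding radial_free_def T_def
    by (simp add: vector_matrix_simps vector_matrix_mult_assoc bounded_bilinear.zero_left[OF bounded_bilinear_vector_matrix])
  \<comment> \<open>This is 1 - \<Xi>, rewritten with x . x = 1 - 2 \<rho>. In this form both parts
    of \<open>P x ** F1 x\<close> show a factor \<rho>: the outer product through the radial
    contraction of \<open>F1\<close>, the rest explicitly.\<close>
  define P where "P x = outer x x + (2 * \<rho> x) *\<^sub>R mat 1" for x :: "real^'n"
  have sP: "smooth_inf P" unfolding P_def[abs_def] by (intro smooth_inf_intros)
  define G where "G x = outer x (Z x) + 2 *\<^sub>R F1 x" for x
  have sG: "smooth_inf G" unfolding G_def[abs_def] by (intro smooth_inf_intros sZ sF1)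
  have PF1: "P x ** F1 x = \<rho> x *\<^sub>R G x" for x
    by (simp add: P_def G_def matrix_mult_simps outer_matrix_mult xF1 bounded_bilinear.scaleR_right[OF bounded_bilinear_outer] scaleR_add_right mult.commute)
  \<comment> \<open>Expanding (1 - P) F1 (1 - P) gives F1 - \<Xi> F1 \<Xi> = P F1 + F1 P - P F1 P.
    By symmetry the second term is the transpose of the first, so each is \<rho> times a smooth
    matrix and the projection costs only one order.\<close>
  have "O_inf (1 + 0) (\<lambda>x. \<rho> x ^ 1 *\<^sub>R (G x + transpose (G x) - G x ** P x))"
    unfolding O_inf_rho_power_cancel
    by (intro smooth_inf_bounded smooth_inf_intros sG sP)
  moreover have "eventually (\<lambda>x. \<rho> x ^ 1 *\<^sub>R (G x + transpose (G x) - G x ** P x) = F1 x - \<Xi> x ** F1 x ** \<Xi> x) near_inf"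
    using F1
  proof eventually_elim
    case (elim x)
    have "transpose (P x) = P x" by (simp add: P_def transpose_add transpose_scaleR transpose_mat transpose_outer)
    hence "F1 x ** P x = transpose (P x ** F1 x)" using elim by (simp add: matrix_transpose_mul)
    hence F1P: "F1 x ** P x = \<rho> x *\<^sub>R transpose (G x)" by (simp add: PF1 transpose_scaleR)
    have "\<Xi> x = mat 1 - P x" by (simp add: \<Xi>_def P_def xx scaleR_diff_left)
    moreover have "A - (mat 1 - Q) ** A ** (mat 1 - Q) = Q ** A + A ** Q - (Q ** A) ** Q" for A Q :: "real^'n^'n"
      by (simp add: matrix_mult_simps algebra_simps)
    ultimately have "F1 x - \<Xi> x ** F1 x ** \<Xi> x = P x ** F1 x + F1 x ** P x - (P x ** F1 x) ** P x"
      by (simp only:)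
    thus ?case unfolding PF1 F1P by (simp add: matrix_mult_simps algebra_simps)
  qed
  ultimately have "O_inf (1 + 0) (\<lambda>x. F1 x - \<Xi> x ** F1 x ** \<Xi> x)" by (rule O_inf_cong[rotated])
  hence F1\<Xi>: "O_inf 1 (\<lambda>x. F1 x - \<Xi> x ** F1 x ** \<Xi> x)" by simp
  define u where "u x = \<rho> x ^ Suc m *\<^sub>R V x" for x
  have su: "smooth_inf u" unfolding u_def[abs_def] by (intro smooth_inf_intros sV)
  have "O_inf (Suc m + 0) u" unfolding u_def[abs_def] O_inf_rho_power_cancel by (intro smooth_inf_bounded sV)
  moreover have "O_inf (Suc m) (\<lambda>x. R x - T x - Lie u x)"
  proof -
    have "O_inf (1 + 0) (\<lambda>x. \<rho> x ^ 1 *\<^sub>R (jac V x + transpose (jac V x)))"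
      unfolding O_inf_rho_power_cancel by (intro smooth_inf_bounded smooth_inf_add smooth_inf_transpose smooth_inf_jac sV)
    hence "O_inf 1 (\<lambda>x. (F1 x - \<Xi> x ** F1 x ** \<Xi> x) - \<rho> x ^ 1 *\<^sub>R (jac V x + transpose (jac V x)))"
      by (intro O_inf_diff F1\<Xi>) simp
    hence "O_inf (m + 1) (\<lambda>x. \<rho> x ^ m *\<^sub>R ((F1 x - \<Xi> x ** F1 x ** \<Xi> x) - \<rho> x ^ 1 *\<^sub>R (jac V x + transpose (jac V x))))"
      by (simp only: O_inf_rho_power_cancel)
    moreover have "eventually (\<lambda>x. \<rho> x ^ m *\<^sub>R ((F1 x - \<Xi> x ** F1 x ** \<Xi> x) - \<rho> x ^ 1 *\<^sub>R (jac V x + transpose (jac V x)))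
       = R x - T x - Lie u x) near_inf"
      using RF Lie_rho_power[OF sV, of m]
    proof eventually_elim
      case (elim x)
      have "Lie u x = \<rho> x ^ m *\<^sub>R (\<rho> x *\<^sub>R (jac V x + transpose (jac V x)) + symb m x (V x))"
        using elim(2) by (simp add: u_def[abs_def])
      thus ?case unfolding elim(1) F1_def T_def by (simp add: algebra_simps)
    qed
    ultimately have "O_inf (m + 1) (\<lambda>x. R x - T x - Lie u x)" by (rule O_inf_cong[rotated])
    thus ?thesis by simp
  qed
  ultimately show "\<exists>T. lin_adjusted m (Suc m) R T"
    unfolding lin_adjusted_def using pT rT su by auto
qed

text \<open>The residual H - T - Lie u is again symmetric and smooth, so the one-order step applies
  to it, and the new tensors and fields add to the old ones. Up to order k the choice T = 0, u = 0
  suffices because H itself is negligible there.\<close>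

lemma lin_adjusted_exists:
  fixes H :: "real^'n \<Rightarrow> real^'n^'n"
  assumes "k > 0" "perturb k H"
  shows "\<exists>T. lin_adjusted k m H T"
proof -
  have low: "\<exists>T. lin_adjusted k m H T" if "m \<le> k" for m
  proof -
    have "O_inf m (Lie (\<lambda>x. 0 :: real^'n))" by (intro O_inf_Lie smooth_inf_const O_inf_zero)
    moreover have "O_inf m H" using assms that O_inf_mono by (auto simp: perturb_def)
    ultimately have "O_inf m (\<lambda>x. H x - 0 - Lie (\<lambda>x. 0) x)" by (intro O_inf_diff) (auto intro: O_inf_zero)
    hence "lin_adjusted k m H (\<lambda>x. 0)"
      unfolding lin_adjusted_def using perturb_zero radial_free_zero smooth_inf_const O_inf_zero by blast
    thus ?thesis by blast
  qed
  have "\<exists>T. lin_adjusted k m H T" if "k \<le> m" for m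
    using that
  proof (induction m rule: dec_induct)
    case base
    show ?case by (rule low) simp
  next
    case (step m)
    then obtain T u where T: "perturb k T" "radial_free T" "smooth_inf u" "O_inf (Suc k) u" "O_inf m (\<lambda>x. H x - T x - Lie u x)"
      unfolding lin_adjusted_def by blast
    define R where "R x = H x - T x - Lie u x" for x
    have "perturb k R" unfolding R_def[abs_def] by (intro perturb_diff assms T perturb_Lie)
    hence "perturb m R" using T(5) by (simp add: perturb_def R_def[abs_def])
    then obtain T' u' where T': "perturb m T'" "radial_free T'" "smooth_inf u'" "O_inf (Suc m) u'" "O_inf (Suc m) (\<lambda>x. R x - T' x - Lie u' x)"
      using lin_adjusted_step[of m R] step(1) assms(1) unfolding lin_adjusted_def by auto
    have "O_inf (Suc m) (\<lambda>x. H x - (T x + T' x) - Lie (\<lambda>x. u x + u' x) x)"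
      by (rule O_inf_cong[OF _ T'(5)], rule eventually_mono[OF Lie_add[OF T(3) T'(3)]]) (simp add: R_def)
    moreover have "perturb k T'" "O_inf (Suc k) u'"
      using perturb_mono[OF T'(1)] O_inf_mono[OF T'(4)] step(1) by auto
    ultimately show ?case
      unfolding lin_adjusted_def using T T'
      by (auto intro!: exI[of _ "\<lambda>x. T x + T' x"] exI[of _ "\<lambda>x. u x + u' x"] perturb_add radial_free_add smooth_inf_add O_inf_add)
  qed
  thus ?thesis using low[of m] by (cases "m \<le> k") auto
qed

subsection \<open>Metric germs and push-forward\<close>

lemma germ_of_eq_iff: "germ_of f = germ_of g \<longleftrightarrow> eventually (\<lambda>x. f x = g x) near_inf"
  by (rule germ.abs_eq_iff)

text \<open>The factor \<rho>^(-2) cancels the \<rho>^2 between the b-norm and the Euclidean norm,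
  so the order of the germ with respect to b is the plain order of H.\<close>

definition tensor_of :: "(real^'n \<Rightarrow> real^'n^'n) \<Rightarrow> 'n::finite tensor_germ" where
  "tensor_of H = germ_of (\<lambda>x. inverse ((\<rho> x)\<^sup>2) *\<^sub>R H x)"

definition metric_of :: "(real^'n \<Rightarrow> real^'n^'n) \<Rightarrow> 'n::finite tensor_germ" where
  "metric_of H = germ_of (\<lambda>x. inverse ((\<rho> x)\<^sup>2) *\<^sub>R (mat 1 + H x))"

lemma metric_minus_hyp: "metric_of H - germ_of hyp_metric = tensor_of H"
  unfolding metric_of_def tensor_of_def minus_germ.abs_eq germ_of_eq_iff
  by (simp add: hyp_metric_def scaleR_add_right)

lemma tensor_add: "tensor_of (\<lambda>x. H x + H' x) = tensor_of H + tensor_of H'"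
  unfolding tensor_of_def plus_germ.abs_eq germ_of_eq_iff by (simp add: scaleR_add_right)

lemma tensor_diff: "tensor_of (\<lambda>x. H x - H' x) = tensor_of H - tensor_of H'"
  unfolding tensor_of_def minus_germ.abs_eq germ_of_eq_iff by (simp add: scaleR_diff_right)

lemma tensor_scaleR: "tensor_of (\<lambda>x. c *\<^sub>R H x) = c *\<^sub>R tensor_of H"
  unfolding tensor_of_def scaleR_germ.abs_eq germ_of_eq_iff by (simp add: mult.commute)

lemma metric_diff: "metric_of H - metric_of H' = tensor_of (\<lambda>x. H x - H' x)"
  using metric_minus_hyp[of H] metric_minus_hyp[of H'] by (simp add: tensor_diff algebra_simps)

lemma order_b_iff: "order_b m (germ_of h) \<longleftrightarrow> O_inf m (\<lambda>x. (\<rho> x)\<^sup>2 *\<^sub>R h x)"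
  unfolding order_b_germ O_inf_iff_bigo[symmetric] by simp

lemma order_b_tensor: "order_b m (tensor_of H) \<longleftrightarrow> O_inf m H"
proof -
  have ev: "eventually (\<lambda>x. (\<rho> x)\<^sup>2 *\<^sub>R (inverse ((\<rho> x)\<^sup>2) *\<^sub>R H x) = H x) near_inf"
    using eventually_rho by eventually_elim simp
  from ev have "eventually (\<lambda>x. H x = (\<rho> x)\<^sup>2 *\<^sub>R (inverse ((\<rho> x)\<^sup>2) *\<^sub>R H x)) near_inf"
    by (rule eventually_mono) (erule sym)
  from O_inf_cong[OF this] O_inf_cong[OF ev] show ?thesis
    unfolding tensor_of_def order_b_iff by (rule iffI[rotated])
qed

lemma transverse_metric: "transverse (metric_of H) \<longleftrightarrow> radial_free H"
  unfolding metric_of_def transverse.abs_eq radial_free_def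
proof (rule eventually_cong[OF eventually_rho])
  fix x :: "real^'a" assume "0 < \<rho> x \<and> \<rho> x \<le> 1 / 2 \<and> 1 / 2 < norm x \<and> norm x < 1"
  hence "inverse ((\<rho> x)\<^sup>2) \<noteq> 0" by simp
  moreover have "x v* (inverse ((\<rho> x)\<^sup>2) *\<^sub>R (mat 1 + H x)) - x v* hyp_metric x = inverse ((\<rho> x)\<^sup>2) *\<^sub>R (x v* H x)"
    unfolding hyp_metric_def by (simp add: vector_matrix_simps scaleR_add_right)
  ultimately show "x v* (inverse ((\<rho> x)\<^sup>2) *\<^sub>R (mat 1 + H x)) = x v* hyp_metric x \<longleftrightarrow> x v* H x = 0"
    by (metis eq_iff_diff_eq_0 scaleR_eq_0_iff)
qed

lemma nbhd_inf_eventually: "nbhd_inf U \<Longrightarrow> eventually (\<lambda>x. x \<in> U) near_inf"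
  unfolding eventually_near_inf by blast

lemma metric_germsD:
  assumes "g \<in> metric_germs k"
  obtains H where "perturb k H" "g = metric_of H"
proof -
  obtain g' U h where g: "g = germ_of g'" "nbhd_inf U" "riemannian_metric_on U g'"
    "riemannian_metric_on (with_sphere U) h" "\<forall>x\<in>U. h x = (\<rho> x)\<^sup>2 *\<^sub>R g' x"
    "order_b k (germ_of g' - germ_of hyp_metric)"
    using assms unfolding metric_germs_def by blast
  define H where "H x = (\<rho> x)\<^sup>2 *\<^sub>R g' x - mat 1" for x
  have U: "eventually (\<lambda>x. x \<in> U) near_inf" by (rule nbhd_inf_eventually[OF g(2)])
  have "smooth_inf h" by (rule smooth_inf_of_smooth_on[OF g(2)]) (use g(4) in \<open>simp add: riemannian_metric_on_def\<close>)
  hence "smooth_inf (\<lambda>x. h x - mat 1)" by (intro smooth_inf_diff smooth_inf_const)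
  hence "smooth_inf H"
    by (rule smooth_inf_cong) (use U in \<open>rule eventually_mono\<close>, use g(5) in \<open>auto simp: H_def\<close>)
  moreover have "eventually (\<lambda>x. transpose (H x) = H x) near_inf"
    using U by eventually_elim (use g(3) in \<open>auto simp: H_def riemannian_metric_on_def transpose_diff transpose_scaleR transpose_mat\<close>)
  moreover have gH: "g = metric_of H"
    unfolding g(1) metric_of_def germ_of_eq_iff using eventually_rho by eventually_elim (simp add: H_def)
  moreover have "O_inf k H"
    using g(6) unfolding g(1)[symmetric] gH metric_minus_hyp order_b_tensor .
  ultimately show ?thesis using that[of H] by (simp add: perturb_def)
qed

lemma smooth_onE:
  assumes "smooth_on S f" "x \<in> S"
  obtains W F where "open W" "x \<in> W" "\<And>k. Ck_on k W F" "\<And>y. y \<in> W \<Longrightarrow> y \<in> S \<Longrightarrow> F y = f y"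
proof -
  obtain W F where *: "open W \<and> x \<in> W \<and> (\<forall>k. Ck_on k W F) \<and> (\<forall>y\<in>W \<inter> S. F y = f y)"
    using bspec[OF assms(1)[unfolded smooth_on_def] assms(2)] by (elim exE)
  show ?thesis by (rule that[of W F]) (simp_all add: *)
qed

lemma smooth_on_subset:
  assumes "smooth_on S f" "T \<subseteq> S"
  shows "smooth_on T f"
  unfolding smooth_on_def
proof
  fix x assume "x \<in> T"
  hence "x \<in> S" using assms(2) by blast
  with assms(1) obtain W F where W: "open W" "x \<in> W" "\<And>k. Ck_on k W F" "\<And>y. y \<in> W \<Longrightarrow> y \<in> S \<Longrightarrow> F y = f y"
    by (rule smooth_onE) blast
  show "\<exists>W F. open W \<and> x \<in> W \<and> (\<forall>k. Ck_on k W F) \<and> (\<forall>y\<in>W \<inter> T. F y = f y)"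
    by (rule exI[of _ W], rule exI[of _ F]) (use W assms(2) in auto)
qed

lemma Ck_on_rho:
  assumes "open S"
  shows "Ck_on k S (\<rho> :: real^'n \<Rightarrow> real)"
proof -
  have "Ck_on k S (\<lambda>x::real^'n. (1 / 2) * (1 + - (x \<bullet> x)))"
    by (intro Ck_on_bilinear[OF assms bounded_bilinear_mult] Ck_on_const assms Ck_on_add
        Ck_on_linear_comp[OF assms bounded_linear_minus[OF bounded_linear_ident]]
        Ck_on_bilinear[OF assms bounded_bilinear_inner] Ck_on_id)
  thus ?thesis by (simp add: \<rho>_def[abs_def] power2_norm_eq_inner)
qed

text \<open>What \<open>perturb\<close> does not contain is positive definiteness up to the sphere.
  Since k > 0, H tends to 0 there: the extended tensor 1 + H is the identity on the sphere and
  positive definite on a collar where H is small against the constant of matrix-vector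
  multiplication.\<close>

lemma metric_germsI:
  fixes H :: "real^'n \<Rightarrow> real^'n^'n"
  assumes "perturb k H" "k > 0"
  shows "metric_of H \<in> metric_germs k"
proof -
  have H: "smooth_inf H" "O_inf k H" "eventually (\<lambda>x. transpose (H x) = H x) near_inf"
    using assms by (auto simp: perturb_def)
  have bb: "bounded_bilinear ((*v) :: real^'n^'n \<Rightarrow> real^'n \<Rightarrow> real^'n)"
    unfolding bilinear_conv_bounded_bilinear[symmetric] bilinear_def
    by (auto intro!: linearI simp: matrix_vector_mult_def vec_eq_iff algebra_simps sum.distrib sum_distrib_left)
  obtain K where K: "K > 0" "\<And>(A :: real^'n^'n) (v :: real^'n). norm (A *v v) \<le> norm A * norm v * K"
    using bounded_bilinear.pos_bounded[OF bb] by blast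
  have pos: "v \<bullet> ((mat 1 + A) *v v) > 0" if "norm A < 1 / K" "v \<noteq> 0" for A :: "real^'n^'n" and v
  proof -
    have "\<bar>v \<bullet> (A *v v)\<bar> \<le> norm v * (norm A * norm v * K)"
      using Cauchy_Schwarz_ineq2[of v "A *v v"] K(2)[of A v] by (meson mult_left_mono norm_ge_zero order_trans)
    also have "\<dots> = (norm A * K) * (norm v)\<^sup>2" by (simp add: power2_eq_square)
    also have "\<dots> < 1 * (norm v)\<^sup>2" using that K(1) by (intro mult_strict_right_mono) (auto simp: field_simps)
    finally show ?thesis by (simp add: matrix_vector_mult_add_rdistrib inner_add_right power2_norm_eq_inner)
  qed
  have "smooth_inf (\<lambda>x. mat 1 + H x)" by (intro smooth_inf_add smooth_inf_const H)
  then obtain e h where h: "e > 0" "smooth_on (with_sphere (ball 0 1 - cball 0 (1 - e))) h"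
    "\<And>x. norm x < 1 \<Longrightarrow> h x = mat 1 + H x"
    "\<And>p. norm p = 1 \<Longrightarrow> ((\<lambda>x. mat 1 + H x) \<longlongrightarrow> h p) (at p within ball 0 1)"
    by (rule smooth_inf_extend) blast
  have hp: "h p = mat 1" if p: "norm p = 1" for p
  proof -
    have "((\<lambda>x. mat 1 + H x) \<longlongrightarrow> mat 1 + 0) (at p within ball 0 1)"
      by (intro tendsto_add tendsto_const tendsto_near_sphere[OF _ p, of "k - 1"]) (use H assms in simp)
    from tendsto_unique[OF at_within_ball_nontrivial[OF p] h(4)[OF p] this] show ?thesis by simp
  qed
  have "eventually (\<lambda>x. norm (H x) < 1 / K \<and> transpose (H x) = H x) near_inf"
    using O_inf_small[OF H(2) assms(2), of "1 / K"] H(3) K(1) by (auto intro: eventually_conj)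
  then obtain e' where e': "e' > 0" "\<And>x. 1 - e' < norm x \<Longrightarrow> norm x < 1 \<Longrightarrow> norm (H x) < 1 / K \<and> transpose (H x) = H x"
    unfolding eventually_near_inf_collar by blast
  define U :: "(real^'n) set" where "U = ball 0 1 - cball 0 (1 - min e e')"
  define g where "g x = inverse ((\<rho> x)\<^sup>2) *\<^sub>R (mat 1 + H x)" for x
  have U: "nbhd_inf U" unfolding nbhd_inf_def U_def using h(1) e'(1)
    by (auto intro!: exI[of _ "min e e'"])
  have rU: "\<rho> x > 0" if "x \<in> U" for x using that rho_pos[of x] by (auto simp: U_def)
  have U': "with_sphere U \<subseteq> with_sphere (ball 0 1 - cball 0 (1 - e))" by (auto simp: U_def with_sphere_def)
  have hU: "transpose (h x) = h x \<and> (\<forall>v. v \<noteq> 0 \<longrightarrow> v \<bullet> (h x *v v) > 0)" if "x \<in> with_sphere U" for x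
  proof (cases "norm x = 1")
    case True
    then show ?thesis using hp by (simp add: transpose_mat)
  next
    case False
    hence "1 - e' < norm x" "norm x < 1" using that by (auto simp: with_sphere_def U_def)
    then show ?thesis using h(3)[of x] e'(2)[of x] pos[of "H x"] by (simp add: transpose_add transpose_mat)
  qed
  have sh: "smooth_on (with_sphere U) h" by (rule smooth_on_subset[OF h(2) U'])
  have hg: "h x = (\<rho> x)\<^sup>2 *\<^sub>R g x" if "x \<in> U" for x
    using h(3)[of x] that rU[OF that] by (auto simp: U_def g_def)
  have sg: "smooth_on U g"
    unfolding smooth_on_def
  proof
    fix x assume x: "x \<in> U"
    hence "x \<in> with_sphere U" by (simp add: with_sphere_def)
    with sh obtain W F where W: "open W" "x \<in> W" "\<And>k. Ck_on k W F" "\<And>y. y \<in> W \<Longrightarrow> y \<in> with_sphere U \<Longrightarrow> F y = h y"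
      by (rule smooth_onE) blast
    have o: "open (W \<inter> U)" using W U by (auto simp: nbhd_inf_def)
    have "Ck_on k (W \<inter> U) (\<lambda>y. inverse (\<rho> y * \<rho> y) *\<^sub>R F y)" for k
      by (intro Ck_on_bilinear[OF o bounded_bilinear_scaleR] Ck_on_inverse[OF o] Ck_on_bilinear[OF o bounded_bilinear_mult]
          Ck_on_rho[OF o] Ck_on_subset[OF W(3)]) (use rU in force)+
    moreover have "\<forall>y\<in>(W \<inter> U) \<inter> U. inverse (\<rho> y * \<rho> y) *\<^sub>R F y = g y"
    proof
      fix y assume y: "y \<in> (W \<inter> U) \<inter> U"
      hence Fy: "F y = (\<rho> y * \<rho> y) *\<^sub>R g y" using W(4)[of y] hg[of y] by (simp add: with_sphere_def power2_eq_square)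
      have "inverse (\<rho> y * \<rho> y) * (\<rho> y * \<rho> y) = 1" using rU[of y] y by (intro left_inverse) simp
      thus "inverse (\<rho> y * \<rho> y) *\<^sub>R F y = g y" by (simp only: Fy scaleR_scaleR scaleR_one)
    qed
    ultimately show "\<exists>W F. open W \<and> x \<in> W \<and> (\<forall>k. Ck_on k W F) \<and> (\<forall>y\<in>W \<inter> U. F y = g y)"
      using o W x by blast
  qed
  have gU: "transpose (g x) = g x \<and> (\<forall>v. v \<noteq> 0 \<longrightarrow> v \<bullet> (g x *v v) > 0)" if x: "x \<in> U" for x
  proof -
    have "g x = inverse ((\<rho> x)\<^sup>2) *\<^sub>R h x" using hg[OF x] rU[OF x] by simp
    moreover have "inverse ((\<rho> x)\<^sup>2) > 0" using rU[OF x] by simp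
    moreover have "x \<in> with_sphere U" using x by (simp add: with_sphere_def)
    ultimately show ?thesis using hU[of x]
      by (simp add: transpose_scaleR scaleR_matrix_vector_assoc[symmetric])
  qed
  have "order_b k (germ_of g - germ_of hyp_metric)"
    using metric_minus_hyp[of H] H(2) by (simp add: metric_of_def g_def[abs_def] order_b_tensor)
  hence "germ_of g \<in> metric_germs k"
    unfolding metric_germs_def riemannian_metric_on_def using U sg gU sh hU hg by blast
  thus ?thesis by (simp add: metric_of_def g_def[abs_def])
qed

section \<open>Inverting maps close to the identity and pushing metrics forward\<close>

lemma smooth_on_at_sphere:
  fixes h :: "real^'n \<Rightarrow> 'b::real_normed_vector"
  assumes "smooth_on S h" "norm p = 1" "p \<in> S" "eventually (\<lambda>x. x \<in> S) near_inf"
  obtains W F where "open W" "p \<in> W" "Cinf W F" "\<And>x. x \<in> W \<Longrightarrow> norm x < 1 \<Longrightarrow> F x = h x" "F p = h p"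
proof -
  obtain W F where W: "open W" "p \<in> W" "\<And>k. Ck_on k W F" "\<And>y. y \<in> W \<Longrightarrow> y \<in> S \<Longrightarrow> F y = h y"
    using assms(1,3) by (rule smooth_onE) blast
  obtain V where V: "open V" "p \<in> V" "\<And>x. x \<in> V \<Longrightarrow> norm x < 1 \<Longrightarrow> x \<in> S"
    using assms(4,2) by (rule eventually_near_infD) blast
  show ?thesis
    by (rule that[of "W \<inter> V" F]) (use W V assms(3) in \<open>auto simp: Cinf_def intro: Ck_on_subset\<close>)
qed

text \<open>Brouwer's theorem on the ball of radius \<open>\<rho> y / 2\<close> around \<open>y\<close>, for the map
  \<open>x \<mapsto> x - \<phi> x + y\<close>.\<close>

lemma near_id_surj:
  fixes \<phi> :: "real^'n \<Rightarrow> real^'n"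
  assumes "O_inf (Suc k) (\<lambda>x. \<phi> x - x)" "k > 0" "open U" "continuous_on U \<phi>" "eventually (\<lambda>x. x \<in> U) near_inf"
  shows "eventually (\<lambda>y. \<exists>x\<in>U. \<phi> x = y \<and> norm (x - y) \<le> \<rho> y / 2) near_inf"
proof -
  \<comment> \<open>Order 2, available since k > 0, makes the displacement small compared with the
    radius of the ball, which is itself proportional to \<rho>.\<close>
  obtain C where C: "C \<ge> 0" "eventually (\<lambda>x. norm (\<phi> x - x) \<le> C * \<rho> x ^ 2) near_inf"
    using O_inf_mono[OF assms(1), of 2] assms(2) by (auto elim: O_infE)
  from eventually_conj[OF this(2) assms(5)] obtain e where e: "e > 0"
    "\<And>x. 1 - e < norm x \<Longrightarrow> norm x < 1 \<Longrightarrow> norm (\<phi> x - x) \<le> C * \<rho> x ^ 2 \<and> x \<in> U"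
    unfolding eventually_near_inf_collar by blast
  \<comment> \<open>On the ball \<rho> is at most 3/2 of its value at the center y, and this
    threshold makes (C + 1) (3/2 \<rho> y)^2 at most \<rho> y / 2.\<close>
  have "eventually (\<lambda>x::real^'n. \<rho> x < 2 / (9 * (C + 1))) near_inf"
    using C(1) by (intro eventually_rho_less) simp
  moreover have "eventually (\<lambda>x::real^'n. \<rho> x < e / 2) near_inf"
    using e(1) by (intro eventually_rho_less) simp
  moreover have "eventually (\<lambda>x::real^'n. 1 - e / 2 < norm x \<and> norm x < 1) near_inf"
    by (rule eventually_norm_near_inf) (use e in simp)
  ultimately show ?thesis using eventually_rho
  proof eventually_elim
    case (elim y)
    define B where "B = cball y (\<rho> y / 2)"
    have B: "1 - e < norm x \<and> norm x < 1 \<and> \<rho> x \<le> 3 / 2 * \<rho> y \<and> 0 < \<rho> x" if "x \<in> B" for x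
    proof -
      have d: "norm (x - y) \<le> \<rho> y / 2" using that by (simp add: B_def dist_norm norm_minus_commute)
      moreover have "norm x \<le> norm y + norm (x - y)" "norm y - norm x \<le> norm (x - y)"
        using norm_triangle_sub[of x y] norm_triangle_ineq2[of y x] by (auto simp: norm_minus_commute)
      ultimately have x: "1 - e < norm x" "norm x < 1" using elim rho_le[of y] by linarith+
      have "\<bar>\<rho> x - \<rho> y\<bar> \<le> norm (x - y)" using x elim by (intro rho_lipschitz) auto
      thus ?thesis using x d rho_pos[OF x(2)] by auto
    qed
    have BU: "B \<subseteq> U" using B e by blast
    obtain x where x: "x \<in> B" "x - \<phi> x + y = x"
    proof (rule brouwer_ball[of "\<rho> y / 2" y "\<lambda>x. x - \<phi> x + y"])
      show "0 < \<rho> y / 2" using elim by simp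
      show "continuous_on (cball y (\<rho> y / 2)) (\<lambda>x. x - \<phi> x + y)"
        using continuous_on_subset[OF assms(4) BU] unfolding B_def by (intro continuous_intros)
      show "(\<lambda>x. x - \<phi> x + y) \<in> cball y (\<rho> y / 2) \<rightarrow> cball y (\<rho> y / 2)"
      proof
        fix x assume "x \<in> cball y (\<rho> y / 2)"
        hence x: "x \<in> B" by (simp add: B_def)
        have "norm (x - \<phi> x) \<le> C * \<rho> x ^ 2" using e(2) B[OF x] by (auto simp: norm_minus_commute)
        also have "\<dots> \<le> (C + 1) * (3 / 2 * \<rho> y) ^ 2" using B[OF x] C(1) by (intro mult_mono power_mono) auto
        also have "\<dots> = \<rho> y / 2 * (\<rho> y * (9 * (C + 1)) / 2)" by (simp add: power2_eq_square)
        also have "\<dots> \<le> \<rho> y / 2 * 1" using elim C(1) by (intro mult_left_mono) (auto simp: field_simps)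
        finally show "x - \<phi> x + y \<in> cball y (\<rho> y / 2)" by (simp add: dist_norm norm_minus_commute)
      qed
    qed (auto simp: B_def)
    have "norm (x - y) \<le> \<rho> y / 2" using x(1) by (simp add: B_def dist_norm norm_minus_commute)
    thus ?case using x BU by (intro bexI[of _ x]) (auto simp: algebra_simps)
  qed
qed

lemma matrix_inv_eqI:
  fixes A B :: "real^'n^'n"
  assumes "A ** B = mat 1"
  shows "matrix_inv A = B"
proof -
  have BA: "B ** A = mat 1" using assms by (simp add: matrix_left_right_inverse)
  hence "\<exists>A'. A ** A' = mat 1 \<and> A' ** A = mat 1" using assms by blast
  hence "matrix_inv A ** A = mat 1" unfolding matrix_inv_def by (rule someI2_ex) blast
  hence "matrix_inv A ** A ** B = B" by (simp add: matrix_mul_lid)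
  thus ?thesis by (simp add: matrix_mul_assoc[symmetric] assms matrix_mul_rid)
qed

text \<open>Push-forward becomes pull-back by the inverse \<open>\<psi>\<close>. The substance is
  that \<open>\<psi>\<close> is again close to the identity: its domain must contain a collar, and
  its smoothness must reach the sphere.\<close>

lemma push_metric:
  fixes H :: "real^'n \<Rightarrow> real^'n^'n"
  assumes "\<Theta> \<in> I0 (k + 1)" "k > 0"
  obtains \<phi> \<psi> where "near_id k \<phi>" "near_id k \<psi>" "eventually (\<lambda>x. \<psi> (\<phi> x) = x) near_inf"
    "push \<Theta> (metric_of H) = metric_of (pull \<psi> H)"
proof -
  obtain \<phi>0 U0 where \<phi>0: "\<Theta> = germ_of \<phi>0" "nbhd_inf U0" "diffeo_onto_image (with_sphere U0) \<phi>0"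
    "(\<lambda>x. norm (\<phi>0 x - x)) \<in> O[near_inf](\<lambda>x. \<rho> x ^ (k + 1))"
    using assms(1) unfolding I0_def by blast
  let ?P = "\<lambda>h. \<exists>U \<phi> f. nbhd_inf U \<and> diffeo_onto_image (with_sphere U) \<phi> \<and>
     germ_of \<phi> = \<Theta> \<and> germ_of f = metric_of H \<and> h = germ_of (push_field U \<phi> f)"
  \<comment> \<open>This instance only shows that \<open>push\<close> chooses from a nonempty set;
    the rest works with whichever domain and representatives the choice returns.\<close>
  have "?P (germ_of (push_field U0 \<phi>0 (\<lambda>x. inverse ((\<rho> x)\<^sup>2) *\<^sub>R (mat 1 + H x))))"
    by (intro exI[of _ U0] exI[of _ \<phi>0] exI[of _ "\<lambda>x. inverse ((\<rho> x)\<^sup>2) *\<^sub>R (mat 1 + H x)"])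
      (simp add: \<phi>0 metric_of_def)
  hence "\<exists>h. ?P h" by (rule exI[of ?P])
  hence "?P (push \<Theta> (metric_of H))" unfolding push_def by (rule someI_ex)
  then obtain U \<phi> f where \<phi>: "nbhd_inf U" "diffeo_onto_image (with_sphere U) \<phi>" "germ_of \<phi> = \<Theta>"
    "germ_of f = metric_of H" "push \<Theta> (metric_of H) = germ_of (push_field U \<phi> f)" by blast
  then obtain \<psi> where s\<phi>: "smooth_on (with_sphere U) \<phi>" and \<psi>: "smooth_on (\<phi> ` with_sphere U) \<psi>"
    "\<And>x. x \<in> with_sphere U \<Longrightarrow> \<psi> (\<phi> x) = x" unfolding diffeo_onto_image_def by blast
  have U: "open U" "U \<subseteq> with_sphere U" "eventually (\<lambda>x. x \<in> U) near_inf"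
    using \<phi>(1) nbhd_inf_eventually[OF \<phi>(1)] by (auto simp: nbhd_inf_def with_sphere_def)
  have "eventually (\<lambda>x. \<phi>0 x = \<phi> x) near_inf" using \<phi>(3) \<phi>0(1) germ_of_eq_iff by metis
  hence "eventually (\<lambda>x. \<phi>0 x - x = \<phi> x - x) near_inf" by (rule eventually_mono) simp
  moreover have "O_inf (Suc k) (\<lambda>x. \<phi>0 x - x)" using \<phi>0(4) unfolding O_inf_iff_bigo by simp
  ultimately have w: "O_inf (Suc k) (\<lambda>x. \<phi> x - x)" by (rule O_inf_cong)
  have near\<phi>: "near_id k \<phi>"
    using w smooth_inf_of_smooth_on[OF \<phi>(1) s\<phi>] by (simp add: near_id_def)
  have surj: "eventually (\<lambda>y. \<exists>x\<in>U. \<phi> x = y \<and> norm (x - y) \<le> \<rho> y / 2) near_inf"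
    by (rule near_id_surj[OF w assms(2) U(1) _ U(3)])
      (rule continuous_on_subset[OF smooth_on_continuous_on[OF s\<phi>] U(2)])
  have \<psi>U: "eventually (\<lambda>y. \<psi> y \<in> U \<and> \<phi> (\<psi> y) = y \<and> norm (\<psi> y - y) \<le> \<rho> y / 2) near_inf"
    using surj by (rule eventually_mono) (use \<psi>(2) U(2) in auto)
  \<comment> \<open>The map \<open>\<phi>\<close> fixes each sphere point p by continuity, so p
    belongs to the image on which \<open>\<psi>\<close> is smooth.\<close>
  have "smooth_inf \<psi>"
  proof (rule smooth_infI)
    fix p :: "real^'n" assume p: "norm p = 1"
    have "p \<in> with_sphere U" "eventually (\<lambda>x. x \<in> with_sphere U) near_inf"
      using p U by (auto simp: with_sphere_def elim: eventually_mono)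
    with s\<phi> p obtain W F where W: "open W" "p \<in> W" "Cinf W F" "\<And>x. x \<in> W \<Longrightarrow> norm x < 1 \<Longrightarrow> F x = \<phi> x" "F p = \<phi> p"
      by (rule smooth_on_at_sphere) blast
    have "((\<lambda>x. (\<phi> x - x) + x) \<longlongrightarrow> 0 + p) (at p within ball 0 1)"
      by (intro tendsto_add tendsto_near_sphere[OF w p] tendsto_ident_at)
    hence "F p = p" by (intro local_extension_eq_limit[OF W(1,2) p W(3,4)]) auto
    hence "p \<in> \<phi> ` with_sphere U" using W(5) p by (intro image_eqI[of _ _ p]) (auto simp: with_sphere_def)
    moreover have "eventually (\<lambda>y. y \<in> \<phi> ` with_sphere U) near_inf"
      using surj by (rule eventually_mono) (use U in blast)
    ultimately obtain W F where "open W" "p \<in> W" "Cinf W F" "\<And>x. x \<in> W \<Longrightarrow> norm x < 1 \<Longrightarrow> F x = \<psi> x"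
      using smooth_on_at_sphere[OF \<psi>(1) p] by metis
    thus "\<exists>W F. open W \<and> p \<in> W \<and> Cinf W F \<and> (\<forall>x\<in>W. norm x < 1 \<longrightarrow> F x = \<psi> x)" by blast
  qed
  \<comment> \<open>The displacement of the inverse at y is minus that of \<open>\<phi>\<close> at
    \<open>\<psi> y\<close>. The a priori bound by \<rho> y / 2 from the fixed-point argument makes
    \<rho> at the two points comparable, which transfers the order.\<close>
  moreover have "O_inf (Suc k) (\<lambda>y. \<psi> y - y)"
  proof -
    obtain C where C: "C \<ge> 0" "eventually (\<lambda>x. norm (\<phi> x - x) \<le> C * \<rho> x ^ Suc k) near_inf" using w by (rule O_infE)
    obtain e where e: "e > 0" "\<And>x. 1 - e < norm x \<Longrightarrow> norm x < 1 \<Longrightarrow> norm (\<phi> x - x) \<le> C * \<rho> x ^ Suc k"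
      using C(2) unfolding eventually_near_inf_collar by blast
    have "eventually (\<lambda>x::real^'n. \<rho> x < e / 2) near_inf"
      using e(1) by (intro eventually_rho_less) simp
    moreover have "eventually (\<lambda>x::real^'n. 1 - e / 2 < norm x \<and> norm x < 1) near_inf"
      by (rule eventually_norm_near_inf) (use e in simp)
    ultimately have "eventually (\<lambda>y. norm (\<psi> y - y) \<le> (C * 2 ^ Suc k) * \<rho> y ^ Suc k) near_inf"
      using \<psi>U eventually_rho
    proof eventually_elim
      case (elim y)
      let ?x = "\<psi> y"
      have "norm ?x \<le> norm y + norm (?x - y)" "norm y - norm ?x \<le> norm (?x - y)"
        using norm_triangle_sub[of ?x y] norm_triangle_ineq2[of y ?x] by (auto simp: norm_minus_commute)
      hence x: "1 - e < norm ?x" "norm ?x < 1" using elim rho_le[of y] by linarith+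
      have "\<bar>\<rho> ?x - \<rho> y\<bar> \<le> norm (?x - y)" using x elim by (intro rho_lipschitz) auto
      hence "\<rho> ?x \<le> 2 * \<rho> y" using elim by linarith
      hence "C * \<rho> ?x ^ Suc k \<le> C * (2 * \<rho> y) ^ Suc k"
        using rho_pos[OF x(2)] C(1) by (intro mult_left_mono power_mono) auto
      moreover have "norm (?x - y) = norm (\<phi> ?x - ?x)" using elim by (simp add: norm_minus_commute)
      ultimately show ?case using e(2)[OF x] unfolding power_mult_distrib by (simp only: mult.assoc)
    qed
    thus ?thesis by (rule O_infI)
  qed
  ultimately have near\<psi>: "near_id k \<psi>" by (simp add: near_id_def)
  have inj: "inj_on \<phi> U" by (rule inj_on_inverseI[of _ \<psi>]) (use \<psi>(2) U(2) in blast)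
  have s: "smooth_inf \<phi>" "smooth_inf \<psi>" using near\<phi> near\<psi> by (auto simp: near_id_def)
  have ff: "eventually (\<lambda>x. f x = inverse ((\<rho> x)\<^sup>2) *\<^sub>R (mat 1 + H x)) near_inf"
    using \<phi>(4) unfolding metric_of_def germ_of_eq_iff .
  have id: "eventually (\<lambda>y. \<phi> (\<psi> y) = y) near_inf" using \<psi>U by (rule eventually_mono) simp
  have "eventually (\<lambda>y. push_field U \<phi> f y = inverse ((\<rho> y)\<^sup>2) *\<^sub>R (mat 1 + pull \<psi> H y)) near_inf"
    using \<psi>U jac_cong[OF id] near_id_eventually[OF near\<psi> assms(2) ff] near_id_eventually[OF near\<psi> assms(2) eventually_rho]
      has_derivative_jac[OF s(2)] near_id_eventually[OF near\<psi> assms(2) has_derivative_jac[OF s(1)]] eventually_rho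
  proof eventually_elim
    case (elim y)
    have inv: "inv_into U \<phi> y = \<psi> y" using inv_into_f_f[OF inj, of "\<psi> y"] elim by simp
    \<comment> \<open>Obtained by differentiating \<phi> (\<psi> y) = y; it identifies the matrix
      inverse in \<open>push_field\<close> with the Jacobian of the inverse map.\<close>
    have "jac \<phi> (\<psi> y) ** jac \<psi> y = mat 1"
      using jac_compose[of \<phi> \<psi> y] elim by (simp add: jac_id)
    hence J: "matrix_inv (matrix (frechet_derivative \<phi> (at (\<psi> y)))) = jac \<psi> y"
      unfolding jac_def[symmetric, of \<phi>] by (rule matrix_inv_eqI)
    have "push_field U \<phi> f y = transpose (jac \<psi> y) ** f (\<psi> y) ** jac \<psi> y"
      unfolding push_field_def Let_def inv J ..
    also have "\<dots> = inverse ((\<rho> (\<psi> y))\<^sup>2) *\<^sub>R (transpose (jac \<psi> y) ** (mat 1 + H (\<psi> y)) ** jac \<psi> y)"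
      unfolding elim(3) by (simp only: matrix_mult_simps)
    also have "inverse ((\<rho> (\<psi> y))\<^sup>2) = inverse ((\<rho> y)\<^sup>2) * (\<rho> y / \<rho> (\<psi> y))\<^sup>2"
    proof -
      have "inverse (b\<^sup>2) = inverse (a\<^sup>2) * (a / b)\<^sup>2" if "a > 0" for a b :: real
        using that by (simp add: power_divide inverse_eq_divide)
      thus ?thesis using elim by blast
    qed
    finally show ?case by (simp add: pull_def)
  qed
  hence "push \<Theta> (metric_of H) = metric_of (pull \<psi> H)"
    unfolding \<phi>(5) unfolding metric_of_def germ_of_eq_iff .
  moreover have "eventually (\<lambda>x. \<psi> (\<phi> x) = x) near_inf" using U(3) by (rule eventually_mono) (use \<psi>(2) U(2) in blast)
  ultimately show ?thesis using that near\<phi> near\<psi> by blast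
qed

subsection \<open>Jets\<close>

definition jet_class :: "nat \<Rightarrow> (real^'n \<Rightarrow> real^'n^'n) \<Rightarrow> 'n::finite tensor_germ set" where
  "jet_class l H = vec_class l (tensor_of H)"

lemma jet_class_eq_iff: "jet_class l H = jet_class l H' \<longleftrightarrow> O_inf (Suc l) (\<lambda>x. H x - H' x)"
  by (simp add: jet_class_def vec_class_eq_iff tensor_diff[symmetric] order_b_tensor)

lemma vec_add_jet_class: "vec_add l (jet_class l H) (jet_class l H') = jet_class l (\<lambda>x. H x + H' x)"
  by (simp add: jet_class_def vec_add_class tensor_add)

lemma vec_scale_jet_class: "vec_scale l c (jet_class l H) = jet_class l (\<lambda>x. c *\<^sub>R H x)"
  by (simp add: jet_class_def vec_scale_class tensor_scaleR)

lemma hyp_metric_germ: "k > 0 \<Longrightarrow> germ_of hyp_metric \<in> metric_germs k"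
proof -
  assume "k > 0"
  moreover have "metric_of (\<lambda>x. 0) = germ_of hyp_metric"
    unfolding metric_of_def germ_of_eq_iff by (simp add: hyp_metric_def)
  ultimately show ?thesis using metric_germsI[OF perturb_zero] by metis
qed

lemma jet_diff_hyp_metric:
  assumes "k > 0" "perturb k H"
  shows "jet_diff l (jet k l (metric_of H)) (jet k l (germ_of hyp_metric)) = jet_class l H"
  using jet_diff_jet[OF metric_germsI[OF assms(2,1)] hyp_metric_germ[OF assms(1)]]
  by (simp add: metric_minus_hyp jet_class_def)

lemma jet_vec_metric_of: "k > 0 \<Longrightarrow> perturb k H \<Longrightarrow> jet_vec k l (metric_of H) = jet_class l H"
  by (simp add: jet_vec_def jet_diff_hyp_metric)

lemma jets_eq: "k > 0 \<Longrightarrow> jets k l = {jet k l (metric_of H) | H. perturb k H}"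
proof -
  assume k: "k > 0"
  have "jets k l = jet k l ` metric_germs k"
    unfolding jets_def quotient_def jet_def by blast
  also have "\<dots> = {jet k l (metric_of H) | H. perturb k H}"
    using metric_germsI[OF _ k] by (auto elim!: metric_germsD)
  finally show ?thesis .
qed

lemma jet_eq_iff:
  assumes "k > 0" "perturb k H" "perturb k H'"
  shows "jet k l (metric_of H) = jet k l (metric_of H') \<longleftrightarrow> O_inf (Suc l) (\<lambda>x. H x - H' x)"
  unfolding jet_def
  using eq_equiv_class_iff[OF equiv_jet_rel metric_germsI[OF assms(2,1)] metric_germsI[OF assms(3,1)], of l]
    metric_germsI[OF assms(2,1)] metric_germsI[OF assms(3,1)]
  by (simp add: jet_rel_def metric_diff order_b_tensor)

lemma jet_mem:
  assumes "h \<in> jet k l g"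
  shows "h \<in> metric_germs k" "jet k l h = jet k l g"
  using assms equiv_class_eq[OF equiv_jet_rel, of g h k l] unfolding jet_def by (auto simp: jet_rel_def)

lemma transverse_jets_eq:
  assumes "k > 0"
  shows "transverse_jets k l = {jet k l (metric_of T) | T. perturb k T \<and> radial_free T}"
proof (intro equalityI subsetI)
  fix A assume "A \<in> transverse_jets k l"
  then obtain H g where A: "A = jet k l (metric_of H)" "g \<in> A" "transverse g"
    unfolding transverse_jets_def jets_eq[OF assms] by blast
  have g: "g \<in> metric_germs k" "jet k l g = A" using jet_mem[of g k l "metric_of H"] A by auto
  then obtain T where "perturb k T" "g = metric_of T" by (auto elim: metric_germsD)
  thus "A \<in> {jet k l (metric_of T) | T. perturb k T \<and> radial_free T}"
    using A(3) g(2) transverse_metric by blast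
next
  fix A assume "A \<in> {jet k l (metric_of T) | T. perturb k T \<and> radial_free T}"
  then obtain T where T: "A = jet k l (metric_of T)" "perturb k T" "radial_free T" by blast
  have "metric_of T \<in> A"
    using metric_germsI[OF T(2) assms] by (simp add: T(1) jet_def jet_rel_def order_b_0)
  thus "A \<in> transverse_jets k l"
    unfolding transverse_jets_def jets_eq[OF assms] using T transverse_metric by blast
qed

lemma \<J>_eq: "k > 0 \<Longrightarrow> \<J> k l = {jet_class l H | H. perturb k H}"
  unfolding \<J>_def by (auto simp: jets_eq jet_diff_hyp_metric image_iff) (metis jet_diff_hyp_metric)

lemma \<T>_eq: "k > 0 \<Longrightarrow> \<T> k l = {jet_class l T | T. perturb k T \<and> radial_free T}"
  unfolding \<T>_def by (auto simp: transverse_jets_eq jet_diff_hyp_metric image_iff) (metis jet_diff_hyp_metric)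

text \<open>All members of an l-jet share their l'-jet, so the union in \<open>jet_proj\<close>
  collapses to a single class.\<close>

lemma jet_proj_jet:
  assumes "k > 0" "perturb k H" "l' \<le> l"
  shows "jet_proj k l' (jet k l (metric_of H)) = jet k l' (metric_of H)"
proof -
  have m: "metric_of H \<in> metric_germs k" by (rule metric_germsI[OF assms(2,1)])
  have "jet k l' h = jet k l' (metric_of H)" if h: "h \<in> jet k l (metric_of H)" for h
  proof -
    obtain H' where H': "perturb k H'" "h = metric_of H'" using jet_mem(1)[OF h] by (auto elim: metric_germsD)
    hence "O_inf (Suc l) (\<lambda>x. H' x - H x)"
      using jet_mem(2)[OF h] jet_eq_iff[OF assms(1) H'(1) assms(2)] by simp
    hence "O_inf (Suc l') (\<lambda>x. H' x - H x)" by (rule O_inf_mono) (use assms(3) in simp)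
    thus ?thesis using jet_eq_iff[OF assms(1) H'(1) assms(2)] H'(2) by simp
  qed
  moreover have "metric_of H \<in> jet k l (metric_of H)" using m by (simp add: jet_def jet_rel_def order_b_0)
  ultimately show ?thesis unfolding jet_proj_def by blast
qed

lemma \<J>_transverse_upto_eq:
  assumes "k > 0" "l' \<le> l"
  shows "\<J>_transverse_upto k l l' = {jet_class l H | H. perturb k H \<and>
    (\<exists>T. perturb k T \<and> radial_free T \<and> O_inf (Suc l') (\<lambda>x. H x - T x))}"
proof -
  have "jet_proj k l' (jet k l (metric_of H)) \<in> transverse_jets k l' \<longleftrightarrow>
    (\<exists>T. perturb k T \<and> radial_free T \<and> O_inf (Suc l') (\<lambda>x. H x - T x))" if "perturb k H" for H
    unfolding jet_proj_jet[OF assms(1) that assms(2)] transverse_jets_eq[OF assms(1)]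
    using jet_eq_iff[OF assms(1) that] by blast
  hence eq: "{A \<in> jets k l. jet_proj k l' A \<in> transverse_jets k l'} = {jet k l (metric_of H) | H. perturb k H \<and>
    (\<exists>T. perturb k T \<and> radial_free T \<and> O_inf (Suc l') (\<lambda>x. H x - T x))}"
    unfolding jets_eq[OF assms(1)] by auto
  have img: "(\<lambda>A. jet_diff l A (jet k l (germ_of hyp_metric))) ` {jet k l (metric_of H) | H. perturb k H \<and> P H}
     = {jet_class l H | H. perturb k H \<and> P H}" for P
    using jet_diff_hyp_metric[OF assms(1), of _ l]
    by (auto simp: image_Collect)
  show ?thesis unfolding \<J>_transverse_upto_def eq img ..
qed

text \<open>Translates an adjustment into the calculus of perturbations. The last conclusion
  presents the original metric as a pull-back of its adjusted form, the shape in which linearization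
  around a transverse metric applies.\<close>

lemma adjustment_diffeoE:
  assumes "k > 0" "g \<in> metric_germs k" "adjustment_diffeo k g \<Theta>"
  obtains H \<phi> \<psi> where "perturb k H" "g = metric_of H" "near_id k \<phi>" "near_id k \<psi>"
    "push \<Theta> g = metric_of (pull \<psi> H)" "perturb k (pull \<psi> H)" "radial_free (pull \<psi> H)"
    "eventually (\<lambda>x. pull \<phi> (pull \<psi> H) x = H x) near_inf"
proof -
  obtain H where H: "perturb k H" "g = metric_of H" using assms(2) by (rule metric_germsD)
  have \<Theta>: "\<Theta> \<in> I0 (k + 1)" "transverse (push \<Theta> g)" using assms(3) by (auto simp: adjustment_diffeo_def)
  obtain \<phi> \<psi> where p: "near_id k \<phi>" "near_id k \<psi>" "eventually (\<lambda>x. \<psi> (\<phi> x) = x) near_inf"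
    "push \<Theta> (metric_of H) = metric_of (pull \<psi> H)"
    using \<Theta>(1) assms(1) by (rule push_metric)
  have "eventually (\<lambda>x. pull \<phi> (pull \<psi> H) x = H x) near_inf"
    using pull_compose[OF p(2,1) assms(1), of H] pull_identity[OF p(3), of H] by eventually_elim simp
  moreover have push: "push \<Theta> g = metric_of (pull \<psi> H)" using p(4) H(2) by simp
  moreover have "radial_free (pull \<psi> H)" using \<Theta>(2) unfolding push transverse_metric .
  ultimately show ?thesis by (intro that[OF H p(1,2)] perturb_pull[OF p(2) assms(1) H(1)])
qed

text \<open>The map \<open>\<phi>' \<circ> \<psi>\<close> relates the two transverse metrics up to \<open>O(\<rho>\<^sup>l\<^sup>+\<^sup>1)\<close>.\<close>

lemma adjusted_jet_unique:
  assumes "k > 0" "perturb k H" "perturb k H'" "near_id k \<psi>" "near_id k \<phi>'" "near_id k \<psi>'"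
    and "radial_free (pull \<psi> H)" "radial_free (pull \<psi>' H')"
    and inv: "eventually (\<lambda>x. pull \<phi>' (pull \<psi>' H') x = H' x) near_inf"
    and l: "O_inf (Suc l) (\<lambda>x. H x - H' x)"
  shows "O_inf (Suc l) (\<lambda>x. pull \<psi> H x - pull \<psi>' H' x)"
proof (rule transverse_gauge_uniqueness(2)[OF assms(1) _ _ assms(7,8)])
  show "perturb k (pull \<psi> H)" "perturb k (pull \<psi>' H')" using perturb_pull assms by auto
  show "near_id k (\<lambda>x. \<phi>' (\<psi> x))" by (rule near_id_compose[OF assms(5,4,1)])
  \<comment> \<open>Pull-back by a fixed map preserves the order of differences, so \<open>H\<close>
    may be exchanged for \<open>H'\<close>, which is itself a pull-back of the second transverse
    metric.\<close>
  have "O_inf (Suc l) (\<lambda>x. pull \<psi> H' x - pull \<psi> H x)"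
    by (rule O_inf_pull_diff[OF assms(4,1)]) (use O_inf_minus[OF l] in simp)
  moreover have "eventually (\<lambda>x. pull \<psi> H' x - pull \<psi> H x = pull (\<lambda>x. \<phi>' (\<psi> x)) (pull \<psi>' H') x - pull \<psi> H x) near_inf"
    using pull_compose[OF assms(5,4,1), of "pull \<psi>' H'"] near_id_eventually[OF assms(4,1) inv]
  proof eventually_elim
    case (elim x)
    have "pull \<psi> H' x = pull \<psi> (pull \<phi>' (pull \<psi>' H')) x" by (simp only: pull_def[of \<psi>] elim(2))
    thus ?case using elim(1) by simp
  qed
  ultimately show "O_inf (Suc l) (\<lambda>x. pull (\<lambda>x. \<phi>' (\<psi> x)) (pull \<psi>' H') x - pull \<psi> H x)"
    by (rule O_inf_cong[rotated])
qed

text \<open>The witnessing gauge field is the displacement of \<open>\<phi>\<close>. The transverse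
  tensor \<open>T\<close> serves only to raise the order of \<open>\<phi>\<close>: it and the
  adjusted metric are both transverse and are related by \<open>\<phi>\<close> up to
  O(\<rho>^(l'+1)), so \<open>\<phi>\<close> has order q \<ge> l' + 1 and the error k + q reaches l
  + 1.\<close>

lemma adjusted_jet_linear:
  assumes "k > 0" "perturb k H" "near_id k \<phi>" "near_id k \<psi>" "radial_free (pull \<psi> H)"
    and inv: "eventually (\<lambda>x. pull \<phi> (pull \<psi> H) x = H x) near_inf"
    and T: "perturb k T" "radial_free T" "O_inf (Suc l') (\<lambda>x. H x - T x)" and "l \<le> k + l'"
  shows "lin_adjusted k (Suc l) H (pull \<psi> H)"
proof -
  define q where "q = max k (Suc l')"
  let ?T = "pull \<psi> H"
  have pT: "perturb k ?T" using perturb_pull assms by auto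
  have "O_inf (Suc l') (\<lambda>x. pull \<phi> ?T x - T x)"
    by (rule O_inf_cong[OF _ T(3)]) (use inv in \<open>rule eventually_mono, simp\<close>)
  hence q: "near_id q \<phi>"
    unfolding q_def by (rule transverse_gauge_uniqueness(1)[OF assms(1) T(1) pT T(2) assms(5,3)])
  have "O_inf (k + q) (\<lambda>x. pull \<phi> ?T x - ?T x - Lie (\<lambda>x. \<phi> x - x) x)"
    by (rule pull_linearization[OF q assms(1)]) (use pT in \<open>auto simp: q_def perturb_def\<close>)
  hence "O_inf (Suc l) (\<lambda>x. pull \<phi> ?T x - ?T x - Lie (\<lambda>x. \<phi> x - x) x)"
    by (rule O_inf_mono) (use assms(1,10) in \<open>auto simp: q_def\<close>)
  hence "O_inf (Suc l) (\<lambda>x. H x - ?T x - Lie (\<lambda>x. \<phi> x - x) x)"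
    by (rule O_inf_cong[rotated]) (use inv in \<open>rule eventually_mono, simp\<close>)
  moreover have "smooth_inf (\<lambda>x. \<phi> x - x)" "O_inf (Suc k) (\<lambda>x. \<phi> x - x)"
    using assms(3) by (auto simp: near_id_def intro: smooth_inf_intros)
  ultimately show ?thesis unfolding lin_adjusted_def using pT assms(5) by blast
qed

theorem proposition2p16:
  fixes k l :: nat
  assumes "k > 0" and "l > 0"
  shows "\<exists>\<theta> :: 'n::finite tensor_germ set \<Rightarrow> 'n tensor_germ set.
    \<theta> \<in> \<J> k l \<rightarrow> \<T> k l \<and>
    (\<forall>g\<in>metric_germs k. \<forall>\<Theta>. adjustment_diffeo k g \<Theta> \<longrightarrow> \<theta> (jet_vec k l g) = jet_vec k l (push \<Theta> g)) \<and>
    (l < 2 * k \<longrightarrow> linear_on_jets l (\<J> k l) \<theta>) \<and>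
    (\<forall>l'\<le>l. l \<le> k + l' \<longrightarrow> linear_on_jets l (\<J>_transverse_upto k l l') \<theta>)"
proof -
  \<comment> \<open>Truncated subtraction gives the least l' with l \<le> k + l'; the jets
    transverse up to a larger order form a subset.\<close>
  let ?S = "\<J>_transverse_upto k l (l - k) :: 'n tensor_germ set set"
  \<comment> \<open>The constraints on the value B at one jet A: compatibility with every adjustment
    of every metric with that jet, and agreement with the linearized adjustment where linearity is
    claimed. The map is then chosen jet by jet.\<close>
  define Q where "Q A B \<longleftrightarrow> B \<in> \<T> k l \<and>
     (\<forall>g\<in>metric_germs k. \<forall>\<Theta>. adjustment_diffeo k g \<Theta> \<longrightarrow> jet_vec k l g = A \<longrightarrow> B = jet_vec k l (push \<Theta> g)) \<and>
     (A \<in> ?S \<longrightarrow> (\<forall>H T. perturb k H \<longrightarrow> A = jet_class l H \<longrightarrow> lin_adjusted k (Suc l) H T \<longrightarrow> B = jet_class l T))"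
    for A B :: "'n tensor_germ set"
  have S_eq: "?S = {jet_class l H | H. perturb k H \<and>
    (\<exists>T. perturb k T \<and> radial_free T \<and> O_inf (Suc (l - k)) (\<lambda>x. H x - T x))}"
    by (rule \<J>_transverse_upto_eq[OF assms(1)]) simp
  have lin_eq: "jet_class l T = jet_class l T'"
    if "lin_adjusted k (Suc l) H T" "lin_adjusted k (Suc l) H' T'" "jet_class l H = jet_class l H'"
    for H T H' T' :: "real^'n \<Rightarrow> real^'n^'n"
    using lin_adjusted_unique[OF assms(1) that(1,2)] that(3) by (simp add: jet_class_eq_iff)
  \<comment> \<open>If some metric with jet A has an adjustment, its adjusted jet is the candidate
    and must be compared with other adjustments and with the linear solution. Otherwise the linear
    solution is the candidate and the first comparison is vacuous.\<close>
  have "\<exists>B. Q A B" if A: "A \<in> \<J> k l" for A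
  proof (cases "\<exists>g\<in>metric_germs k. \<exists>\<Theta>. adjustment_diffeo k g \<Theta> \<and> jet_vec k l g = A")
    case True
    then obtain g \<Theta> where g: "g \<in> metric_germs k" "adjustment_diffeo k g \<Theta>" "jet_vec k l g = A" by blast
    obtain H \<phi> \<psi> where H: "perturb k H" "g = metric_of H" "near_id k \<phi>" "near_id k \<psi>"
      "push \<Theta> g = metric_of (pull \<psi> H)" "perturb k (pull \<psi> H)" "radial_free (pull \<psi> H)"
      "eventually (\<lambda>x. pull \<phi> (pull \<psi> H) x = H x) near_inf"
      using assms(1) g(1,2) by (rule adjustment_diffeoE)
    have AH: "A = jet_class l H" using g(3) H(1,2) by (simp add: jet_vec_metric_of assms(1))
    have "Q A (jet_class l (pull \<psi> H))"
      unfolding Q_def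
    proof (intro conjI ballI allI impI)
      show "jet_class l (pull \<psi> H) \<in> \<T> k l" using H \<T>_eq[OF assms(1)] by blast
    next
      fix g' \<Theta>' assume g': "g' \<in> metric_germs k" "adjustment_diffeo k g' \<Theta>'" "jet_vec k l g' = A"
      obtain H' \<phi>' \<psi>' where H': "perturb k H'" "g' = metric_of H'" "near_id k \<phi>'" "near_id k \<psi>'"
        "push \<Theta>' g' = metric_of (pull \<psi>' H')" "perturb k (pull \<psi>' H')" "radial_free (pull \<psi>' H')"
        "eventually (\<lambda>x. pull \<phi>' (pull \<psi>' H') x = H' x) near_inf"
        using assms(1) g'(1,2) by (rule adjustment_diffeoE)
      have AH': "A = jet_class l H'" using g'(3) H'(1,2) by (simp add: jet_vec_metric_of assms(1))
      have "jet_class l H = jet_class l H'" using AH AH' by metis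
      hence "O_inf (Suc l) (\<lambda>x. H x - H' x)" by (simp only: jet_class_eq_iff)
      from adjusted_jet_unique[OF assms(1) H(1) H'(1) H(4) H'(3,4) H(7) H'(7,8) this]
      show "jet_class l (pull \<psi> H) = jet_vec k l (push \<Theta>' g')"
        using H'(5,6) by (simp add: jet_vec_metric_of[OF assms(1)] jet_class_eq_iff)
    next
      fix H' T' assume "A \<in> ?S" and H': "perturb k H'" "A = jet_class l H'" "lin_adjusted k (Suc l) H' T'"
      then obtain H0 T where T: "A = jet_class l H0" "perturb k T" "radial_free T" "O_inf (Suc (l - k)) (\<lambda>x. H0 x - T x)"
        unfolding S_eq by blast
      have "jet_class l H = jet_class l H0" using AH T(1) by metis
      hence HH0: "O_inf (Suc l) (\<lambda>x. H x - H0 x)" by (simp only: jet_class_eq_iff)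
      have "O_inf (Suc (l - k)) (\<lambda>x. (H x - H0 x) + (H0 x - T x))"
        by (intro O_inf_add T O_inf_mono[OF HH0]) simp
      hence "O_inf (Suc (l - k)) (\<lambda>x. H x - T x)" by simp
      hence "lin_adjusted k (Suc l) H (pull \<psi> H)"
        by (intro adjusted_jet_linear[OF assms(1) H(1,3,4,7,8) T(2,3)]) auto
      thus "jet_class l (pull \<psi> H) = jet_class l T'" using lin_eq[OF _ H'(3)] AH H'(2) by simp
    qed
    thus ?thesis by blast
  next
    case False
    obtain H where H: "A = jet_class l H" "perturb k H" using A \<J>_eq[OF assms(1)] by blast
    obtain T where T: "lin_adjusted k (Suc l) H T" using lin_adjusted_exists[OF assms(1) H(2)] by blast
    have "jet_class l T \<in> \<T> k l" using T unfolding \<T>_eq[OF assms(1)] lin_adjusted_def by blast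
    hence "Q A (jet_class l T)" unfolding Q_def using False lin_eq[OF T] H by auto
    thus ?thesis by blast
  qed
  then obtain \<theta> where \<theta>: "\<And>A. A \<in> \<J> k l \<Longrightarrow> Q A (\<theta> A)" by metis
  have lin: "linear_on_jets l (\<J>_transverse_upto k l l' :: 'n tensor_germ set set) \<theta>" if l': "l' \<le> l" "l \<le> k + l'" for l'
  proof -
    let ?S' = "\<J>_transverse_upto k l l' :: 'n tensor_germ set set"
    note S'_eq = \<J>_transverse_upto_eq[OF assms(1) l'(1)]
    have S'S: "?S' \<subseteq> ?S"
    proof
      fix A :: "'n tensor_germ set" assume "A \<in> ?S'"
      then obtain H T where "A = jet_class l H" "perturb k H" "perturb k T" "radial_free T" "O_inf (Suc l') (\<lambda>x. H x - T x)"
        unfolding S'_eq by blast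
      moreover from this(5) have "O_inf (Suc (l - k)) (\<lambda>x. H x - T x)" by (rule O_inf_mono) (use l' in simp)
      ultimately show "A \<in> ?S" unfolding S_eq by blast
    qed
    have SJ: "?S \<subseteq> \<J> k l" unfolding S_eq \<J>_eq[OF assms(1)] by blast
    have \<theta>_eq: "\<theta> (jet_class l H) = jet_class l T"
      if "jet_class l H \<in> ?S'" "perturb k H" "lin_adjusted k (Suc l) H T" for H T
      using \<theta>[of "jet_class l H"] that S'S SJ unfolding Q_def by blast
    show ?thesis
      unfolding linear_on_jets_def
    proof (intro conjI ballI allI)
      fix A B :: "'n tensor_germ set" assume AB: "A \<in> ?S'" "B \<in> ?S'"
      obtain H T where H: "A = jet_class l H" "perturb k H" "perturb k T" "radial_free T" "O_inf (Suc l') (\<lambda>x. H x - T x)"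
        using AB(1) unfolding S'_eq by blast
      obtain H' T' where H': "B = jet_class l H'" "perturb k H'" "perturb k T'" "radial_free T'" "O_inf (Suc l') (\<lambda>x. H' x - T' x)"
        using AB(2) unfolding S'_eq by blast
      have "O_inf (Suc l') (\<lambda>x. (H x - T x) + (H' x - T' x))" by (intro O_inf_add H H')
      hence "O_inf (Suc l') (\<lambda>x. (H x + H' x) - (T x + T' x))" by (simp add: add_diff_add)
      thus S: "vec_add l A B \<in> ?S'"
        unfolding S'_eq H(1) H'(1) vec_add_jet_class using H H' perturb_add radial_free_add by blast
      \<comment> \<open>The tensors \<open>T\<close> and \<open>T'\<close> match their metrics only
        to order l' and certify membership; the values of \<theta> are given by linearized
        adjustments valid to order l.\<close>
      obtain L L' where L: "lin_adjusted k (Suc l) H L" "lin_adjusted k (Suc l) H' L'"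
        using lin_adjusted_exists[OF assms(1)] H(2) H'(2) by metis
      show "\<theta> (vec_add l A B) = vec_add l (\<theta> A) (\<theta> B)"
        using \<theta>_eq[OF _ perturb_add[OF H(2) H'(2)] lin_adjusted_add[OF L]] \<theta>_eq[OF _ H(2) L(1)] \<theta>_eq[OF _ H'(2) L(2)] S AB
        unfolding H(1) H'(1) vec_add_jet_class by (simp add: vec_add_jet_class)
    next
      fix A :: "'n tensor_germ set" and c assume A: "A \<in> ?S'"
      obtain H T where H: "A = jet_class l H" "perturb k H" "perturb k T" "radial_free T" "O_inf (Suc l') (\<lambda>x. H x - T x)"
        using A unfolding S'_eq by blast
      have "O_inf (Suc l') (\<lambda>x. c *\<^sub>R (H x - T x))" by (intro O_inf_linear[OF bounded_linear_scaleR_right] H)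
      hence "O_inf (Suc l') (\<lambda>x. c *\<^sub>R H x - c *\<^sub>R T x)" by (simp add: scaleR_diff_right)
      thus S: "vec_scale l c A \<in> ?S'"
        unfolding S'_eq H(1) vec_scale_jet_class using H perturb_scaleR radial_free_scaleR by blast
      obtain L where L: "lin_adjusted k (Suc l) H L" using lin_adjusted_exists[OF assms(1)] H(2) by metis
      show "\<theta> (vec_scale l c A) = vec_scale l c (\<theta> A)"
        using \<theta>_eq[OF _ perturb_scaleR[OF H(2)] lin_adjusted_scaleR[OF L], of c] \<theta>_eq[OF _ H(2) L] S A
        unfolding H(1) vec_scale_jet_class by (simp add: vec_scale_jet_class)
    qed
  qed
  \<comment> \<open>For l < 2 k one has l - k + 1 \<le> k, also when l < k because k > 0. So H =
    O(\<rho>^k) agrees with T = 0 to the required order and every jet lies in the largest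
    set.\<close>
  have J: "linear_on_jets l (\<J> k l) \<theta>" if "l < 2 * k"
  proof -
    have "O_inf (Suc (l - k)) (\<lambda>x. H x - 0)" if "perturb k H" for H :: "real^'n \<Rightarrow> real^'n^'n"
      using that \<open>l < 2 * k\<close> by (auto simp: perturb_def intro: O_inf_mono)
    hence "\<J> k l = ?S" unfolding S_eq \<J>_eq[OF assms(1)] using perturb_zero radial_free_zero by blast
    thus ?thesis using lin[of "l - k"] by simp
  qed
  have "\<theta> \<in> \<J> k l \<rightarrow> \<T> k l" using \<theta> unfolding Q_def by blast
  moreover have "\<theta> (jet_vec k l g) = jet_vec k l (push \<Theta> g)"
    if g: "g \<in> metric_germs k" "adjustment_diffeo k g \<Theta>" for g \<Theta>
  proof -
    obtain H where "perturb k H" "g = metric_of H" using g(1) by (rule metric_germsD)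
    hence "jet_vec k l g \<in> \<J> k l" using jet_vec_metric_of[OF assms(1)] \<J>_eq[OF assms(1)] by blast
    thus ?thesis using \<theta> g unfolding Q_def by blast
  qed
  ultimately show ?thesis using J lin by blast
qed

end
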